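(* Let $\lambda,\lambda'\in I_n$ and $T=V(n,\lambda)\otimes V(n,\lambda')$, a $D(H_{\mathcal D})$-module. (1) If $\lambda\lambda'\in I_n'$, then $T\cong\bigoplus_{s=0}^{n-1}V(n,\phi^s\lambda\lambda')$. (2) If there exists an integer $0\leq l\leq n-1$ such that $\lambda\lambda'\in I_l$ (where $I_0:=I_n''$), then $$T\cong\Big(\bigoplus_{c(l)\leq s\leq l}P(n+l-2s,\phi^s\lambda\lambda')\Big)\oplus\Big(\bigoplus_{c(n+l)\leq s\leq n-1}P(2n+l-2s,\phi^s\lambda\lambda')\Big).$$
   Context: Let $\Bbbk$ be an algebraically closed field of characteristic $0$; all modules are finite-dimensional left modules. $\mathcal D=(G,\chi,a,\alpha)$ is a group datum with $G$ abelian: $G$ is a finite abelian group, $\chi\in\Gamma:=\mathrm{Hom}(G,\Bbbk^\times)$, $a\in G$, $\alpha\in\Bbbk$, and, with $\rho=\chi(a)$ of order $n\geq 2$, either $\chi^n=1$ or $\alpha(a^n-1)=0$. $\mathcal D$ is of nilpotent type if $\alpha(a^n-1)=0$, and of non-nilpotent type if $\alpha(a^n-1)\neq0$ and $\chi^n=1$ (then $\alpha=1$ is assumed). Put $(i)_\rho=1+\rho+\cdots+\rho^{i-1}$, $(i)!_\rho=(i)_\rho\cdots(1)_\rho$, $(0)!_\rho=1$. The Drinfeld double $D(H_{\mathcal D})$ is the Hopf algebra generated as an algebra by the groups $G,\Gamma$ and elements $x,\xi$, with the group relations of $G$ and $\Gamma$ and: $x^n=\alpha(a^n-1)$, $xg=\chi(g)gx$,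 $\xi^n=0$, $\xi\gamma=\gamma(a)\gamma\xi$, $g\gamma=\gamma g$, $\xi g=\chi^{-1}(g)g\xi$, $x\xi-\xi x=a-\chi$, and $\gamma(a)x\gamma=\gamma x$ in the nilpotent case, $\gamma(a)x\gamma=\gamma x+\frac{\gamma^n(a)-1}{(n-1)!_\rho}\gamma(\rho a-\chi)\xi^{n-1}$ in the non-nilpotent case ($g\in G,\gamma\in\Gamma$). Comultiplication: $\Delta(g)=g\otimes g$, $\Delta(x)=x\otimes a+1\otimes x$, $\Delta(\xi)=\xi\otimes1+\chi\otimes\xi$, and $\Delta(\gamma)=\gamma\otimes\gamma$ in the nilpotent case, $\Delta(\gamma)=\gamma\otimes\gamma+(\gamma^n(a)-1)\sum_{p+r=n,\,p,r\geq1}\frac{1}{(p)!_\rho(r)!_\rho}\gamma\chi^p\xi^r\otimes\gamma\xi^p$ in the non-nilpotent case. Tensor products of modules are over $\Bbbk$ with action via $\Delta$. $\Lambda$ is the group of characters $G\times\Gamma\to\Bbbk^\times$; $\phi\in\Lambda$ is $\phi(g\gamma)=\chi^{-1}(g)\gamma(a)$. For $1\leq l\leq n-1$, $I_l=\{\lambda\in\Lambda:\lambda(a\chi^{-1})=\rho^{l-1}\}$; $I_0:=I_n''=\{\lambda\in\Lambda:\lambda(a\chi^{-1})=\rho^{n-1}\}$; $I_n'=\{\lambda\in\Lambda:\lambda(a\chi^{-1})\neq\rho^k\text{ for all }0\leq k\leq n-1\}$; $I_n=I_n'\cup I_n''$. For $1\leq l\leq n$, $\lambda\in I_l$, let $\alpha_i(l,\lambda)=(i)_\rho(\lambda(\chi)-\lambda(a)\rho^{1-i})$.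 $V(l,\lambda)$ is the simple module with basis $v_0,\dots,v_{l-1}$ and $(g\gamma)v_i=(\phi^i\lambda)(g\gamma)v_i$; $xv_i=v_{i+1}$ for $i\leq l-2$; $\xi v_0=0$, $\xi v_i=\alpha_i(l,\lambda)v_{i-1}$ for $i\geq1$; $xv_{l-1}=0$ if $l<n$ or $\mathcal D$ is nilpotent, and $xv_{n-1}=(\lambda(a)^n-1)v_0$ if $l=n$ and $\mathcal D$ is non-nilpotent. These form a complete set of representatives of simple modules. For $1\leq l\leq n-1$, $P(l,\lambda)$ is the projective cover of $V(l,\lambda)$ (of dimension $2n$); $V(n,\lambda)$ is projective and $P(n,\lambda):=V(n,\lambda)$ for $\lambda\in I_n$. For an integer $t$, $c(t)=\lfloor (t+1)/2\rfloor$. Empty direct sums are $0$. *)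

theory Defs
  imports
    "HOL-Algebra.Multiplicative_Group"
    "HOL-Computational_Algebra.Polynomial"
    "Jordan_Normal_Form.Matrix"
begin

section \<open>Characters and group data\<close>

definition unit_grp :: "'k::field monoid" where
  "unit_grp = \<lparr>carrier = - {0}, monoid.mult = (*), one = 1\<rparr>"

text \<open>
  The group of homomorphisms to the multiplicative group of the field. Its elements are
  extensional functions, so that equality of characters is equality in the function type.
\<close>

definition dual_grp :: "('a, 'm) monoid_scheme \<Rightarrow> ('a \<Rightarrow> 'k::field) monoid" where
  "dual_grp G = \<lparr>carrier = hom G unit_grp \<inter> extensional (carrier G),
     monoid.mult = (\<lambda>\<gamma> \<delta>. \<lambda>g\<in>carrier G. \<gamma> g * \<delta> g),
     one = (\<lambda>g\<in>carrier G. 1)\<rparr>"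

record ('g, 'k) gdatum =
  grp :: "'g monoid"
  chi :: "'g \<Rightarrow> 'k"
  elt :: 'g
  alp :: 'k

abbreviation Gam :: "('g, 'k::field) gdatum \<Rightarrow> ('g \<Rightarrow> 'k) monoid" where
  "Gam D \<equiv> dual_grp (grp D)"

abbreviation Lam :: "('g, 'k::field) gdatum \<Rightarrow> ('g \<times> ('g \<Rightarrow> 'k) \<Rightarrow> 'k) monoid" where
  "Lam D \<equiv> dual_grp (grp D \<times>\<times> Gam D)"

definition rho :: "('g, 'k) gdatum \<Rightarrow> 'k" where
  "rho D = chi D (elt D)"

definition ordn :: "('g, 'k::field) gdatum \<Rightarrow> nat" where
  "ordn D = group.ord unit_grp (rho D)"

text \<open>
  The condition \<open>\<alpha> (a\<^sup>n - 1) = 0\<close> is an equation in the group algebra of \<open>G\<close>, where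
  distinct group elements are linearly independent.
\<close>

definition nilpotent_type :: "('g, 'k::field) gdatum \<Rightarrow> bool" where
  "nilpotent_type D \<longleftrightarrow> alp D = 0 \<or> elt D [^]\<^bsub>grp D\<^esub> ordn D = \<one>\<^bsub>grp D\<^esub>"

text \<open>In the non-nilpotent case the scalar \<open>\<alpha>\<close> is normalised to \<open>1\<close>.\<close>

definition abelian_group_datum :: "('g, 'k::field) gdatum \<Rightarrow> bool" where
  "abelian_group_datum D \<longleftrightarrow>
     comm_group (grp D) \<and> finite (carrier (grp D)) \<and>
     chi D \<in> carrier (Gam D) \<and> elt D \<in> carrier (grp D) \<and> 2 \<le> ordn D \<and>
     (chi D [^]\<^bsub>Gam D\<^esub> ordn D = \<one>\<^bsub>Gam D\<^esub> \<or> nilpotent_type D) \<and>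
     (\<not> nilpotent_type D \<longrightarrow> alp D = 1)"

definition qnum :: "'k::field \<Rightarrow> nat \<Rightarrow> 'k" where
  "qnum q i = (\<Sum>j<i. q ^ j)"

definition qfact :: "'k::field \<Rightarrow> nat \<Rightarrow> 'k" where
  "qfact q i = (\<Prod>j=1..i. qnum q j)"


section \<open>The Drinfeld double by generators and relations\<close>

datatype ('g, 'k) gen = Grp 'g | Chr "'g \<Rightarrow> 'k" | GenX | GenXi

text \<open>
  Noncommutative polynomial expressions with letters in \<open>'s\<close> and coefficients in \<open>'k\<close>. They
  are purely syntactic; the algebra laws hold in every evaluation.
\<close>

datatype ('s, 'k) ncpoly =
    Gen 's
  | Scal 'k
  | Plus "('s, 'k) ncpoly" "('s, 'k) ncpoly"
  | Minus "('s, 'k) ncpoly" "('s, 'k) ncpoly"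
  | Times "('s, 'k) ncpoly" "('s, 'k) ncpoly"

instantiation ncpoly :: (type, zero_neq_one) "{zero, one, plus, minus, times}"
begin

definition zero_ncpoly :: "('a, 'b) ncpoly" where "0 = Scal 0"
definition one_ncpoly :: "('a, 'b) ncpoly" where "1 = Scal 1"
definition plus_ncpoly :: "('a, 'b) ncpoly \<Rightarrow> ('a, 'b) ncpoly \<Rightarrow> ('a, 'b) ncpoly"
  where "p + q = Plus p q"
definition minus_ncpoly :: "('a, 'b) ncpoly \<Rightarrow> ('a, 'b) ncpoly \<Rightarrow> ('a, 'b) ncpoly"
  where "p - q = Minus p q"
definition times_ncpoly :: "('a, 'b) ncpoly \<Rightarrow> ('a, 'b) ncpoly \<Rightarrow> ('a, 'b) ncpoly"
  where "p * q = Times p q"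

instance ..

end

instance ncpoly :: (type, zero_neq_one) power ..

text \<open>Evaluation in the algebra of \<open>d \<times> d\<close> matrices.\<close>

primrec eval_nc :: "nat \<Rightarrow> ('s \<Rightarrow> 'k::field mat) \<Rightarrow> ('s, 'k) ncpoly \<Rightarrow> 'k mat" where
  "eval_nc d R (Gen s) = R s"
| "eval_nc d R (Scal c) = c \<cdot>\<^sub>m 1\<^sub>m d"
| "eval_nc d R (Plus p q) = eval_nc d R p + eval_nc d R q"
| "eval_nc d R (Minus p q) = eval_nc d R p - eval_nc d R q"
| "eval_nc d R (Times p q) = eval_nc d R p * eval_nc d R q"

abbreviation gG :: "'g \<Rightarrow> (('g, 'k) gen, 'k) ncpoly" where "gG g \<equiv> Gen (Grp g)"
abbreviation gC :: "('g \<Rightarrow> 'k) \<Rightarrow> (('g, 'k) gen, 'k) ncpoly" where "gC \<gamma> \<equiv> Gen (Chr \<gamma>)"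
abbreviation gX :: "(('g, 'k) gen, 'k) ncpoly" where "gX \<equiv> Gen GenX"
abbreviation gXi :: "(('g, 'k) gen, 'k) ncpoly" where "gXi \<equiv> Gen GenXi"

definition dd_gens :: "('g, 'k::field) gdatum \<Rightarrow> ('g, 'k) gen set" where
  "dd_gens D = Grp ` carrier (grp D) \<union> Chr ` carrier (Gam D) \<union> {GenX, GenXi}"

text \<open>A pair \<open>(p, q)\<close> stands for the relation \<open>p = q\<close>.\<close>

definition dd_relations ::
  "('g, 'k::field) gdatum \<Rightarrow> ((('g, 'k) gen, 'k) ncpoly \<times> (('g, 'k) gen, 'k) ncpoly) set" where
  "dd_relations D = (let G = grp D; \<Gamma> = Gam D; \<chi> = chi D; a = elt D; \<alpha> = alp D;
       \<rho> = rho D; n = ordn D in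
     {(gG \<one>\<^bsub>G\<^esub>, 1), (gC \<one>\<^bsub>\<Gamma>\<^esub>, 1)} \<union>
     {(gG g * gG h, gG (g \<otimes>\<^bsub>G\<^esub> h)) | g h. g \<in> carrier G \<and> h \<in> carrier G} \<union>
     {(gC \<gamma> * gC \<delta>, gC (\<gamma> \<otimes>\<^bsub>\<Gamma>\<^esub> \<delta>)) | \<gamma> \<delta>. \<gamma> \<in> carrier \<Gamma> \<and> \<delta> \<in> carrier \<Gamma>} \<union>
     {(gX ^ n, Scal \<alpha> * (gG (a [^]\<^bsub>G\<^esub> n) - 1)), (gXi ^ n, 0)} \<union>
     {(gX * gG g, Scal (\<chi> g) * gG g * gX) | g. g \<in> carrier G} \<union>
     {(gXi * gC \<gamma>, Scal (\<gamma> a) * gC \<gamma> * gXi) | \<gamma>. \<gamma> \<in> carrier \<Gamma>} \<union>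
     {(gG g * gC \<gamma>, gC \<gamma> * gG g) | g \<gamma>. g \<in> carrier G \<and> \<gamma> \<in> carrier \<Gamma>} \<union>
     {(gXi * gG g, Scal (inverse (\<chi> g)) * gG g * gXi) | g. g \<in> carrier G} \<union>
     {(gX * gXi - gXi * gX, gG a - gC \<chi>)} \<union>
     (if nilpotent_type D
      then {(Scal (\<gamma> a) * gX * gC \<gamma>, gC \<gamma> * gX) | \<gamma>. \<gamma> \<in> carrier \<Gamma>}
      else {(Scal (\<gamma> a) * gX * gC \<gamma>,
             gC \<gamma> * gX + Scal (((\<gamma> a) ^ n - 1) / qfact \<rho> (n - 1)) * gC \<gamma> *
               (Scal \<rho> * gG a - gC \<chi>) * gXi ^ (n - 1)) | \<gamma>. \<gamma> \<in> carrier \<Gamma>}))"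

text \<open>
  Comultiplication on generators; a list of pairs \<open>(p, q)\<close> stands for the sum of the
  tensors \<open>p \<otimes> q\<close>.
\<close>

fun dd_comult :: "('g, 'k::field) gdatum \<Rightarrow> ('g, 'k) gen \<Rightarrow>
    ((('g, 'k) gen, 'k) ncpoly \<times> (('g, 'k) gen, 'k) ncpoly) list" where
  "dd_comult D (Grp g) = [(gG g, gG g)]"
| "dd_comult D GenX = [(gX, gG (elt D)), (1, gX)]"
| "dd_comult D GenXi = [(gXi, 1), (gC (chi D), gXi)]"
| "dd_comult D (Chr \<gamma>) = (gC \<gamma>, gC \<gamma>) #
     (if nilpotent_type D then []
      else map (\<lambda>p. let r = ordn D - p in
        (Scal (((\<gamma> (elt D)) ^ ordn D - 1) / (qfact (rho D) p * qfact (rho D) r)) *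
           gC \<gamma> * gC (chi D [^]\<^bsub>Gam D\<^esub> p) * gXi ^ r,
         gC \<gamma> * gXi ^ p)) [1..<ordn D])"


section \<open>Finite-dimensional modules\<close>

text \<open>
  A finite-dimensional left module with a chosen basis, acting on column vectors: its dimension
  and the matrices of the generators. Values of \<open>mact\<close> outside \<open>dd_gens\<close> are irrelevant.
\<close>

record ('g, 'k) dmod =
  mdim :: nat
  mact :: "('g, 'k) gen \<Rightarrow> 'k mat"

abbreviation meval :: "('g, 'k::field) dmod \<Rightarrow> (('g, 'k) gen, 'k) ncpoly \<Rightarrow> 'k mat" where
  "meval M \<equiv> eval_nc (mdim M) (mact M)"

definition is_dmod :: "('g, 'k::field) gdatum \<Rightarrow> ('g, 'k) dmod \<Rightarrow> bool" where
  "is_dmod D M \<longleftrightarrow>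
     (\<forall>s\<in>dd_gens D. mact M s \<in> carrier_mat (mdim M) (mdim M)) \<and>
     (\<forall>(p, q)\<in>dd_relations D. meval M p = meval M q)"

definition mod_hom :: "('g, 'k::field) gdatum \<Rightarrow> ('g, 'k) dmod \<Rightarrow> ('g, 'k) dmod \<Rightarrow> 'k mat set" where
  "mod_hom D M N = {f \<in> carrier_mat (mdim N) (mdim M).
     \<forall>s\<in>dd_gens D. f * mact M s = mact N s * f}"

definition mod_iso :: "('g, 'k::field) gdatum \<Rightarrow> ('g, 'k) dmod \<Rightarrow> ('g, 'k) dmod \<Rightarrow> bool" where
  "mod_iso D M N \<longleftrightarrow> is_dmod D M \<and> is_dmod D N \<and> (\<exists>f\<in>mod_hom D M N. invertible_mat f)"

definition kronecker :: "'k::semiring_0 mat \<Rightarrow> 'k mat \<Rightarrow> 'k mat" where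
  "kronecker A B = mat (dim_row A * dim_row B) (dim_col A * dim_col B)
     (\<lambda>(i, j). A $$ (i div dim_row B, j div dim_col B) * B $$ (i mod dim_row B, j mod dim_col B))"

definition mod_tensor ::
  "('g, 'k::field) gdatum \<Rightarrow> ('g, 'k) dmod \<Rightarrow> ('g, 'k) dmod \<Rightarrow> ('g, 'k) dmod" where
  "mod_tensor D M N = \<lparr>mdim = mdim M * mdim N,
     mact = (\<lambda>s. foldr (\<lambda>(p, q) A. kronecker (meval M p) (meval N q) + A) (dd_comult D s)
                    (0\<^sub>m (mdim M * mdim N) (mdim M * mdim N)))\<rparr>"

definition mod_dsum :: "('g, 'k::field) dmod list \<Rightarrow> ('g, 'k) dmod" where
  "mod_dsum Ms = \<lparr>mdim = sum_list (map mdim Ms),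
     mact = (\<lambda>s. diag_block_mat (map (\<lambda>M. mact M s) Ms))\<rparr>"

definition surj_mat :: "'k::semiring_0 mat \<Rightarrow> bool" where
  "surj_mat f \<longleftrightarrow>
     (\<forall>w\<in>carrier_vec (dim_row f). \<exists>v\<in>carrier_vec (dim_col f). f *\<^sub>v v = w)"

definition projective_dmod :: "('g, 'k::field) gdatum \<Rightarrow> ('g, 'k) dmod \<Rightarrow> bool" where
  "projective_dmod D P \<longleftrightarrow> is_dmod D P \<and>
     (\<forall>M N f h. is_dmod D M \<and> is_dmod D N \<and> f \<in> mod_hom D M N \<and> surj_mat f \<and> h \<in> mod_hom D P N
        \<longrightarrow> (\<exists>k\<in>mod_hom D P M. f * k = h))"

text \<open>\<open>P\<close> is projective and admits an essential epimorphism onto \<open>V\<close>.\<close>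

definition projective_cover ::
  "('g, 'k::field) gdatum \<Rightarrow> ('g, 'k) dmod \<Rightarrow> ('g, 'k) dmod \<Rightarrow> bool" where
  "projective_cover D P V \<longleftrightarrow> projective_dmod D P \<and> is_dmod D V \<and>
     (\<exists>f\<in>mod_hom D P V. surj_mat f \<and>
        (\<forall>N. \<forall>h\<in>mod_hom D N P. is_dmod D N \<and> surj_mat (f * h) \<longrightarrow> surj_mat h))"


section \<open>The simple modules and their labels\<close>

text \<open>The value of a character \<open>\<mu>\<close> of \<open>G \<times> \<Gamma>\<close> at the product \<open>g\<gamma>\<close> is \<open>\<mu> (g, \<gamma>)\<close>.\<close>

definition phi :: "('g, 'k::field) gdatum \<Rightarrow> 'g \<times> ('g \<Rightarrow> 'k) \<Rightarrow> 'k" where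
  "phi D = (\<lambda>(g, \<gamma>)\<in>carrier (grp D \<times>\<times> Gam D). inverse (chi D g) * \<gamma> (elt D))"

definition phi_shift :: "('g, 'k::field) gdatum \<Rightarrow> nat \<Rightarrow>
    ('g \<times> ('g \<Rightarrow> 'k) \<Rightarrow> 'k) \<Rightarrow> 'g \<times> ('g \<Rightarrow> 'k) \<Rightarrow> 'k" where
  "phi_shift D i \<mu> = (phi D [^]\<^bsub>Lam D\<^esub> i) \<otimes>\<^bsub>Lam D\<^esub> \<mu>"

definition at_achi :: "('g, 'k::field) gdatum \<Rightarrow> ('g \<times> ('g \<Rightarrow> 'k) \<Rightarrow> 'k) \<Rightarrow> 'k" where
  "at_achi D \<mu> = \<mu> (elt D, inv\<^bsub>Gam D\<^esub> (chi D))"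

definition I_n_prime :: "('g, 'k::field) gdatum \<Rightarrow> ('g \<times> ('g \<Rightarrow> 'k) \<Rightarrow> 'k) set" where
  "I_n_prime D = {\<mu> \<in> carrier (Lam D). \<forall>k\<le>ordn D - 1. at_achi D \<mu> \<noteq> rho D ^ k}"

definition I_n_dprime :: "('g, 'k::field) gdatum \<Rightarrow> ('g \<times> ('g \<Rightarrow> 'k) \<Rightarrow> 'k) set" where
  "I_n_dprime D = {\<mu> \<in> carrier (Lam D). at_achi D \<mu> = rho D ^ (ordn D - 1)}"

definition I_set :: "('g, 'k::field) gdatum \<Rightarrow> nat \<Rightarrow> ('g \<times> ('g \<Rightarrow> 'k) \<Rightarrow> 'k) set" where
  "I_set D l =
     (if l = 0 then I_n_dprime D
      else if l < ordn D then {\<mu> \<in> carrier (Lam D). at_achi D \<mu> = rho D ^ (l - 1)}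
      else if l = ordn D then I_n_prime D \<union> I_n_dprime D
      else {})"

definition alpha_coeff :: "('g, 'k::field) gdatum \<Rightarrow> ('g \<times> ('g \<Rightarrow> 'k) \<Rightarrow> 'k) \<Rightarrow> nat \<Rightarrow> 'k" where
  "alpha_coeff D \<mu> i = qnum (rho D) i *
     (\<mu> (\<one>\<^bsub>grp D\<^esub>, chi D) - \<mu> (elt D, \<one>\<^bsub>Gam D\<^esub>) * rho D powi (1 - int i))"

text \<open>Column \<open>j\<close> of each matrix holds the coordinates of the image of the basis vector \<open>v\<^sub>j\<close>.\<close>

definition simple_mod ::
  "('g, 'k::field) gdatum \<Rightarrow> nat \<Rightarrow> ('g \<times> ('g \<Rightarrow> 'k) \<Rightarrow> 'k) \<Rightarrow> ('g, 'k) dmod" where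
  "simple_mod D l \<mu> = \<lparr>mdim = l,
     mact = (\<lambda>s. case s of
        Grp g \<Rightarrow> mat l l (\<lambda>(i, j). if i = j then phi_shift D j \<mu> (g, \<one>\<^bsub>Gam D\<^esub>) else 0)
      | Chr \<gamma> \<Rightarrow> mat l l (\<lambda>(i, j). if i = j then phi_shift D j \<mu> (\<one>\<^bsub>grp D\<^esub>, \<gamma>) else 0)
      | GenX \<Rightarrow> mat l l (\<lambda>(i, j). if i = j + 1 then 1
          else if l = ordn D \<and> \<not> nilpotent_type D \<and> j = l - 1 \<and> i = 0
            then \<mu> (elt D, \<one>\<^bsub>Gam D\<^esub>) ^ ordn D - 1
          else 0)
      | GenXi \<Rightarrow> mat l l (\<lambda>(i, j). if j = i + 1 then alpha_coeff D \<mu> j else 0))\<rparr>"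

text \<open>
  A choice of the modules \<open>P(l, \<lambda>)\<close>: projective covers of the simple modules for \<open>l < n\<close>, which
  are determined up to isomorphism, and the simple modules themselves for \<open>l = n\<close>.
\<close>

definition proj_family :: "('g, 'k::field) gdatum \<Rightarrow>
    (nat \<Rightarrow> ('g \<times> ('g \<Rightarrow> 'k) \<Rightarrow> 'k) \<Rightarrow> ('g, 'k) dmod) \<Rightarrow> bool" where
  "proj_family D P \<longleftrightarrow>
     (\<forall>l \<mu>. 1 \<le> l \<and> l < ordn D \<and> \<mu> \<in> I_set D l
        \<longrightarrow> projective_cover D (P l \<mu>) (simple_mod D l \<mu>)) \<and>
     (\<forall>\<mu>\<in>I_set D (ordn D). P (ordn D) \<mu> = simple_mod D (ordn D) \<mu>)"

definition cfun :: "nat \<Rightarrow> nat" where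
  "cfun t = (t + 1) div 2"

end

theory Submission
  imports Defs "HOL-Library.Function_Algebras" "HOL-Library.Product_Plus"
    "Jordan_Normal_Form.Determinant"
begin

text \<open>The tensor product \<open>T = V(n, \<mu>) \<otimes> V(n, \<mu>')\<close> is free on a weight vector. Put \<open>\<nu> = \<mu> \<mu>'\<close> and
\<open>t = v\<^sub>0 \<otimes> v\<^sub>n\<^sub>-\<^sub>1\<close>, of weight \<open>\<psi> = \<phi>\<^bsup>n-1\<^esup> \<nu>\<close>. Since \<open>\<xi>\<close> kills \<open>v\<^sub>0\<close> and moves \<open>v\<^sub>n\<^sub>-\<^sub>1\<close> through the whole second factor,
while \<open>x\<close> moves \<open>v\<^sub>0\<close> through the first one, the \<open>n\<^sup>2\<close> vectors \<open>x\<^sup>i \<xi>\<^sup>j t\<close> form a basis. In every module the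
span of the \<open>x\<^sup>i \<xi>\<^sup>j w\<close>, for a weight vector \<open>w\<close>, is a submodule, so the homomorphisms from \<open>T\<close> to \<open>N\<close>
correspond to the vectors of weight \<open>\<psi>\<close> in \<open>N\<close> (\<open>free_weight_hom\<close>, \<open>T_hom\<close>). Weight vectors lift through
surjections, by averaging over \<open>G\<close> and \<open>\<Gamma>\<close> (\<open>weight_lift\<close>).

The element \<open>C = (1 - \<rho>) x \<xi> + \<rho> a + \<chi>\<close> is central, and it acts on a simple module with highest weight \<open>\<phi>\<^sup>s \<nu>\<close>
by the scalar \<open>c\<^sub>s = \<rho>\<^bsup>1-s\<^esup> \<nu>(a) + \<rho>\<^sup>s \<nu>(\<chi>)\<close>. On weight vectors \<open>x \<xi>\<close> is a linear polynomial in \<open>C\<close>. Therefore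
the vectors of weight \<open>\<psi>\<close> in \<open>T\<close> are the polynomials in \<open>C\<close> applied to \<open>t\<close> (\<open>weight_space\<close>), and \<open>\<xi>\<^sup>n = 0\<close> turns
into \<open>\<Prod>\<^bsub>s<n\<^esub> (C - c\<^sub>s) = 0\<close> on \<open>T\<close> (\<open>cas_annihilates\<close>).

Choose one index \<open>s\<close> for every value among the \<open>c\<^sub>s\<close>, and a simple module \<open>S\<^sub>s\<close> with highest weight \<open>\<phi>\<^sup>s \<nu>\<close> in which
the weight \<open>\<psi>\<close> occurs, with projective cover \<open>P\<^sub>s\<close>. A vector of weight \<open>\<psi>\<close> in \<open>P\<^sub>s\<close> over the one in \<open>S\<^sub>s\<close> gives a
homomorphism \<open>T \<rightarrow> P\<^sub>s\<close>, which is surjective because \<open>P\<^sub>s \<rightarrow> S\<^sub>s\<close> is essential; projectivity of \<open>P\<^sub>s\<close> gives a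
homomorphism \<open>P\<^sub>s \<rightarrow> T\<close> over \<open>S\<^sub>s\<close> (\<open>cover_data\<close>). The \<open>c\<^sub>s\<close> being distinct, polynomials in \<open>C\<close> separate the indices:
the joint map \<open>T \<rightarrow> \<Oplus> P\<^sub>s\<close> is surjective, and so is \<open>\<Oplus> P\<^sub>s \<rightarrow> T\<close>, since its image contains \<open>Q(C) t\<close> for a
polynomial \<open>Q\<close> that vanishes at no \<open>c\<^sub>s\<close>. Surjections in both directions force equal dimensions, hence an
isomorphism (\<open>decomposition\<close>).

What remains is to find the coincidences \<open>c\<^sub>i = c\<^sub>j\<close> (\<open>cval_eq_iff\<close>). For \<open>\<nu> \<in> I\<^sub>n'\<close> there are none. For
\<open>\<nu> \<in> I\<^sub>l\<close> they occur exactly when \<open>i + j\<close> is congruent to \<open>l\<close> modulo \<open>n\<close>, and the two index ranges of the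
decomposition consist of one representative of every orbit of \<open>s \<mapsto> l - s\<close>. The summands of dimension \<open>n\<close> are
modules \<open>V(n, _)\<close>; these are projective, because they are free on a highest weight vector and such a vector can be
produced from a lifted lowest weight vector (\<open>simple_n_cover\<close>).

Two facts are prior to all this: \<open>V(n, \<mu>)\<close> satisfies the defining relations (\<open>simple_n_dmod\<close>), and so does a tensor
product of modules, that is, the comultiplication respects the relations (\<open>tensor_dmod\<close>). The only hard relation is
the one between \<open>x\<close> and \<open>\<gamma>\<close> in the non-nilpotent case.\<close>

section \<open>Matrices acting on sequences\<close>

definition scl :: "'k::field \<Rightarrow> (nat \<Rightarrow> 'k) \<Rightarrow> nat \<Rightarrow> 'k" where
  "scl c v = (\<lambda>i. c * v i)"

lemma scl_apply [simp]: "scl c v i = c * v i"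
  by (simp add: scl_def)

interpretation fs: vector_space scl
  by unfold_locales (auto simp: fun_eq_iff algebra_simps)

text \<open>Vectors of all dimensions are sequences over the field, so that they lie in one type that is an additive group;
the dimension is a bound on the support.\<close>

definition coords :: "nat \<Rightarrow> (nat \<Rightarrow> 'k::field) set" where
  "coords d = {v. \<forall>i\<ge>d. v i = 0}"

definition unit_seq :: "nat \<Rightarrow> nat \<Rightarrow> 'k::field" where
  "unit_seq j = (\<lambda>i. if i = j then 1 else 0)"

definition mop :: "'k::field mat \<Rightarrow> (nat \<Rightarrow> 'k) \<Rightarrow> nat \<Rightarrow> 'k" where
  "mop A v = (\<lambda>i. if i < dim_row A then \<Sum>j<dim_col A. A $$ (i, j) * v j else 0)"

definition mat_of :: "nat \<Rightarrow> nat \<Rightarrow> ((nat \<Rightarrow> 'k::field) \<Rightarrow> nat \<Rightarrow> 'k) \<Rightarrow> 'k mat" where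
  "mat_of r c F = mat r c (\<lambda>(i, j). F (unit_seq j) i)"

lemma sum_fun_apply: "(\<Sum>x\<in>S. f x) i = (\<Sum>x\<in>S. f x i)"
  for f :: "'a \<Rightarrow> 'b \<Rightarrow> 'c::ab_group_add"
  by (induction S rule: infinite_finite_induct) auto

lemma coords_eqI: "u \<in> coords d \<Longrightarrow> v \<in> coords d \<Longrightarrow> (\<And>i. i < d \<Longrightarrow> u i = v i) \<Longrightarrow> u = v"
  by (rule ext) (metis (mono_tags, lifting) coords_def mem_Collect_eq not_le)

lemma subspace_coords: "fs.subspace (coords d)"
  by (auto simp: fs.subspace_def coords_def)

lemma unit_seq_in_coords [simp]: "unit_seq j \<in> coords d \<longleftrightarrow> j < d"
  by (auto simp: unit_seq_def coords_def)

lemma coords_expand: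
  assumes "v \<in> coords d"
  shows "v = (\<Sum>j<d. scl (v j) (unit_seq j))"
proof
  fix i
  have "(\<Sum>j<d. v j * unit_seq j i) = (\<Sum>j<d. if j = i then v j else 0)"
    by (rule sum.cong) (auto simp: unit_seq_def)
  also have "\<dots> = v i"
    using assms by (auto simp: coords_def)
  finally show "v i = (\<Sum>j<d. scl (v j) (unit_seq j)) i" by (simp add: sum_fun_apply)
qed

lemma mop_closed: "A \<in> carrier_mat r c \<Longrightarrow> mop A v \<in> coords r"
  by (auto simp: mop_def coords_def)

lemma module_hom_mop: "module_hom scl scl (mop A)"
  by unfold_locales
    (auto simp: mop_def fun_eq_iff sum.distrib algebra_simps sum_distrib_left)

lemma mop_mult:
  assumes "A \<in> carrier_mat r m" "B \<in> carrier_mat m c"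
  shows "mop (A * B) v = mop A (mop B v)"
proof
  fix i
  show "mop (A * B) v i = mop A (mop B v) i"
  proof (cases "i < r")
    case True
    have "mop (A * B) v i = (\<Sum>j<c. (\<Sum>k<m. A $$ (i,k) * B $$ (k,j)) * v j)"
      using assms True by (auto simp: mop_def scalar_prod_def lessThan_atLeast0 intro!: sum.cong)
    also have "\<dots> = (\<Sum>k<m. \<Sum>j<c. A $$ (i,k) * (B $$ (k,j) * v j))"
      by (simp add: sum_distrib_right mult.assoc) (rule sum.swap)
    also have "\<dots> = mop A (mop B v) i"
      using assms True by (auto simp: mop_def sum_distrib_left intro!: sum.cong)
    finally show ?thesis .
  qed (use assms in \<open>auto simp: mop_def\<close>)
qed

lemma mop_plus:
  assumes "A \<in> carrier_mat r c" "B \<in> carrier_mat r c"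
  shows "mop (A + B) v = mop A v + mop B v"
  using assms by (auto simp: mop_def fun_eq_iff sum.distrib algebra_simps)

lemma mop_minus:
  assumes "A \<in> carrier_mat r c" "B \<in> carrier_mat r c"
  shows "mop (A - B) v = mop A v - mop B v"
  using assms by (auto simp: mop_def fun_eq_iff sum_subtractf algebra_simps)

lemma mop_scalar:
  assumes "v \<in> coords d"
  shows "mop (c \<cdot>\<^sub>m 1\<^sub>m d) v = scl c v"
proof
  fix i
  show "mop (c \<cdot>\<^sub>m 1\<^sub>m d) v i = scl c v i"
  proof (cases "i < d")
    case True
    have "mop (c \<cdot>\<^sub>m 1\<^sub>m d) v i = (\<Sum>j<d. (c \<cdot>\<^sub>m 1\<^sub>m d) $$ (i, j) * v j)"
      using True by (simp add: mop_def)
    also have "\<dots> = (\<Sum>j<d. if j = i then c * v j else 0)"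
      by (rule sum.cong) (use True in auto)
    finally show ?thesis using True by simp
  qed (use assms in \<open>simp_all add: mop_def coords_def\<close>)
qed

lemma mop_zero_mat [simp]: "mop (0\<^sub>m r c) v = 0"
  by (auto simp: mop_def fun_eq_iff)

lemma mop_one: "v \<in> coords d \<Longrightarrow> mop (1\<^sub>m d) v = v"
proof -
  assume "v \<in> coords d"
  moreover have "(1::'a) \<cdot>\<^sub>m 1\<^sub>m d = 1\<^sub>m d" by (rule eq_matI) auto
  ultimately show ?thesis using mop_scalar[of v d 1] by (simp add: scl_def)
qed

lemma mop_unit:
  "A \<in> carrier_mat r c \<Longrightarrow> i < r \<Longrightarrow> j < c \<Longrightarrow> mop A (unit_seq j) i = A $$ (i, j)"
  by (simp add: mop_def unit_seq_def if_distrib cong: if_cong)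

lemma mat_eq_of_mop:
  assumes "A \<in> carrier_mat r c" "B \<in> carrier_mat r c"
    and "\<And>v. v \<in> coords c \<Longrightarrow> mop A v = mop B v"
  shows "A = B"
proof (rule eq_matI)
  fix i j assume "i < dim_row B" "j < dim_col B"
  then have ij: "i < r" "j < c" using assms(2) by auto
  then have "mop A (unit_seq j) i = mop B (unit_seq j) i" using assms(3)[of "unit_seq j"] by simp
  then show "A $$ (i, j) = B $$ (i, j)" using mop_unit assms(1,2) ij by metis
qed (use assms in auto)

lemma mat_of_carrier [simp]: "mat_of r c F \<in> carrier_mat r c"
  by (simp add: mat_of_def)

lemma mop_mat_of:
  assumes add: "\<And>u v. u \<in> coords c \<Longrightarrow> v \<in> coords c \<Longrightarrow> F (u + v) = F u + F v"
    and scale: "\<And>a u. u \<in> coords c \<Longrightarrow> F (scl a u) = scl a (F u)"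
    and closed: "\<And>u. u \<in> coords c \<Longrightarrow> F u \<in> coords r"
    and v: "v \<in> coords c"
  shows "mop (mat_of r c F) v = F v"
proof -
  have zero: "F 0 = 0" using scale[of 0 0] by (simp add: coords_def)
  have sum: "F (\<Sum>j\<in>S. f j) = (\<Sum>j\<in>S. F (f j)) \<and> (\<Sum>j\<in>S. f j) \<in> coords c"
    if "\<And>j. j \<in> S \<Longrightarrow> f j \<in> coords c" for f and S :: "nat set"
    using that
  proof (induction S rule: infinite_finite_induct)
    case (insert x S)
    then have IH: "F (\<Sum>j\<in>S. f j) = (\<Sum>j\<in>S. F (f j))" "(\<Sum>j\<in>S. f j) \<in> coords c"
      and fx: "f x \<in> coords c" by blast+
    show ?case
      unfolding sum.insert[OF insert.hyps] add[OF fx IH(2)] IH(1)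
      using fs.subspace_add[OF subspace_coords fx IH(2)] by blast
  qed (auto simp: zero coords_def)
  have "F v = F (\<Sum>j<c. scl (v j) (unit_seq j))"
    using coords_expand[OF v] by simp
  also have "\<dots> = (\<Sum>j<c. scl (v j) (F (unit_seq j)))"
  proof -
    have "scl (v j) (unit_seq j) \<in> coords c" if "j < c" for j
      using that by (intro fs.subspace_scale[OF subspace_coords]) simp
    then have "F (\<Sum>j<c. scl (v j) (unit_seq j)) = (\<Sum>j<c. F (scl (v j) (unit_seq j)))"
      using sum[of "{..<c}"] by simp
    also have "\<dots> = (\<Sum>j<c. scl (v j) (F (unit_seq j)))"
      by (intro sum.cong refl) (simp add: scale)
    finally show ?thesis .
  qed
  finally have Fv: "F v = (\<Sum>j<c. scl (v j) (F (unit_seq j)))" .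
  show ?thesis
  proof (rule coords_eqI[of _ r])
    fix i assume "i < r"
    then show "mop (mat_of r c F) v i = F v i"
      unfolding Fv by (simp add: sum_fun_apply mop_def mat_of_def mult.commute)
  qed (use closed v mop_closed[OF mat_of_carrier] in auto)
qed

lemma surj_mat_iff:
  fixes A :: "'a::field mat"
  assumes "A \<in> carrier_mat r c"
  shows "surj_mat A \<longleftrightarrow> (\<forall>w\<in>coords r. \<exists>v\<in>coords c. mop A v = w)"
proof -
  let ?s = "\<lambda>d (w::'a vec). \<lambda>i. if i < d then w $ i else 0"
  have tos: "?s d w \<in> coords d" for d and w :: "'a vec" by (simp add: coords_def)
  have mv: "?s r (A *\<^sub>v v) = mop A (?s c v)" if "v \<in> carrier_vec c" for v
    using assms that
    by (auto simp: fun_eq_iff mop_def scalar_prod_def lessThan_atLeast0 intro!: sum.cong)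
  have vecs: "?s d (vec d f) = f" if "f \<in> coords d" for d and f :: "nat \<Rightarrow> 'a"
    using that by (auto simp: coords_def fun_eq_iff)
  have inj: "u = w" if "?s d u = ?s d w" and "u \<in> carrier_vec d" and "w \<in> carrier_vec d" for d and u w :: "'a vec"
  proof (rule eq_vecI)
    fix i assume "i < dim_vec w"
    then show "u $ i = w $ i" using that fun_cong[OF that(1), of i] by simp
  qed (use that in auto)
  show ?thesis
  proof
    assume L: "surj_mat A"
    show "\<forall>w\<in>coords r. \<exists>v\<in>coords c. mop A v = w"
    proof
      fix w :: "nat \<Rightarrow> 'a" assume w: "w \<in> coords r"
      obtain v where v: "v \<in> carrier_vec c" "A *\<^sub>v v = vec r w"
        using L assms unfolding surj_mat_def by fastforce
      have "mop A (?s c v) = w" using mv[OF v(1)] vecs[OF w] unfolding v(2) by metis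
      then show "\<exists>v\<in>coords c. mop A v = w" using tos by blast
    qed
  next
    assume R: "\<forall>w\<in>coords r. \<exists>v\<in>coords c. mop A v = w"
    show "surj_mat A" unfolding surj_mat_def
    proof
      fix w :: "'a vec" assume w: "w \<in> carrier_vec (dim_row A)"
      obtain f where f: "f \<in> coords c" "mop A f = ?s r w" using R tos by blast
      have "?s r (A *\<^sub>v vec c f) = ?s r w"
        using mv[of "vec c f"] vecs[OF f(1)] f(2) by simp
      then have "A *\<^sub>v vec c f = w" using inj assms w by (metis carrier_matD(1) mult_mat_vec_carrier vec_carrier)
      then show "\<exists>v\<in>carrier_vec (dim_col A). A *\<^sub>v v = w" using assms by (intro bexI[of _ "vec c f"]) auto
    qed
  qed
qed

lemma surj_right_inverse:
  fixes A :: "'a::field mat"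
  assumes A: "A \<in> carrier_mat r c" and s: "surj_mat A"
  obtains B where "B \<in> carrier_mat c r" "A * B = 1\<^sub>m r"
proof -
  have "\<forall>w\<in>coords r. \<exists>v\<in>coords c. mop A v = w" using surj_mat_iff[OF A] s by simp
  then obtain b where b: "\<And>w. w \<in> coords r \<Longrightarrow> b w \<in> coords c \<and> mop A (b w) = w" by metis
  define B where "B = mat c r (\<lambda>(i, j). b (unit_seq j) i)"
  have B: "B \<in> carrier_mat c r" by (simp add: B_def)
  have "A * B = 1\<^sub>m r"
  proof (rule eq_matI)
    fix i j assume ij: "i < dim_row (1\<^sub>m r)" "j < dim_col (1\<^sub>m r)"
    have "(A * B) $$ (i, j) = (\<Sum>k<c. A $$ (i, k) * b (unit_seq j) k)"
      using ij A by (auto simp: B_def scalar_prod_def lessThan_atLeast0 intro!: sum.cong)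
    also have "\<dots> = mop A (b (unit_seq j)) i" using ij A by (simp add: mop_def)
    also have "\<dots> = 1\<^sub>m r $$ (i, j)" using b[of "unit_seq j"] ij by simp (simp add: unit_seq_def)
    finally show "(A * B) $$ (i, j) = 1\<^sub>m r $$ (i, j)" .
  qed (use A B in auto)
  then show thesis using that B by blast
qed

lemma surj_square_invertible:
  fixes A :: "'a::field mat"
  assumes A: "A \<in> carrier_mat d d" and s: "surj_mat A"
  shows "invertible_mat A"
proof -
  obtain B where B: "B \<in> carrier_mat d d" "A * B = 1\<^sub>m d" using surj_right_inverse[OF A s] .
  have "B * A = 1\<^sub>m d" by (rule mat_mult_left_right_inverse[OF A B])
  then show ?thesis using A B unfolding invertible_mat_def inverts_mat_def by auto
qed

text \<open>If \<open>c < r\<close>, adding zero columns makes the matrix square; it stays surjective, hence is invertible, and yet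
it kills a unit vector.\<close>

lemma surj_mat_dim:
  fixes A :: "'a::field mat"
  assumes A: "A \<in> carrier_mat r c" and s: "surj_mat A"
  shows "r \<le> c"
proof (rule ccontr)
  assume "\<not> r \<le> c"
  then have cr: "c < r" by simp
  define A' where "A' = mat r r (\<lambda>(i, j). if j < c then A $$ (i, j) else 0)"
  have A': "A' \<in> carrier_mat r r" by (simp add: A'_def)
  have eq: "mop A' v = mop A v" for v
  proof
    fix i
    have "(\<Sum>j<r. (if j < c then A $$ (i, j) else 0) * v j) = (\<Sum>j<c. A $$ (i, j) * v j)"
      by (rule sum.mono_neutral_cong_right) (use cr in auto)
    then show "mop A' v i = mop A v i" using A by (simp add: mop_def A'_def)
  qed
  have "coords c \<subseteq> (coords r :: (nat \<Rightarrow> 'a) set)" using cr by (auto simp: coords_def)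
  then have "surj_mat A'" unfolding surj_mat_iff[OF A'] eq
    using s[unfolded surj_mat_iff[OF A]] by blast
  from surj_right_inverse[OF A' this] obtain B where B: "B \<in> carrier_mat r r" "A' * B = 1\<^sub>m r" .
  have "B * A' = 1\<^sub>m r" by (rule mat_mult_left_right_inverse[OF A' B])
  then have "mop B (mop A' (unit_seq c)) = unit_seq c"
    using mop_mult[OF B(1) A', symmetric] cr by (simp add: mop_one)
  moreover have "mop A' (unit_seq c) i = 0" for i
    unfolding mop_def A'_def unit_seq_def by (simp, intro impI sum.neutral) auto
  then have "mop A' (unit_seq c) = 0" by (simp add: fun_eq_iff)
  moreover have "mop B 0 = 0" by (auto simp: mop_def fun_eq_iff)
  ultimately have "unit_seq c c = (0 :: 'a)" by simp
  then show False by (simp add: unit_seq_def)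
qed

section \<open>Characters of finite groups\<close>

lemma unit_grp_simps [simp]:
  "carrier unit_grp = - {0}" "x \<otimes>\<^bsub>unit_grp\<^esub> y = x * y" "\<one>\<^bsub>unit_grp\<^esub> = 1"
  by (simp_all add: unit_grp_def)

lemma group_unit_grp: "group (unit_grp :: 'k::field monoid)"
proof (rule groupI)
  fix x :: 'k assume "x \<in> carrier unit_grp"
  then show "\<exists>y\<in>carrier unit_grp. y \<otimes>\<^bsub>unit_grp\<^esub> x = \<one>\<^bsub>unit_grp\<^esub>"
    by (intro bexI[of _ "inverse x"]) auto
qed (auto simp: mult.assoc)

lemma unit_grp_pow [simp]: "x [^]\<^bsub>unit_grp\<^esub> (m::nat) = (x::'k::field) ^ m"
proof -
  interpret group "unit_grp :: 'k monoid" by (rule group_unit_grp)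
  show ?thesis by (induction m) (simp_all add: mult.commute)
qed

lemma dual_grp_simps [simp]:
  "carrier (dual_grp K) = hom K unit_grp \<inter> extensional (carrier K)"
  "\<gamma> \<otimes>\<^bsub>dual_grp K\<^esub> \<delta> = (\<lambda>g\<in>carrier K. \<gamma> g * \<delta> g)"
  "\<one>\<^bsub>dual_grp K\<^esub> = (\<lambda>g\<in>carrier K. 1)"
  by (simp_all add: dual_grp_def)

lemma dual_grp_pow:
  assumes "group K" "\<gamma> \<in> carrier (dual_grp K)" "g \<in> carrier K"
  shows "(\<gamma> [^]\<^bsub>dual_grp K\<^esub> (m::nat)) g = \<gamma> g ^ m"
  using assms(3) by (induction m) (auto simp: nat_pow_def mult.commute)

lemma group_dual_grp:
  assumes "group K"
  shows "group (dual_grp K :: ('a \<Rightarrow> 'k::field) monoid)"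
proof -
  interpret group K by fact
  have cl: "x \<in> carrier K \<Longrightarrow> y \<in> carrier K \<Longrightarrow> x \<otimes>\<^bsub>K\<^esub> y \<in> carrier K" for x y by simp
  show ?thesis
  proof (rule groupI)
    fix \<gamma> :: "'a \<Rightarrow> 'k"
    assume \<gamma>: "\<gamma> \<in> carrier (dual_grp K)"
    then have nz: "g \<in> carrier K \<Longrightarrow> \<gamma> g \<noteq> 0" for g by (auto simp: hom_def)
    show "\<one>\<^bsub>dual_grp K\<^esub> \<otimes>\<^bsub>dual_grp K\<^esub> \<gamma> = \<gamma>"
      using \<gamma> by (auto simp: extensional_def fun_eq_iff)
    show "\<exists>\<eta>\<in>carrier (dual_grp K). \<eta> \<otimes>\<^bsub>dual_grp K\<^esub> \<gamma> = \<one>\<^bsub>dual_grp K\<^esub>"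
      using \<gamma> nz by (intro bexI[of _ "\<lambda>g\<in>carrier K. inverse (\<gamma> g)"]) (auto simp: hom_def fun_eq_iff)
  next
    fix \<gamma> \<delta> :: "'a \<Rightarrow> 'k"
    assume "\<gamma> \<in> carrier (dual_grp K)" "\<delta> \<in> carrier (dual_grp K)"
    then show "\<gamma> \<otimes>\<^bsub>dual_grp K\<^esub> \<delta> \<in> carrier (dual_grp K)"
      using cl by (auto simp: hom_def)
  qed (use cl in \<open>auto simp: hom_def fun_eq_iff mult_ac\<close>)
qed

text \<open>A character of a finite group takes its values in a finite set of roots of unity.\<close>

lemma finite_dual_grp:
  assumes "group K" "finite (carrier K)"
  shows "finite (carrier (dual_grp K :: ('a \<Rightarrow> 'k::field) monoid))"
proof -
  interpret group K by fact
  define m where "m = Coset.order K"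
  have m: "m > 0" using assms by (simp add: m_def order_gt_0_iff_finite)
  have fin: "finite {z::'k. z ^ m = 1}"
  proof -
    have "poly (monom 1 m - 1) z = z ^ m - 1" for z :: 'k by (simp add: poly_monom)
    moreover have "monom (1::'k) m - 1 \<noteq> 0"
      using m by (metis degree_1 degree_monom_eq eq_iff_diff_eq_0 less_numeral_extra(3) zero_neq_one)
    ultimately show ?thesis using poly_roots_finite[of "monom (1::'k) m - 1"] by simp
  qed
  have "carrier (dual_grp K) \<subseteq> carrier K \<rightarrow>\<^sub>E {z::'k. z ^ m = 1}"
  proof
    fix \<gamma> :: "'a \<Rightarrow> 'k" assume \<gamma>: "\<gamma> \<in> carrier (dual_grp K)"
    have "\<gamma> g ^ m = 1" if g: "g \<in> carrier K" for g
    proof -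
      have pow: "\<gamma> (g [^]\<^bsub>K\<^esub> j) = \<gamma> g ^ j" for j :: nat
      proof (induction j)
        case 0
        have "\<gamma> \<one>\<^bsub>K\<^esub> * \<gamma> \<one>\<^bsub>K\<^esub> = \<gamma> \<one>\<^bsub>K\<^esub>" "\<gamma> \<one>\<^bsub>K\<^esub> \<noteq> 0"
          using \<gamma> hom_mult[of \<gamma> K unit_grp "\<one>\<^bsub>K\<^esub>" "\<one>\<^bsub>K\<^esub>"] by (auto simp: hom_def)
        then show ?case by simp
      next
        case (Suc j)
        then show ?case using \<gamma> g by (auto simp: hom_def mult.commute)
      qed
      show ?thesis using pow[of m] pow[of 0] pow_order_eq_1[OF g] by (simp add: m_def)
    qed
    then show "\<gamma> \<in> carrier K \<rightarrow>\<^sub>E {z::'k. z ^ m = 1}" using \<gamma> by (auto simp: PiE_def)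
  qed
  then show ?thesis using fin assms(2) by (meson finite_PiE finite_subset)
qed

section \<open>Group data\<close>

locale dd =
  fixes D :: "('g, 'k::field_char_0) gdatum"
  assumes datum: "abelian_group_datum D"
begin

abbreviation G where "G \<equiv> grp D"
abbreviation \<Gamma> where "\<Gamma> \<equiv> dual_grp G :: ('g \<Rightarrow> 'k) monoid"
abbreviation a where "a \<equiv> elt D"
abbreviation \<chi> where "\<chi> \<equiv> chi D"
abbreviation \<rho> where "\<rho> \<equiv> rho D"
abbreviation n where "n \<equiv> ordn D"
abbreviation \<Lambda> where "\<Lambda> \<equiv> Lam D"

lemma G_group: "group G" and G_finite: "finite (carrier G)" and a_G: "a \<in> carrier G"
  and chi_Gam: "\<chi> \<in> carrier \<Gamma>" and n2: "2 \<le> n"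
  using datum comm_group.axioms(2) unfolding abelian_group_datum_def by auto

lemma G_comm: "comm_group G"
  using datum unfolding abelian_group_datum_def by auto

sublocale G: comm_group G by (rule G_comm)
sublocale Gam: group \<Gamma> by (rule group_dual_grp[OF G_group])

lemma Gam_finite: "finite (carrier \<Gamma>)"
  by (rule finite_dual_grp[OF G_group G_finite])

lemma char_nz: "\<gamma> \<in> carrier \<Gamma> \<Longrightarrow> g \<in> carrier G \<Longrightarrow> \<gamma> g \<noteq> 0"
  by (auto simp: hom_def)

lemma char_mult: "\<gamma> \<in> carrier \<Gamma> \<Longrightarrow> g \<in> carrier G \<Longrightarrow> h \<in> carrier G \<Longrightarrow>
    \<gamma> (g \<otimes>\<^bsub>G\<^esub> h) = \<gamma> g * \<gamma> h"
  by (auto simp: hom_def)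

lemma char_one: "\<gamma> \<in> carrier \<Gamma> \<Longrightarrow> \<gamma> \<one>\<^bsub>G\<^esub> = 1"
  using char_mult[of \<gamma> "\<one>\<^bsub>G\<^esub>" "\<one>\<^bsub>G\<^esub>"] char_nz[of \<gamma> "\<one>\<^bsub>G\<^esub>"] by simp

lemma Gam_mult_apply: "g \<in> carrier G \<Longrightarrow> (\<gamma> \<otimes>\<^bsub>\<Gamma>\<^esub> \<delta>) g = \<gamma> g * \<delta> g"
  by simp

lemma Gam_one_apply: "g \<in> carrier G \<Longrightarrow> \<one>\<^bsub>\<Gamma>\<^esub> g = 1"
  by simp

lemma Gam_pow_apply: "\<gamma> \<in> carrier \<Gamma> \<Longrightarrow> g \<in> carrier G \<Longrightarrow> (\<gamma> [^]\<^bsub>\<Gamma>\<^esub> (m::nat)) g = \<gamma> g ^ m"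
  by (rule dual_grp_pow[OF G_group])

lemma Gam_comm: "comm_group \<Gamma>"
  by (rule Gam.group_comm_groupI) (auto simp: fun_eq_iff mult.commute)

declare dual_grp_simps [simp del]

lemma rho_nz: "\<rho> \<noteq> 0"
  unfolding rho_def by (rule char_nz[OF chi_Gam a_G])

lemma chi_nz: "g \<in> carrier G \<Longrightarrow> \<chi> g \<noteq> 0"
  using char_nz[OF chi_Gam] .

lemma chi_a: "\<chi> a = \<rho>"
  by (simp add: rho_def)

lemma rho_pow_1: "\<rho> ^ m = 1 \<longleftrightarrow> n dvd m"
proof -
  interpret U: group "unit_grp :: 'k monoid" by (rule group_unit_grp)
  show ?thesis using U.pow_eq_id[of \<rho> m] rho_nz by (simp add: ordn_def)
qed

lemma rho_n: "\<rho> ^ n = 1"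
  by (simp add: rho_pow_1)

lemma rho_inj:
  assumes "i < n" "j < n" "\<rho> ^ i = \<rho> ^ j"
  shows "i = j"
proof -
  have *: "i = j" if "i \<le> j" "j < n" "\<rho> ^ i = \<rho> ^ j" for i j
  proof -
    have "\<rho> ^ i * \<rho> ^ (j - i) = \<rho> ^ i * 1" using that(1,3) power_add[of \<rho> i "j - i"] by simp
    then have "n dvd j - i" using rho_nz by (simp add: rho_pow_1)
    then show ?thesis using that by (auto dest: dvd_imp_le)
  qed
  show ?thesis using assms *[of i j] *[of j i] by (cases "i \<le> j") auto
qed

lemma rho_1: "\<rho> \<noteq> 1"
  using rho_pow_1[of 1] n2 by auto

lemma qnum_eq: "(1 - \<rho>) * qnum \<rho> i = 1 - \<rho> ^ i"
  unfolding qnum_def by (simp add: one_diff_power_eq)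

lemma qnum_Suc: "qnum \<rho> (Suc i) = qnum \<rho> i + \<rho> ^ i"
  by (simp add: qnum_def)

lemma qnum_0 [simp]: "qnum \<rho> 0 = 0"
  by (simp add: qnum_def)

lemma qnum_nz: "0 < i \<Longrightarrow> i < n \<Longrightarrow> qnum \<rho> i \<noteq> 0"
  using qnum_eq[of i] rho_pow_1[of i] by (auto dest: dvd_imp_le)

lemma qnum_n: "qnum \<rho> n = 0"
  using qnum_eq[of n] rho_n rho_1 by simp

lemma qfact_0 [simp]: "qfact \<rho> 0 = 1"
  by (simp add: qfact_def)

lemma qfact_Suc: "qfact \<rho> (Suc i) = qnum \<rho> (Suc i) * qfact \<rho> i"
  by (simp add: qfact_def mult.commute)

lemma qfact_nz: "i < n \<Longrightarrow> qfact \<rho> i \<noteq> 0"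
  by (induction i) (auto simp: qfact_Suc qnum_nz)

lemma qfact_n: "qfact \<rho> n = 0"
  using n2 qnum_n by (cases n) (auto simp: qfact_Suc)

text \<open>The defect of \<open>\<gamma>\<close> being grouplike; it vanishes identically in the nilpotent case.\<close>

definition corr :: "('g \<Rightarrow> 'k) \<Rightarrow> 'k" where
  "corr \<gamma> = (if nilpotent_type D then 0 else \<gamma> a ^ n - 1)"

lemma chi_n: "\<not> nilpotent_type D \<Longrightarrow> \<chi> [^]\<^bsub>\<Gamma>\<^esub> n = \<one>\<^bsub>\<Gamma>\<^esub>"
  using datum unfolding abelian_group_datum_def by auto

lemma chi_n_apply: "\<not> nilpotent_type D \<Longrightarrow> g \<in> carrier G \<Longrightarrow> \<chi> g ^ n = 1"
  using Gam_pow_apply[OF chi_Gam, of g n] chi_n Gam_one_apply by metis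

lemma alp_1: "\<not> nilpotent_type D \<Longrightarrow> alp D = 1"
  using datum unfolding abelian_group_datum_def by auto

lemma corr_chi: "corr \<chi> = 0"
  by (simp add: corr_def chi_a rho_n)

lemma corr_one: "corr \<one>\<^bsub>\<Gamma>\<^esub> = 0"
  by (simp add: corr_def Gam_one_apply a_G)

lemma corr_mult: "corr (\<gamma> \<otimes>\<^bsub>\<Gamma>\<^esub> \<delta>) = corr \<gamma> * \<delta> a ^ n + corr \<delta>"
  by (simp add: corr_def Gam_mult_apply a_G power_mult_distrib algebra_simps)

subsection \<open>Characters of \<open>G \<times> \<Gamma>\<close>\<close>

lemma GG_group: "group (G \<times>\<times> \<Gamma>)"
  by (rule DirProd_group[OF G_group Gam.is_group])

sublocale Lam: group \<Lambda> by (rule group_dual_grp[OF GG_group])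

lemma GG_carrier: "(g, \<gamma>) \<in> carrier (G \<times>\<times> \<Gamma>) \<longleftrightarrow> g \<in> carrier G \<and> \<gamma> \<in> carrier \<Gamma>"
  by (simp add: DirProd_def)

lemma Lam_nz: "\<mu> \<in> carrier \<Lambda> \<Longrightarrow> g \<in> carrier G \<Longrightarrow> \<gamma> \<in> carrier \<Gamma> \<Longrightarrow> \<mu> (g, \<gamma>) \<noteq> 0"
proof -
  assume "\<mu> \<in> carrier \<Lambda>" "g \<in> carrier G" "\<gamma> \<in> carrier \<Gamma>"
  then have "\<mu> \<in> hom (G \<times>\<times> \<Gamma>) unit_grp" "(g, \<gamma>) \<in> carrier (G \<times>\<times> \<Gamma>)"
    by (simp_all add: dual_grp_simps(1) GG_carrier)
  from hom_in_carrier[OF this] show ?thesis by simp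
qed

lemma Lam_hom: "\<mu> \<in> carrier \<Lambda> \<Longrightarrow> g \<in> carrier G \<Longrightarrow> \<gamma> \<in> carrier \<Gamma> \<Longrightarrow> h \<in> carrier G \<Longrightarrow>
    \<delta> \<in> carrier \<Gamma> \<Longrightarrow> \<mu> (g \<otimes>\<^bsub>G\<^esub> h, \<gamma> \<otimes>\<^bsub>\<Gamma>\<^esub> \<delta>) = \<mu> (g, \<gamma>) * \<mu> (h, \<delta>)"
proof -
  assume A: "\<mu> \<in> carrier \<Lambda>" "g \<in> carrier G" "\<gamma> \<in> carrier \<Gamma>" "h \<in> carrier G" "\<delta> \<in> carrier \<Gamma>"
  then have "\<mu> \<in> hom (G \<times>\<times> \<Gamma>) unit_grp" by (simp add: dual_grp_simps(1))
  from hom_mult[OF this, of "(g, \<gamma>)" "(h, \<delta>)"] A show ?thesis by (simp add: GG_carrier)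
qed

lemma Lam_one: "\<mu> \<in> carrier \<Lambda> \<Longrightarrow> \<mu> (\<one>\<^bsub>G\<^esub>, \<one>\<^bsub>\<Gamma>\<^esub>) = 1"
  using Lam_hom[of \<mu> "\<one>\<^bsub>G\<^esub>" "\<one>\<^bsub>\<Gamma>\<^esub>" "\<one>\<^bsub>G\<^esub>" "\<one>\<^bsub>\<Gamma>\<^esub>"] Lam_nz[of \<mu> "\<one>\<^bsub>G\<^esub>" "\<one>\<^bsub>\<Gamma>\<^esub>"] by simp

lemma Lam_hom_G: "\<mu> \<in> carrier \<Lambda> \<Longrightarrow> g \<in> carrier G \<Longrightarrow> h \<in> carrier G \<Longrightarrow>
    \<mu> (g \<otimes>\<^bsub>G\<^esub> h, \<one>\<^bsub>\<Gamma>\<^esub>) = \<mu> (g, \<one>\<^bsub>\<Gamma>\<^esub>) * \<mu> (h, \<one>\<^bsub>\<Gamma>\<^esub>)"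
  using Lam_hom[of \<mu> g "\<one>\<^bsub>\<Gamma>\<^esub>" h "\<one>\<^bsub>\<Gamma>\<^esub>"] by simp

lemma Lam_hom_Gam: "\<mu> \<in> carrier \<Lambda> \<Longrightarrow> \<gamma> \<in> carrier \<Gamma> \<Longrightarrow> \<delta> \<in> carrier \<Gamma> \<Longrightarrow>
    \<mu> (\<one>\<^bsub>G\<^esub>, \<gamma> \<otimes>\<^bsub>\<Gamma>\<^esub> \<delta>) = \<mu> (\<one>\<^bsub>G\<^esub>, \<gamma>) * \<mu> (\<one>\<^bsub>G\<^esub>, \<delta>)"
  using Lam_hom[of \<mu> "\<one>\<^bsub>G\<^esub>" \<gamma> "\<one>\<^bsub>G\<^esub>" \<delta>] by simp

lemma Lam_mult_apply: "g \<in> carrier G \<Longrightarrow> \<gamma> \<in> carrier \<Gamma> \<Longrightarrow>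
    (\<mu> \<otimes>\<^bsub>\<Lambda>\<^esub> \<nu>) (g, \<gamma>) = \<mu> (g, \<gamma>) * \<nu> (g, \<gamma>)"
  by (simp add: dual_grp_simps(2) GG_carrier)

lemma phi_Lam: "phi D \<in> carrier \<Lambda>"
proof -
  have "phi D \<in> extensional (carrier (G \<times>\<times> \<Gamma>))" by (simp add: phi_def)
  moreover have "phi D \<in> hom (G \<times>\<times> \<Gamma>) unit_grp"
  proof (rule homI)
    fix x assume "x \<in> carrier (G \<times>\<times> \<Gamma>)"
    then show "phi D x \<in> carrier unit_grp"
      using char_nz[OF chi_Gam] char_nz[OF _ a_G] by (cases x) (auto simp: phi_def DirProd_def)
  next
    fix x y assume "x \<in> carrier (G \<times>\<times> \<Gamma>)" "y \<in> carrier (G \<times>\<times> \<Gamma>)"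
    then show "phi D (x \<otimes>\<^bsub>G \<times>\<times> \<Gamma>\<^esub> y) = phi D x \<otimes>\<^bsub>unit_grp\<^esub> phi D y"
      by (cases x; cases y) (simp add: phi_def DirProd_def char_mult[OF chi_Gam] Gam_mult_apply[OF a_G])
  qed
  ultimately show ?thesis by (simp add: dual_grp_simps(1))
qed

lemma phi_shift_Lam: "\<mu> \<in> carrier \<Lambda> \<Longrightarrow> phi_shift D i \<mu> \<in> carrier \<Lambda>"
  unfolding phi_shift_def using phi_Lam by simp

lemma phi_shift_apply:
  assumes "g \<in> carrier G" "\<gamma> \<in> carrier \<Gamma>"
  shows "phi_shift D i \<mu> (g, \<gamma>) = inverse (\<chi> g) ^ i * \<gamma> a ^ i * \<mu> (g, \<gamma>)"
  using assms dual_grp_pow[OF GG_group phi_Lam, of "(g, \<gamma>)" i]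
  by (simp add: phi_shift_def Lam_mult_apply GG_carrier)
    (simp add: phi_def DirProd_def power_mult_distrib)

lemma phi_shift_shift: "\<mu> \<in> carrier \<Lambda> \<Longrightarrow> phi_shift D i (phi_shift D j \<mu>) = phi_shift D (i + j) \<mu>"
  unfolding phi_shift_def using phi_Lam by (simp add: Lam.m_assoc[symmetric] Lam.nat_pow_mult)

lemma at_achi_eq:
  assumes "\<mu> \<in> carrier \<Lambda>"
  shows "at_achi D \<mu> * \<mu> (\<one>\<^bsub>G\<^esub>, \<chi>) = \<mu> (a, \<one>\<^bsub>\<Gamma>\<^esub>)"
  using Lam_hom[OF assms a_G _ _ chi_Gam, of "inv\<^bsub>\<Gamma>\<^esub> \<chi>" "\<one>\<^bsub>G\<^esub>"] chi_Gam a_G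
  by (simp add: at_achi_def)

end

section \<open>Representations\<close>

text \<open>Evaluation of an expression when the letters act on the vectors of an arbitrary vector space with scalar
multiplication \<open>sc\<close>.\<close>

primrec ev :: "('k \<Rightarrow> 'v \<Rightarrow> 'v) \<Rightarrow> ('s \<Rightarrow> 'v \<Rightarrow> 'v::ab_group_add) \<Rightarrow> ('s, 'k) ncpoly \<Rightarrow> 'v \<Rightarrow> 'v" where
  "ev sc A (Gen s) v = A s v"
| "ev sc A (Scal c) v = sc c v"
| "ev sc A (Plus p q) v = ev sc A p v + ev sc A q v"
| "ev sc A (Minus p q) v = ev sc A p v - ev sc A q v"
| "ev sc A (Times p q) v = ev sc A p (ev sc A q v)"

lemma module_hom_funpow:
  assumes "module_hom sc sc f"
  shows "module_hom sc sc (f ^^ i)"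
proof (induction i)
  case 0
  interpret module_hom sc sc f by fact
  show ?case by (simp add: id_def) (rule m1.module_hom_ident)
next
  case (Suc i)
  show ?case using module_hom_compose[OF Suc assms] by (simp add: comp_def)
qed

context dd
begin

text \<open>The defining relations, tested at one vector. With \<open>corr\<close> the relation between \<open>x\<close> and \<open>\<gamma>\<close> takes the same form in
the nilpotent and the non-nilpotent case.\<close>

definition rel_vec :: "('k \<Rightarrow> 'v \<Rightarrow> 'v) \<Rightarrow> (('g, 'k) gen \<Rightarrow> 'v \<Rightarrow> 'v::ab_group_add) \<Rightarrow> 'v \<Rightarrow> bool" where
  "rel_vec sc A v \<longleftrightarrow>
     A (Grp \<one>\<^bsub>G\<^esub>) v = v \<and> A (Chr \<one>\<^bsub>\<Gamma>\<^esub>) v = v \<and>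
     (\<forall>g\<in>carrier G. \<forall>h\<in>carrier G. A (Grp g) (A (Grp h) v) = A (Grp (g \<otimes>\<^bsub>G\<^esub> h)) v) \<and>
     (\<forall>\<gamma>\<in>carrier \<Gamma>. \<forall>\<delta>\<in>carrier \<Gamma>. A (Chr \<gamma>) (A (Chr \<delta>) v) = A (Chr (\<gamma> \<otimes>\<^bsub>\<Gamma>\<^esub> \<delta>)) v) \<and>
     (A GenX ^^ n) v = sc (alp D) (A (Grp (a [^]\<^bsub>G\<^esub> n)) v - v) \<and>
     (A GenXi ^^ n) v = 0 \<and>
     (\<forall>g\<in>carrier G. A GenX (A (Grp g) v) = sc (\<chi> g) (A (Grp g) (A GenX v))) \<and>
     (\<forall>\<gamma>\<in>carrier \<Gamma>. A GenXi (A (Chr \<gamma>) v) = sc (\<gamma> a) (A (Chr \<gamma>) (A GenXi v))) \<and>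
     (\<forall>g\<in>carrier G. \<forall>\<gamma>\<in>carrier \<Gamma>. A (Grp g) (A (Chr \<gamma>) v) = A (Chr \<gamma>) (A (Grp g) v)) \<and>
     (\<forall>g\<in>carrier G. A GenXi (A (Grp g) v) = sc (inverse (\<chi> g)) (A (Grp g) (A GenXi v))) \<and>
     A GenX (A GenXi v) - A GenXi (A GenX v) = A (Grp a) v - A (Chr \<chi>) v \<and>
     (\<forall>\<gamma>\<in>carrier \<Gamma>. sc (\<gamma> a) (A GenX (A (Chr \<gamma>) v)) = A (Chr \<gamma>) (A GenX v) +
        sc (corr \<gamma> / qfact \<rho> (n - 1)) (A (Chr \<gamma>)
          (sc \<rho> (A (Grp a) ((A GenXi ^^ (n - 1)) v)) - A (Chr \<chi>) ((A GenXi ^^ (n - 1)) v))))"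

lemma rel_iff:
  fixes sc :: "'k \<Rightarrow> 'v \<Rightarrow> 'v::ab_group_add"
  assumes "vector_space sc" and lin: "\<And>s. module_hom sc sc (A s)"
  shows "(\<forall>(p, q)\<in>dd_relations D. ev sc A p v = ev sc A q v) \<longleftrightarrow> rel_vec sc A v"
proof -
  interpret vector_space sc by fact
  have pow: "ev sc A (Gen s ^ i) w = (A s ^^ i) w" for s i w
    by (induction i) (simp_all add: one_ncpoly_def times_ncpoly_def)
  have ball1: "(\<forall>x\<in>{f g | g. g \<in> S}. Q x) \<longleftrightarrow> (\<forall>g\<in>S. Q (f g))"
    for f :: "'b \<Rightarrow> 'c" and S Q by blast
  have ball2: "(\<forall>x\<in>{f g h | g h. g \<in> S \<and> h \<in> T}. Q x) \<longleftrightarrow> (\<forall>g\<in>S. \<forall>h\<in>T. Q (f g h))"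
    for f :: "'b \<Rightarrow> 'c \<Rightarrow> 'd" and S T Q by blast
  show ?thesis
  proof (cases "nilpotent_type D")
    case True
    then show ?thesis
      unfolding dd_relations_def rel_vec_def Let_def if_P[OF True] ball_Un ball1 ball2
      by (simp add: pow plus_ncpoly_def minus_ncpoly_def times_ncpoly_def
        one_ncpoly_def zero_ncpoly_def corr_def)
  next
    case False
    then show ?thesis
      unfolding dd_relations_def rel_vec_def Let_def if_not_P[OF False] ball_Un ball1 ball2
      by (simp add: pow plus_ncpoly_def minus_ncpoly_def times_ncpoly_def
        one_ncpoly_def zero_ncpoly_def corr_def)
  qed
qed

end

text \<open>A representation on a subspace \<open>W\<close> of a vector space that is a type. The operators are linear on the whole
type, but the relations hold on \<open>W\<close> only.\<close>

locale dd_rep = dd D + vs: vector_space sc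
  for D :: "('g, 'k::field_char_0) gdatum"
    and sc :: "'k \<Rightarrow> 'v \<Rightarrow> 'v::ab_group_add" (infixr \<open>\<odot>\<close> 75) +
  fixes W :: "'v set" and A :: "('g, 'k) gen \<Rightarrow> 'v \<Rightarrow> 'v"
  assumes W_subspace: "vs.subspace W"
    and lin: "\<And>s. module_hom sc sc (A s)"
    and closed: "\<And>s v. s \<in> dd_gens D \<Longrightarrow> v \<in> W \<Longrightarrow> A s v \<in> W"
    and rel: "\<And>v. v \<in> W \<Longrightarrow> rel_vec sc A v"
begin

abbreviation "X \<equiv> A GenX"
abbreviation "Xi \<equiv> A GenXi"
abbreviation "gg g \<equiv> A (Grp g)"
abbreviation "cc \<gamma> \<equiv> A (Chr \<gamma>)"
abbreviation "K \<equiv> A (Grp a)"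
abbreviation "L \<equiv> A (Chr \<chi>)"

lemma A_add: "A s (u + v) = A s u + A s v"
  and A_scale: "A s (c \<odot> v) = c \<odot> A s v"
  and A_zero: "A s 0 = 0"
  and A_diff: "A s (u - v) = A s u - A s v"
  and A_sum: "A s (\<Sum>i\<in>I. f i) = (\<Sum>i\<in>I. A s (f i))"
  using module_hom.add[OF lin] module_hom.scale[OF lin] module_hom.zero[OF lin]
    module_hom.diff[OF lin] module_hom.sum[OF lin] by auto

lemmas A_lin = A_add A_scale A_zero A_diff

lemma Ap_add: "(A s ^^ i) (u + v) = (A s ^^ i) u + (A s ^^ i) v"
  and Ap_scale: "(A s ^^ i) (c \<odot> v) = c \<odot> (A s ^^ i) v"
  and Ap_zero: "(A s ^^ i) 0 = 0"
  and Ap_diff: "(A s ^^ i) (u - v) = (A s ^^ i) u - (A s ^^ i) v"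
  using module_hom.add[OF module_hom_funpow[OF lin]] module_hom.scale[OF module_hom_funpow[OF lin]]
    module_hom.zero[OF module_hom_funpow[OF lin]] module_hom.diff[OF module_hom_funpow[OF lin]] by auto

lemmas W_rules = vs.subspace_add[OF W_subspace] vs.subspace_scale[OF W_subspace]
  vs.subspace_diff[OF W_subspace] vs.subspace_0[OF W_subspace]

lemma X_W: "v \<in> W \<Longrightarrow> X v \<in> W"
  and Xi_W: "v \<in> W \<Longrightarrow> Xi v \<in> W"
  and gg_W: "g \<in> carrier G \<Longrightarrow> v \<in> W \<Longrightarrow> gg g v \<in> W"
  and cc_W: "\<gamma> \<in> carrier \<Gamma> \<Longrightarrow> v \<in> W \<Longrightarrow> cc \<gamma> v \<in> W"
  using closed by (auto simp: dd_gens_def)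

lemma Xp_W: "v \<in> W \<Longrightarrow> (X ^^ i) v \<in> W"
  and Xip_W: "v \<in> W \<Longrightarrow> (Xi ^^ i) v \<in> W"
  by (induction i) (auto simp: X_W Xi_W)

lemmas W_closed = X_W Xi_W gg_W cc_W Xp_W Xip_W gg_W[OF a_G] cc_W[OF chi_Gam]

lemma X_n: "v \<in> W \<Longrightarrow> (X ^^ n) v = alp D \<odot> (gg (a [^]\<^bsub>G\<^esub> n) v - v)"
  and Xi_n: "v \<in> W \<Longrightarrow> (Xi ^^ n) v = 0"
  and X_gg: "v \<in> W \<Longrightarrow> g \<in> carrier G \<Longrightarrow> X (gg g v) = \<chi> g \<odot> gg g (X v)"
  and Xi_cc: "v \<in> W \<Longrightarrow> \<gamma> \<in> carrier \<Gamma> \<Longrightarrow> Xi (cc \<gamma> v) = \<gamma> a \<odot> cc \<gamma> (Xi v)"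
  and gg_cc: "v \<in> W \<Longrightarrow> g \<in> carrier G \<Longrightarrow> \<gamma> \<in> carrier \<Gamma> \<Longrightarrow> gg g (cc \<gamma> v) = cc \<gamma> (gg g v)"
  and Xi_gg: "v \<in> W \<Longrightarrow> g \<in> carrier G \<Longrightarrow> Xi (gg g v) = inverse (\<chi> g) \<odot> gg g (Xi v)"
  and X_Xi: "v \<in> W \<Longrightarrow> X (Xi v) - Xi (X v) = K v - L v"
  and X_cc: "v \<in> W \<Longrightarrow> \<gamma> \<in> carrier \<Gamma> \<Longrightarrow> \<gamma> a \<odot> X (cc \<gamma> v) = cc \<gamma> (X v) +
        (corr \<gamma> / qfact \<rho> (n - 1)) \<odot> cc \<gamma> (\<rho> \<odot> K ((Xi ^^ (n - 1)) v) - L ((Xi ^^ (n - 1)) v))"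
  and gg_one: "v \<in> W \<Longrightarrow> gg \<one>\<^bsub>G\<^esub> v = v"
  and cc_one: "v \<in> W \<Longrightarrow> cc \<one>\<^bsub>\<Gamma>\<^esub> v = v"
  and gg_mult: "v \<in> W \<Longrightarrow> g \<in> carrier G \<Longrightarrow> h \<in> carrier G \<Longrightarrow> gg g (gg h v) = gg (g \<otimes>\<^bsub>G\<^esub> h) v"
  and cc_mult: "v \<in> W \<Longrightarrow> \<gamma> \<in> carrier \<Gamma> \<Longrightarrow> \<delta> \<in> carrier \<Gamma> \<Longrightarrow> cc \<gamma> (cc \<delta> v) = cc (\<gamma> \<otimes>\<^bsub>\<Gamma>\<^esub> \<delta>) v"
  using rel unfolding rel_vec_def by blast+

lemma gg_X: "v \<in> W \<Longrightarrow> g \<in> carrier G \<Longrightarrow> gg g (X v) = inverse (\<chi> g) \<odot> X (gg g v)"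
  using X_gg chi_nz by simp

lemma gg_Xi: "v \<in> W \<Longrightarrow> g \<in> carrier G \<Longrightarrow> gg g (Xi v) = \<chi> g \<odot> Xi (gg g v)"
  using Xi_gg chi_nz by simp

lemma cc_Xi: "v \<in> W \<Longrightarrow> \<gamma> \<in> carrier \<Gamma> \<Longrightarrow> cc \<gamma> (Xi v) = inverse (\<gamma> a) \<odot> Xi (cc \<gamma> v)"
  using Xi_cc char_nz[OF _ a_G] by simp

lemma cc_X: "v \<in> W \<Longrightarrow> \<gamma> \<in> carrier \<Gamma> \<Longrightarrow> cc \<gamma> (X v) = \<gamma> a \<odot> X (cc \<gamma> v) -
    (corr \<gamma> / qfact \<rho> (n - 1)) \<odot> cc \<gamma> (\<rho> \<odot> K ((Xi ^^ (n - 1)) v) - L ((Xi ^^ (n - 1)) v))"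
  using X_cc by (simp add: algebra_simps)

lemma K_X: "v \<in> W \<Longrightarrow> K (X v) = inverse \<rho> \<odot> X (K v)"
  using gg_X[OF _ a_G] by (simp add: chi_a)

lemma K_Xi: "v \<in> W \<Longrightarrow> K (Xi v) = \<rho> \<odot> Xi (K v)"
  using gg_Xi[OF _ a_G] by (simp add: chi_a)

lemma L_X: "v \<in> W \<Longrightarrow> L (X v) = \<rho> \<odot> X (L v)"
  using cc_X[OF _ chi_Gam] by (simp add: chi_a corr_chi)

lemma L_Xi: "v \<in> W \<Longrightarrow> L (Xi v) = inverse \<rho> \<odot> Xi (L v)"
  using cc_Xi[OF _ chi_Gam] by (simp add: chi_a)

definition eig :: "'k \<Rightarrow> 'k \<Rightarrow> 'v \<Rightarrow> bool" where
  "eig \<kappa> \<theta> v \<longleftrightarrow> v \<in> W \<and> K v = \<kappa> \<odot> v \<and> L v = \<theta> \<odot> v"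

lemma eig_Xp: "eig \<kappa> \<theta> v \<Longrightarrow> eig (inverse \<rho> ^ i * \<kappa>) (\<rho> ^ i * \<theta>) ((X ^^ i) v)"
  by (induction i) (auto simp: eig_def W_closed K_X L_X A_scale mult_ac)

lemma eig_Xip: "eig \<kappa> \<theta> v \<Longrightarrow> eig (\<rho> ^ i * \<kappa>) (inverse \<rho> ^ i * \<theta>) ((Xi ^^ i) v)"
  by (induction i) (auto simp: eig_def W_closed K_Xi L_Xi A_scale mult_ac)

end

context dd
begin

text \<open>The coefficient \<open>\<alpha>\<^sub>i\<close>, in terms of the eigenvalues \<open>\<kappa>\<close> of \<open>a\<close> and \<open>\<theta>\<close> of \<open>\<chi>\<close> at the starting vector.\<close>

definition acoef :: "'k \<Rightarrow> 'k \<Rightarrow> nat \<Rightarrow> 'k" where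
  "acoef \<kappa> \<theta> i = qnum \<rho> i * (\<theta> - \<kappa> * \<rho> powi (1 - int i))"

lemma acoef_0 [simp]: "acoef \<kappa> \<theta> 0 = 0"
  by (simp add: acoef_def)

lemma acoef_Suc: "acoef \<kappa> \<theta> (Suc i) = acoef \<kappa> \<theta> i + \<rho> ^ i * \<theta> - inverse \<rho> ^ i * \<kappa>"
proof -
  have p1: "\<rho> powi (1 - int i) = \<rho> * inverse \<rho> ^ i"
    using rho_nz by (simp add: power_int_diff power_inverse field_simps)
  have p2: "\<rho> powi (1 - int (Suc i)) = inverse \<rho> ^ i"
    using rho_nz by (simp add: power_int_minus power_inverse)
  have q: "qnum \<rho> i * \<rho> - qnum \<rho> i - \<rho> ^ i = -1"
    using qnum_eq[of i] by (simp add: algebra_simps)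
  have "acoef \<kappa> \<theta> (Suc i) = acoef \<kappa> \<theta> i + \<rho> ^ i * \<theta>
      + \<kappa> * inverse \<rho> ^ i * (qnum \<rho> i * \<rho> - qnum \<rho> i - \<rho> ^ i)"
    unfolding acoef_def p1 p2 qnum_Suc by (simp add: algebra_simps)
  then show ?thesis unfolding q by (simp add: mult.commute)
qed

lemma alpha_coeff_eq: "alpha_coeff D \<mu> i = acoef (\<mu> (a, \<one>\<^bsub>\<Gamma>\<^esub>)) (\<mu> (\<one>\<^bsub>G\<^esub>, \<chi>)) i"
  by (simp add: alpha_coeff_def acoef_def)

end

context dd_rep
begin

text \<open>Each exchange of \<open>\<xi>\<close> with a factor \<open>x\<close> contributes \<open>\<chi> - a\<close>, whose eigenvalue at \<open>x\<^sup>i v\<close> is the increment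
\<open>acoef_Suc\<close>.\<close>

lemma Xi_Xp:
  assumes "eig \<kappa> \<theta> v"
  shows "Xi ((X ^^ i) v) = (X ^^ i) (Xi v) + acoef \<kappa> \<theta> i \<odot> (X ^^ (i - 1)) v"
proof (induction i)
  case (Suc i)
  have W: "(X ^^ i) v \<in> W" and e: "eig (inverse \<rho> ^ i * \<kappa>) (\<rho> ^ i * \<theta>) ((X ^^ i) v)"
    using eig_Xp[OF assms] by (auto simp: eig_def)
  have "X (acoef \<kappa> \<theta> i \<odot> (X ^^ (i - 1)) v) = acoef \<kappa> \<theta> i \<odot> (X ^^ i) v"
    by (cases i) (simp_all add: A_scale A_zero)
  then have "X (Xi ((X ^^ i) v)) = (X ^^ Suc i) (Xi v) + acoef \<kappa> \<theta> i \<odot> (X ^^ i) v"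
    by (simp add: Suc.IH A_add)
  moreover have "Xi (X ((X ^^ i) v)) = X (Xi ((X ^^ i) v)) - K ((X ^^ i) v) + L ((X ^^ i) v)"
    using X_Xi[OF W] by (simp add: algebra_simps)
  ultimately show ?case
    using e by (simp add: eig_def acoef_Suc vs.scale_left_distrib vs.scale_left_diff_distrib)
qed simp

subsection \<open>The Casimir operator\<close>

text \<open>The coefficients are the ones that make the operator commute with \<open>x\<close>: the commutator of \<open>(1 - \<rho>) x \<xi>\<close> with \<open>x\<close> is
\<open>(\<rho> - 1) x (a - \<chi>)\<close>, and \<open>\<rho> a + \<chi>\<close> compensates it since \<open>x a = \<rho> a x\<close> and \<open>\<chi> x = \<rho> x \<chi>\<close>.\<close>

definition cas :: "'v \<Rightarrow> 'v" where
  "cas v = (1 - \<rho>) \<odot> X (Xi v) + \<rho> \<odot> K v + L v"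

lemma module_hom_cas: "module_hom sc sc cas"
  by unfold_locales (simp_all add: cas_def A_lin algebra_simps)

lemma cas_W: "v \<in> W \<Longrightarrow> cas v \<in> W"
  by (simp add: cas_def W_closed W_rules)

lemma cas_X: "v \<in> W \<Longrightarrow> cas (X v) = X (cas v)"
proof -
  assume v: "v \<in> W"
  have 1: "Xi (X v) = X (Xi v) - K v + L v" using X_Xi[OF v] by (simp add: algebra_simps)
  show ?thesis
    unfolding cas_def K_X[OF v] L_X[OF v] 1 A_lin using rho_nz
    by (simp add: algebra_simps)
qed

lemma cas_Xi: "v \<in> W \<Longrightarrow> cas (Xi v) = Xi (cas v)"
proof -
  assume v: "v \<in> W"
  have 1: "X (Xi (Xi v)) = Xi (X (Xi v)) + K (Xi v) - L (Xi v)"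
    using X_Xi[OF Xi_W[OF v]] by (simp add: algebra_simps)
  have 2: "Xi (K v) = inverse \<rho> \<odot> K (Xi v)" "Xi (L v) = \<rho> \<odot> L (Xi v)"
    using rho_nz by (simp_all add: K_Xi L_Xi v)
  show ?thesis
    unfolding cas_def A_lin 1 2 using rho_nz
    by (simp add: algebra_simps)
qed

lemma cas_gg: "v \<in> W \<Longrightarrow> g \<in> carrier G \<Longrightarrow> cas (gg g v) = gg g (cas v)"
proof -
  assume v: "v \<in> W" and g: "g \<in> carrier G"
  have "K (gg g v) = gg g (K v)" using gg_mult[OF v] g a_G G.m_comm by simp
  then show ?thesis
    unfolding cas_def using chi_nz[OF g]
    by (simp add: Xi_gg X_gg gg_cc[OF v g chi_Gam] v g W_closed A_lin)
qed

text \<open>The correction term in the relation between \<open>x\<close> and \<open>\<gamma>\<close> carries a factor \<open>\<xi>\<^bsup>n-1\<^esup>\<close>, which meets the \<open>\<xi>\<close> of the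
Casimir operator.\<close>

lemma cas_cc: "v \<in> W \<Longrightarrow> \<gamma> \<in> carrier \<Gamma> \<Longrightarrow> cas (cc \<gamma> v) = cc \<gamma> (cas v)"
proof -
  assume v: "v \<in> W" and g: "\<gamma> \<in> carrier \<Gamma>"
  interpret C: comm_group \<Gamma> by (rule Gam_comm)
  have L: "L (cc \<gamma> v) = cc \<gamma> (L v)" using cc_mult[OF v] g chi_Gam C.m_comm by metis
  have "(Xi ^^ (n - 1)) (Xi v) = (Xi ^^ n) v"
    using n2 by (simp flip: funpow_Suc_right[THEN fun_cong, unfolded comp_def])
  then have "(Xi ^^ (n - 1)) (Xi v) = 0" using Xi_n[OF v] by simp
  then have "X (Xi (cc \<gamma> v)) = cc \<gamma> (X (Xi v))"
    using X_cc[OF Xi_W[OF v] g] by (simp add: Xi_cc[OF v g] A_lin)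
  then show ?thesis
    unfolding cas_def using L by (simp add: gg_cc[OF v a_G g] A_lin)
qed

end

section \<open>Weight vectors and the submodules they generate\<close>

lemma (in vector_space) span_family:
  assumes "finite I" "v \<in> span (b ` I)"
  shows "\<exists>c. v = (\<Sum>p\<in>I. c p *s b p)"
proof -
  let ?U = "{v. \<exists>c. v = (\<Sum>p\<in>I. c p *s b p)}"
  have "subspace ?U"
  proof (rule subspaceI)
    show "0 \<in> ?U" by (auto intro: exI[of _ "\<lambda>_. 0"])
  next
    fix x y assume "x \<in> ?U" "y \<in> ?U"
    then obtain c d where "x = (\<Sum>p\<in>I. c p *s b p)" "y = (\<Sum>p\<in>I. d p *s b p)" by blast
    then show "x + y \<in> ?U"
      by (intro CollectI exI[of _ "\<lambda>p. c p + d p"]) (simp add: scale_left_distrib sum.distrib)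
  next
    fix k x assume "x \<in> ?U"
    then obtain c where "x = (\<Sum>p\<in>I. c p *s b p)" by blast
    then show "k *s x \<in> ?U"
      by (intro CollectI exI[of _ "\<lambda>p. k * c p"]) (simp add: scale_sum_right)
  qed
  moreover have "b ` I \<subseteq> ?U"
  proof
    fix x assume "x \<in> b ` I"
    then obtain q where q: "q \<in> I" "x = b q" by blast
    have "(\<Sum>p\<in>I. (if p = q then 1 else 0) *s b p) = (\<Sum>p\<in>I. if p = q then b p else 0)"
      by (intro sum.cong) auto
    then have "x = (\<Sum>p\<in>I. (if p = q then 1 else 0) *s b p)" using q assms(1) by simp
    then show "x \<in> ?U" by (intro CollectI exI[of _ "\<lambda>p. if p = q then 1 else 0"])
  qed
  ultimately show ?thesis using assms(2) span_minimal by blast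
qed

lemma (in vector_space) span_map:
  assumes f: "module_hom scale scale f" and B: "\<And>b. b \<in> B \<Longrightarrow> f b \<in> span C" and v: "v \<in> span B"
  shows "f v \<in> span C"
proof -
  interpret module_hom scale scale f by fact
  have "subspace {v. f v \<in> span C}"
    by (rule subspaceI) (auto simp: zero add scale span_zero span_add span_scale)
  then show ?thesis using span_minimal[of B "{v. f v \<in> span C}"] B v by blast
qed

context dd_rep
begin

text \<open>Vectors of weight \<open>\<psi>\<close>; a character \<open>\<psi>\<close> of the product is determined by its restrictions to the two factors.\<close>

definition wt :: "('g \<times> ('g \<Rightarrow> 'k) \<Rightarrow> 'k) \<Rightarrow> 'v \<Rightarrow> bool" where
  "wt \<psi> v \<longleftrightarrow> v \<in> W \<and> (\<forall>g\<in>carrier G. gg g v = \<psi> (g, \<one>\<^bsub>\<Gamma>\<^esub>) \<odot> v) \<and>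
     (\<forall>\<gamma>\<in>carrier \<Gamma>. cc \<gamma> v = \<psi> (\<one>\<^bsub>G\<^esub>, \<gamma>) \<odot> v)"

lemma wt_eig: "wt \<psi> v \<Longrightarrow> eig (\<psi> (a, \<one>\<^bsub>\<Gamma>\<^esub>)) (\<psi> (\<one>\<^bsub>G\<^esub>, \<chi>)) v"
  using a_G chi_Gam by (simp add: wt_def eig_def)

lemma wt_Xip_gg: "wt \<psi> v \<Longrightarrow> g \<in> carrier G \<Longrightarrow>
    gg g ((Xi ^^ j) v) = (\<chi> g ^ j * \<psi> (g, \<one>\<^bsub>\<Gamma>\<^esub>)) \<odot> (Xi ^^ j) v"
  by (induction j) (auto simp: wt_def W_closed gg_Xi A_scale mult_ac)

lemma wt_Xip_cc: "wt \<psi> v \<Longrightarrow> \<gamma> \<in> carrier \<Gamma> \<Longrightarrow>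
    cc \<gamma> ((Xi ^^ j) v) = (inverse (\<gamma> a) ^ j * \<psi> (\<one>\<^bsub>G\<^esub>, \<gamma>)) \<odot> (Xi ^^ j) v"
  by (induction j) (auto simp: wt_def W_closed cc_Xi A_scale mult_ac)

lemma gg_Xp: "g \<in> carrier G \<Longrightarrow> v \<in> W \<Longrightarrow> gg g ((X ^^ i) v) = inverse (\<chi> g) ^ i \<odot> (X ^^ i) (gg g v)"
  by (induction i) (auto simp: W_closed gg_X A_scale mult_ac)

text \<open>The monomials \<open>x\<^sup>i \<xi>\<^sup>j\<close> applied to \<open>z\<close>, and the span of those with at most \<open>i\<close> factors \<open>x\<close>.\<close>

definition pbw :: "'v \<Rightarrow> nat \<Rightarrow> nat \<Rightarrow> 'v" where
  "pbw z i j = (X ^^ i) ((Xi ^^ j) z)"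

definition level :: "'v \<Rightarrow> nat \<Rightarrow> 'v set" where
  "level z i = vs.span ((\<lambda>(i, j). pbw z i j) ` ({..i} \<times> {..<n}))"

lemma pbw_level: "i' \<le> i \<Longrightarrow> j < n \<Longrightarrow> pbw z i' j \<in> level z i"
  unfolding level_def by (rule vs.span_base) auto

lemma level_mono: "i \<le> i' \<Longrightarrow> level z i \<subseteq> level z i'"
  unfolding level_def by (rule vs.span_mono) auto

lemma level_map:
  assumes "module_hom sc sc f" "\<And>i' j. i' \<le> i \<Longrightarrow> j < n \<Longrightarrow> f (pbw z i' j) \<in> level z k" "v \<in> level z i"
  shows "f v \<in> level z k"
  unfolding level_def
  by (rule vs.span_map[OF assms(1) _ assms(3)[unfolded level_def]])
    (use assms(2)[unfolded level_def] in auto)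

lemmas level_rules = vs.span_add[of _ "(\<lambda>(i, j). pbw z i j) ` ({..i} \<times> {..<n})" for z i, folded level_def]
  vs.span_scale[of _ "(\<lambda>(i, j). pbw z i j) ` ({..i} \<times> {..<n})" for z i, folded level_def]
  vs.span_diff[of _ "(\<lambda>(i, j). pbw z i j) ` ({..i} \<times> {..<n})" for z i, folded level_def]
  vs.span_zero[of "(\<lambda>(i, j). pbw z i j) ` ({..i} \<times> {..<n})" for z i, folded level_def]

context
  fixes \<psi> z assumes z: "wt \<psi> z"
begin

lemma z_W: "z \<in> W" using z by (simp add: wt_def)

lemma pbw_W: "pbw z i j \<in> W"
  by (simp add: pbw_def W_closed z_W)

lemma level_W: "level z i \<subseteq> W"
  unfolding level_def by (rule vs.span_minimal[OF _ W_subspace]) (auto simp: pbw_W)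

lemma gg_pbw: "g \<in> carrier G \<Longrightarrow>
    gg g (pbw z i j) = (inverse (\<chi> g) ^ i * \<chi> g ^ j * \<psi> (g, \<one>\<^bsub>\<Gamma>\<^esub>)) \<odot> pbw z i j"
  by (simp add: pbw_def gg_Xp W_closed z_W wt_Xip_gg[OF z] Ap_scale mult_ac)

lemma gg_level: "g \<in> carrier G \<Longrightarrow> v \<in> level z i \<Longrightarrow> gg g v \<in> level z i"
  by (rule level_map[OF lin, of i]) (auto simp: gg_pbw intro: level_rules pbw_level)

lemma L_level: "v \<in> level z i \<Longrightarrow> L v \<in> level z i"
proof (rule level_map[OF lin, of i])
  fix i' j assume "i' \<le> i" "j < n"
  moreover have "\<exists>c. L (pbw z i' j) = c \<odot> pbw z i' j"
    using eig_Xp[OF eig_Xip[OF wt_eig[OF z]]] unfolding pbw_def eig_def by blast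
  ultimately show "L (pbw z i' j) \<in> level z i" using level_rules(2) pbw_level by metis
qed

lemma X_level: "v \<in> level z i \<Longrightarrow> X v \<in> level z (Suc i)"
proof (rule level_map[OF lin, of i])
  fix i' j assume "i' \<le> i" "j < n"
  then show "X (pbw z i' j) \<in> level z (Suc i)" using pbw_level[of "Suc i'"] by (simp add: pbw_def)
qed

lemma Xi_level: "v \<in> level z i \<Longrightarrow> Xi v \<in> level z i"
proof (rule level_map[OF lin, of i])
  fix i' j assume ij: "i' \<le> i" "j < n"
  have "(X ^^ i') (Xi ((Xi ^^ j) z)) \<in> level z i"
  proof (cases "Suc j = n")
    case True
    then have "Xi ((Xi ^^ j) z) = 0" using Xi_n[OF z_W] by (metis comp_apply funpow.simps(2))
    then show ?thesis by (simp add: Ap_zero level_rules)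
  next
    case False
    then show ?thesis using pbw_level[of i' i "Suc j" z] ij by (simp add: pbw_def)
  qed
  moreover have "(X ^^ (i' - 1)) ((Xi ^^ j) z) \<in> level z i"
    using pbw_level[of "i' - 1" i j z] ij by (simp add: pbw_def)
  ultimately show "Xi (pbw z i' j) \<in> level z i"
    unfolding pbw_def Xi_Xp[OF eig_Xip[OF wt_eig[OF z]]] by (intro level_rules)
qed

lemma Xip_level: "v \<in> level z i \<Longrightarrow> (Xi ^^ k) v \<in> level z i"
  by (induction k) (auto simp: Xi_level)

text \<open>Moving \<open>\<gamma>\<close> past \<open>x\<close> produces a term that has no more factors \<open>x\<close> than before, so the
  statement propagates from one level to the next.\<close>

lemma cc_level: "\<gamma> \<in> carrier \<Gamma> \<Longrightarrow> v \<in> level z i \<Longrightarrow> cc \<gamma> v \<in> level z i"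
proof (induction i arbitrary: v)
  case 0
  show ?case
  proof (rule level_map[OF lin _ 0(2)])
    fix i' j assume "i' \<le> (0::nat)" "j < n"
    then show "cc \<gamma> (pbw z i' j) \<in> level z 0"
      using wt_Xip_cc[OF z 0(1), of j] pbw_level[of 0 0 j z]
      by (auto simp: pbw_def intro: level_rules)
  qed
next
  case (Suc i)
  show ?case
  proof (rule level_map[OF lin _ Suc.prems(2)])
    fix i' j assume ij: "i' \<le> Suc i" "j < n"
    show "cc \<gamma> (pbw z i' j) \<in> level z (Suc i)"
    proof (cases "i' \<le> i")
      case True
      then show ?thesis
        using Suc.IH[OF Suc.prems(1) pbw_level[of i' i j z]] ij level_mono[of i "Suc i" z] by auto
    next
      case False
      define y where "y = pbw z i j"
      have y: "y \<in> level z i" "y \<in> W" using ij pbw_level pbw_W by (auto simp: y_def)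
      have "pbw z i' j = X y" using False ij by (simp add: y_def pbw_def le_Suc_eq)
      moreover have "cc \<gamma> (X y) \<in> level z (Suc i)"
        unfolding cc_X[OF y(2) Suc.prems(1)]
      proof (intro level_rules)
        show "X (cc \<gamma> y) \<in> level z (Suc i)" by (rule X_level[OF Suc.IH[OF Suc.prems(1) y(1)]])
        have "\<rho> \<odot> K ((Xi ^^ (n - 1)) y) - L ((Xi ^^ (n - 1)) y) \<in> level z i"
          by (intro level_rules gg_level L_level Xip_level y a_G)
        then show "cc \<gamma> (\<rho> \<odot> K ((Xi ^^ (n - 1)) y) - L ((Xi ^^ (n - 1)) y)) \<in> level z (Suc i)"
          using Suc.IH[OF Suc.prems(1)] level_mono[of i "Suc i" z] by auto
      qed
      ultimately show ?thesis by simp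
    qed
  qed
qed

text \<open>At the top level \<open>x\<^sup>n\<close> is a linear combination of group elements and falls back to level \<open>0\<close>.\<close>

lemma X_level_top: "v \<in> level z (n - 1) \<Longrightarrow> X v \<in> level z (n - 1)"
proof (rule level_map[OF lin, of "n - 1"])
  fix i j assume ij: "i \<le> n - 1" "j < n"
  show "X (pbw z i j) \<in> level z (n - 1)"
  proof (cases "i = n - 1")
    case True
    then have "X (pbw z i j) = (X ^^ n) (pbw z 0 j)" using n2
      by (cases n) (auto simp: pbw_def)
    also have "\<dots> \<in> level z (n - 1)"
      unfolding X_n[OF pbw_W] by (intro level_rules gg_level pbw_level) (use ij a_G in auto)
    finally show ?thesis .
  next
    case False
    then show ?thesis using pbw_level[of "Suc i" "n - 1" j z] ij by (simp add: pbw_def)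
  qed
qed

lemma level_submodule: "s \<in> dd_gens D \<Longrightarrow> v \<in> level z (n - 1) \<Longrightarrow> A s v \<in> level z (n - 1)"
  unfolding dd_gens_def using gg_level cc_level X_level_top Xi_level by auto

lemma z_level: "z \<in> level z (n - 1)"
  using pbw_level[of 0 "n - 1" 0 z] n2 by (simp add: pbw_def)

lemma level_family: "v \<in> level z (n - 1) \<longleftrightarrow> (\<exists>c. v = (\<Sum>p\<in>{..<n}\<times>{..<n}. c p \<odot> pbw z (fst p) (snd p)))"
proof
  have I: "{..n - 1} = {..<n}" using n2 by auto
  assume "v \<in> level z (n - 1)"
  then show "\<exists>c. v = (\<Sum>p\<in>{..<n}\<times>{..<n}. c p \<odot> pbw z (fst p) (snd p))"
    using vs.span_family[of "{..<n}\<times>{..<n}" v "\<lambda>(i, j). pbw z i j"]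
    unfolding level_def I by (simp add: case_prod_beta)
next
  assume "\<exists>c. v = (\<Sum>p\<in>{..<n}\<times>{..<n}. c p \<odot> pbw z (fst p) (snd p))"
  then show "v \<in> level z (n - 1)"
  proof
    fix c assume v: "v = (\<Sum>p\<in>{..<n}\<times>{..<n}. c p \<odot> pbw z (fst p) (snd p))"
    show "v \<in> level z (n - 1)"
      unfolding v level_def by (rule vs.span_sum, rule vs.span_scale, rule vs.span_base) auto
  qed
qed

end

subsection \<open>Polynomials in the Casimir operator\<close>

lemma cas_lin: "cas (u + v) = cas u + cas v" "cas (c \<odot> v) = c \<odot> cas v" "cas 0 = 0"
  "cas (u - v) = cas u - cas v" "cas (\<Sum>i\<in>I. f i) = (\<Sum>i\<in>I. cas (f i))"
  using module_hom.add[OF module_hom_cas] module_hom.scale[OF module_hom_cas]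
    module_hom.zero[OF module_hom_cas] module_hom.diff[OF module_hom_cas]
    module_hom.sum[OF module_hom_cas] by auto

definition pact :: "'k poly \<Rightarrow> 'v \<Rightarrow> 'v" where
  "pact p v = (\<Sum>i\<le>degree p. coeff p i \<odot> (cas ^^ i) v)"

lemma pact_bound: "degree p \<le> m \<Longrightarrow> pact p v = (\<Sum>i\<le>m. coeff p i \<odot> (cas ^^ i) v)"
  unfolding pact_def by (rule sum.mono_neutral_left) (auto simp: coeff_eq_0)

lemma pact_0 [simp]: "pact 0 v = 0"
  by (simp add: pact_def)

lemma pact_1 [simp]: "pact 1 v = v"
  by (simp add: pact_def)

lemma pact_add: "pact (p + q) v = pact p v + pact q v"
proof -
  let ?m = "max (degree p) (degree q)"
  have "degree (p + q) \<le> ?m" by (rule degree_add_le_max)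
  then show ?thesis
    by (simp add: pact_bound[of _ ?m] sum.distrib vs.scale_left_distrib)
qed

lemma pact_smult: "pact (smult c p) v = c \<odot> pact p v"
  by (simp add: pact_bound[of "smult c p" "degree p"] degree_smult_le pact_def vs.scale_sum_right)

lemma pact_pCons: "pact (pCons c p) v = c \<odot> v + cas (pact p v)"
proof -
  have "pact (pCons c p) v = (\<Sum>i\<le>Suc (degree p). coeff (pCons c p) i \<odot> (cas ^^ i) v)"
    by (rule pact_bound) (simp add: degree_pCons_le)
  also have "\<dots> = c \<odot> v + (\<Sum>i\<le>degree p. coeff p i \<odot> (cas ^^ Suc i) v)"
    by (simp only: sum.atMost_Suc_shift) simp
  finally show ?thesis by (simp add: pact_def cas_lin)
qed

lemma pact_mult: "pact (p * q) v = pact p (pact q v)"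
  by (induction p) (simp_all add: pact_pCons pact_add pact_smult)

lemma pact_vadd: "pact p (u + v) = pact p u + pact p v"
  by (induction p) (simp_all add: pact_pCons cas_lin vs.scale_right_distrib add_ac)

lemma pact_vscale: "pact p (c \<odot> v) = c \<odot> pact p v"
  by (induction p) (simp_all add: pact_pCons cas_lin vs.scale_right_distrib mult_ac)

lemma pact_vzero: "pact p 0 = 0"
  by (induction p) (simp_all add: pact_pCons cas_lin)

lemma pact_W: "v \<in> W \<Longrightarrow> pact p v \<in> W"
  by (induction p) (simp_all add: pact_pCons cas_W W_rules)

lemma cas_Xp: "v \<in> W \<Longrightarrow> cas ((X ^^ i) v) = (X ^^ i) (cas v)"
  by (induction i) (simp_all add: cas_X Xp_W)

lemma cas_gens: "s \<in> dd_gens D \<Longrightarrow> v \<in> W \<Longrightarrow> cas (A s v) = A s (cas v)"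
  unfolding dd_gens_def using cas_X cas_Xi cas_gg cas_cc by auto

lemma pact_gens: "s \<in> dd_gens D \<Longrightarrow> v \<in> W \<Longrightarrow> pact p (A s v) = A s (pact p v)"
  by (induction p) (simp_all add: pact_pCons cas_gens A_lin pact_W)

lemma pact_eigen: "cas v = c \<odot> v \<Longrightarrow> pact p v = poly p c \<odot> v"
  by (induction p) (simp_all add: pact_pCons cas_lin vs.scale_left_distrib mult_ac)

lemma cas_eig: "eig \<kappa> \<theta> v \<Longrightarrow> Xi v = 0 \<Longrightarrow> cas v = (\<rho> * \<kappa> + \<theta>) \<odot> v"
  by (simp add: cas_def eig_def A_zero vs.scale_left_distrib)

text \<open>On weight vectors \<open>x \<xi>\<close> is, up to a scalar, the Casimir operator minus a constant.\<close>

lemma pact_prod: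
  assumes "eig \<kappa> \<theta> v"
  shows "pact (\<Prod>k<j. [:- (\<rho> ^ Suc k * \<kappa> + inverse \<rho> ^ k * \<theta>), 1:]) v = (1 - \<rho>) ^ j \<odot> (X ^^ j) ((Xi ^^ j) v)"
proof (induction j)
  case (Suc j)
  let ?c = "\<rho> ^ Suc j * \<kappa> + inverse \<rho> ^ j * \<theta>" and ?y = "(Xi ^^ j) v"
  have e: "eig (\<rho> ^ j * \<kappa>) (inverse \<rho> ^ j * \<theta>) ?y" by (rule eig_Xip[OF assms])
  then have yW: "?y \<in> W" by (simp add: eig_def)
  have "cas ?y - ?c \<odot> ?y = (1 - \<rho>) \<odot> X (Xi ?y)"
    using e by (simp add: cas_def eig_def vs.scale_left_distrib mult.assoc)
  moreover have "cas ((X ^^ j) ?y) = (X ^^ j) (cas ?y)"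
    by (rule cas_Xp[OF yW])
  ultimately have *: "cas ((X ^^ j) ?y) - ?c \<odot> (X ^^ j) ?y = (1 - \<rho>) \<odot> (X ^^ j) (X (Xi ?y))"
    by (metis Ap_diff Ap_scale)
  have "pact (\<Prod>k<Suc j. [:- (\<rho> ^ Suc k * \<kappa> + inverse \<rho> ^ k * \<theta>), 1:]) v
      = pact [:- ?c, 1:] (pact (\<Prod>k<j. [:- (\<rho> ^ Suc k * \<kappa> + inverse \<rho> ^ k * \<theta>), 1:]) v)"
    unfolding prod.lessThan_Suc by (subst mult.commute) (rule pact_mult)
  also have "\<dots> = (1 - \<rho>) ^ j \<odot> (cas ((X ^^ j) ?y) - ?c \<odot> (X ^^ j) ?y)"
    unfolding Suc.IH by (simp add: pact_pCons cas_lin algebra_simps)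
  also have "\<dots> = (1 - \<rho>) ^ Suc j \<odot> (X ^^ Suc j) ((Xi ^^ Suc j) v)"
    unfolding * by (simp add: funpow_swap1 mult.commute)
  finally show ?case .
qed simp

end

section \<open>The universal property of a free weight vector\<close>

definition pair_sc :: "('k \<Rightarrow> 'u \<Rightarrow> 'u) \<Rightarrow> ('k \<Rightarrow> 'v \<Rightarrow> 'v) \<Rightarrow> 'k \<Rightarrow> 'u \<times> 'v \<Rightarrow> 'u \<times> 'v" where
  "pair_sc sc1 sc2 c = map_prod (sc1 c) (sc2 c)"

lemma funpow_map_prod: "(map_prod f g ^^ i) (u, v) = ((f ^^ i) u, (g ^^ i) v)"
  for f :: "'u \<Rightarrow> 'u" and g :: "'v \<Rightarrow> 'v"
  by (induction i) auto

lemma (in dd) dd_rep_pair: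
  assumes "dd_rep D sc1 W1 A1" "dd_rep D sc2 W2 A2"
  shows "dd_rep D (pair_sc sc1 sc2) (W1 \<times> W2) (\<lambda>s. map_prod (A1 s) (A2 s))"
proof -
  interpret R1: dd_rep D sc1 W1 A1 by fact
  interpret R2: dd_rep D sc2 W2 A2 by fact
  interpret vector_space "pair_sc sc1 sc2"
    by unfold_locales (auto simp: pair_sc_def algebra_simps)
  show ?thesis
  proof unfold_locales
    show "subspace (W1 \<times> W2)"
      by (rule subspaceI) (auto simp: pair_sc_def R1.W_rules R2.W_rules zero_prod_def)
    show "map_prod (A1 s) (A2 s) (x + y) = map_prod (A1 s) (A2 s) x + map_prod (A1 s) (A2 s) y" for s x y
      by (cases x; cases y) (simp add: R1.A_lin R2.A_lin)
    show "map_prod (A1 s) (A2 s) (pair_sc sc1 sc2 c x) = pair_sc sc1 sc2 c (map_prod (A1 s) (A2 s) x)" for s c x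
      by (cases x) (simp add: pair_sc_def R1.A_lin R2.A_lin)
    show "map_prod (A1 s) (A2 s) v \<in> W1 \<times> W2" if "s \<in> dd_gens D" "v \<in> W1 \<times> W2" for s v
      using that R1.closed R2.closed by auto
    show "rel_vec (pair_sc sc1 sc2) (\<lambda>s. map_prod (A1 s) (A2 s)) v" if "v \<in> W1 \<times> W2" for v
    proof -
      obtain u w where v: "v = (u, w)" "u \<in> W1" "w \<in> W2" using \<open>v \<in> W1 \<times> W2\<close> by auto
      show ?thesis using R1.rel[OF v(2)] R2.rel[OF v(3)]
        unfolding rel_vec_def v(1) funpow_map_prod pair_sc_def map_prod_simp
        by (simp add: zero_prod_def)
    qed
  qed
qed

text \<open>The submodule generated by \<open>(z, w)\<close> in the product is the graph of the homomorphism.\<close>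

lemma (in dd) free_weight_hom:
  fixes sc1 :: "'k \<Rightarrow> 'u \<Rightarrow> 'u::ab_group_add" and sc2 :: "'k \<Rightarrow> 'v \<Rightarrow> 'v::ab_group_add"
  assumes R1: "dd_rep D sc1 W1 A1" and R2: "dd_rep D sc2 W2 A2"
    and z: "dd_rep.wt D sc1 W1 A1 \<psi> z" and w: "dd_rep.wt D sc2 W2 A2 \<psi> w"
    and gen: "W1 \<subseteq> dd_rep.level D sc1 A1 z (n - 1)"
    and ind: "\<And>c p. (\<Sum>p\<in>{..<n}\<times>{..<n}. sc1 (c p) (dd_rep.pbw A1 z (fst p) (snd p))) = 0 \<Longrightarrow>
       p \<in> {..<n}\<times>{..<n} \<Longrightarrow> c p = 0"
  obtains f where "\<And>u v. u \<in> W1 \<Longrightarrow> v \<in> W1 \<Longrightarrow> f (u + v) = f u + f v"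
    "\<And>c u. u \<in> W1 \<Longrightarrow> f (sc1 c u) = sc2 c (f u)" "\<And>u. u \<in> W1 \<Longrightarrow> f u \<in> W2"
    "\<And>s u. s \<in> dd_gens D \<Longrightarrow> u \<in> W1 \<Longrightarrow> f (A1 s u) = A2 s (f u)" "f z = w"
proof -
  interpret R1: dd_rep D sc1 W1 A1 by fact
  interpret R2: dd_rep D sc2 W2 A2 by fact
  let ?sc = "pair_sc sc1 sc2" and ?A = "\<lambda>s. map_prod (A1 s) (A2 s)"
  interpret P: dd_rep D ?sc "W1 \<times> W2" ?A by (rule dd_rep_pair[OF R1 R2])
  let ?I = "{..<n}\<times>{..<n}"
  have zw: "P.wt \<psi> (z, w)"
    using z w unfolding P.wt_def R1.wt_def R2.wt_def by (simp add: pair_sc_def)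
  have pbw: "P.pbw (z, w) i j = (R1.pbw z i j, R2.pbw w i j)" for i j
    by (simp add: P.pbw_def R1.pbw_def R2.pbw_def funpow_map_prod)
  define Z where "Z = P.level (z, w) (n - 1)"
  have sum_pair: "(\<Sum>p\<in>I. (f p, g p)) = (sum f I, sum g I)" for f :: "nat \<times> nat \<Rightarrow> 'u" and g :: "nat \<times> nat \<Rightarrow> 'v" and I
    by (induction I rule: infinite_finite_induct) (auto simp: zero_prod_def)
  have Z: "(u, v) \<in> Z \<longleftrightarrow> (\<exists>c. u = (\<Sum>p\<in>?I. sc1 (c p) (R1.pbw z (fst p) (snd p))) \<and>
      v = (\<Sum>p\<in>?I. sc2 (c p) (R2.pbw w (fst p) (snd p))))" for u v
    unfolding Z_def P.level_family[OF zw] by (simp add: pbw pair_sc_def sum_pair)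
  have ex: "\<exists>y. (u, y) \<in> Z" if "u \<in> W1" for u
    using subsetD[OF gen that] unfolding Z R1.level_family[OF z] by blast
  have un0: "y = 0" if "(0, y) \<in> Z" for y
  proof -
    obtain c where c: "0 = (\<Sum>p\<in>?I. sc1 (c p) (R1.pbw z (fst p) (snd p)))"
      "y = (\<Sum>p\<in>?I. sc2 (c p) (R2.pbw w (fst p) (snd p)))" using \<open>(0, y) \<in> Z\<close> unfolding Z by blast
    have "c p = 0" if "p \<in> ?I" for p using ind[OF c(1)[symmetric] that] .
    then show ?thesis unfolding c(2) by (auto intro!: sum.neutral)
  qed
  have un: "y = y'" if "(u, y) \<in> Z" "(u, y') \<in> Z" for u y y'
  proof -
    have "(u, y) - (u, y') \<in> Z" using that unfolding Z_def by (rule P.level_rules)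
    then show ?thesis using un0[of "y - y'"] by simp
  qed
  define f where "f u = (THE y. (u, y) \<in> Z)" for u
  have f: "(u, f u) \<in> Z" if "u \<in> W1" for u
    unfolding f_def by (rule theI') (use ex[OF that] un in blast)
  have fI: "f u = y" if "(u, y) \<in> Z" "u \<in> W1" for u y using f un that by blast
  show thesis
  proof (rule that[of f])
    fix u v assume uv: "u \<in> W1" "v \<in> W1"
    have "(u, f u) + (v, f v) \<in> Z" using f[OF uv(1)] f[OF uv(2)] unfolding Z_def by (rule P.level_rules)
    then show "f (u + v) = f u + f v" by (intro fI) (simp_all add: uv R1.W_rules)
  next
    fix c u assume u: "u \<in> W1"
    have "?sc c (u, f u) \<in> Z" using f[OF u] unfolding Z_def by (rule P.level_rules)
    then show "f (sc1 c u) = sc2 c (f u)" by (intro fI) (simp_all add: u R1.W_rules pair_sc_def)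
  next
    fix u assume "u \<in> W1"
    then have "(u, f u) \<in> W1 \<times> W2" using f P.level_W[OF zw] unfolding Z_def by blast
    then show "f u \<in> W2" by simp
  next
    fix s u assume su: "s \<in> dd_gens D" "u \<in> W1"
    have "?A s (u, f u) \<in> Z" using P.level_submodule[OF zw su(1)] f[OF su(2)] unfolding Z_def by blast
    then show "f (A1 s u) = A2 s (f u)" by (intro fI) (simp_all add: su R1.closed)
  next
    have "(z, w) \<in> Z" using P.z_level[OF zw] unfolding Z_def .
    then show "f z = w" using R1.z_W[OF z] by (rule fI)
  qed
qed

section \<open>Matrix modules as representations\<close>

definition act :: "('g, 'k::field) dmod \<Rightarrow> ('g, 'k) gen \<Rightarrow> (nat \<Rightarrow> 'k) \<Rightarrow> nat \<Rightarrow> 'k" where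
  "act M s = mop (mact M s)"

lemma eval_nc_closed:
  assumes "set1_ncpoly p \<subseteq> S" "\<And>s. s \<in> S \<Longrightarrow> R s \<in> carrier_mat d d"
  shows "eval_nc d R p \<in> carrier_mat d d"
  using assms(1) by (induction p) (auto simp: assms(2))

lemma mop_eval_nc:
  assumes "set1_ncpoly p \<subseteq> S" "\<And>s. s \<in> S \<Longrightarrow> R s \<in> carrier_mat d d" "v \<in> coords d"
  shows "mop (eval_nc d R p) v = ev scl (\<lambda>s. mop (R s)) p v"
  using assms(1,3)
proof (induction p arbitrary: v)
  case (Scal c)
  then show ?case by (simp add: mop_scalar)
next
  case (Plus p q)
  then show ?case using mop_plus[OF eval_nc_closed eval_nc_closed, of p S R d q S R v] assms(2) by auto
next
  case (Minus p q)
  then show ?case using mop_minus[OF eval_nc_closed eval_nc_closed, of p S R d q S R v] assms(2) by auto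
next
  case (Times p q)
  have cl: "eval_nc d R p \<in> carrier_mat d d" "eval_nc d R q \<in> carrier_mat d d"
    using Times.prems assms(2) by (auto intro!: eval_nc_closed[where S = S])
  have "mop (eval_nc d R q) v \<in> coords d" by (rule mop_closed[OF cl(2)])
  then show ?case using Times by (simp add: mop_mult[OF cl])
qed simp

lemma set1_ncpoly_power: "set1_ncpoly (Gen s ^ i :: ('s, 'k::zero_neq_one) ncpoly) \<subseteq> {s}"
  by (induction i) (auto simp: one_ncpoly_def times_ncpoly_def)

context dd
begin

lemma grp_gens: "g \<in> carrier G \<Longrightarrow> Grp g \<in> dd_gens D"
  and chr_gens: "\<gamma> \<in> carrier \<Gamma> \<Longrightarrow> Chr \<gamma> \<in> dd_gens D"
  and x_gens: "GenX \<in> dd_gens D" and xi_gens: "GenXi \<in> dd_gens D"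
  by (auto simp: dd_gens_def)

text \<open>The letters outside \<open>dd_gens D\<close> act by arbitrary matrices, so they must not occur in the relations.\<close>

lemma relations_letters:
  assumes "(p, q) \<in> dd_relations D"
  shows "set1_ncpoly p \<subseteq> dd_gens D" "set1_ncpoly q \<subseteq> dd_gens D"
proof -
  have pow: "set1_ncpoly (Gen s ^ i :: (('g, 'k) gen, 'k) ncpoly) \<subseteq> dd_gens D"
    if "s \<in> dd_gens D" for s and i :: nat
    using that set1_ncpoly_power[of s i] by blast
  note [simp] = grp_gens chr_gens x_gens xi_gens a_G chi_Gam pow
  have "set1_ncpoly p \<subseteq> dd_gens D \<and> set1_ncpoly q \<subseteq> dd_gens D"
    using assms unfolding dd_relations_def Let_def
    by (auto simp: plus_ncpoly_def minus_ncpoly_def times_ncpoly_def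
        one_ncpoly_def zero_ncpoly_def split: if_splits dest!: subsetD[OF pow, rotated])
  then show "set1_ncpoly p \<subseteq> dd_gens D" "set1_ncpoly q \<subseteq> dd_gens D" by auto
qed

text \<open>This translates between matrix identities and identities of operators on coordinate vectors.\<close>

lemma is_dmod_iff:
  "is_dmod D M \<longleftrightarrow> (\<forall>s\<in>dd_gens D. mact M s \<in> carrier_mat (mdim M) (mdim M)) \<and>
     (\<forall>v\<in>coords (mdim M). rel_vec scl (act M) v)"
proof -
  have "(\<forall>(p, q)\<in>dd_relations D. meval M p = meval M q) \<longleftrightarrow>
      (\<forall>v\<in>coords (mdim M). \<forall>(p, q)\<in>dd_relations D. ev scl (act M) p v = ev scl (act M) q v)"
    if car: "\<And>s. s \<in> dd_gens D \<Longrightarrow> mact M s \<in> carrier_mat (mdim M) (mdim M)"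
  proof -
    have "meval M p = meval M q \<longleftrightarrow> (\<forall>v\<in>coords (mdim M). ev scl (act M) p v = ev scl (act M) q v)"
      if pq: "(p, q) \<in> dd_relations D" for p q
    proof -
      have cl: "meval M p \<in> carrier_mat (mdim M) (mdim M)" "meval M q \<in> carrier_mat (mdim M) (mdim M)"
        using relations_letters[OF pq] car by (auto intro!: eval_nc_closed[where S = "dd_gens D"])
      have "meval M p = meval M q \<longleftrightarrow> (\<forall>v\<in>coords (mdim M). mop (meval M p) v = mop (meval M q) v)"
        using mat_eq_of_mop[OF cl] by auto
      then show ?thesis
        using mop_eval_nc[OF relations_letters(1)[OF pq] car]
          mop_eval_nc[OF relations_letters(2)[OF pq] car] by (simp add: act_def[abs_def])
    qed
    then show ?thesis by blast
  qed
  moreover have "(\<forall>(p, q)\<in>dd_relations D. ev scl (act M) p v = ev scl (act M) q v) \<longleftrightarrow> rel_vec scl (act M) v" for v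
    by (rule rel_iff) (auto simp: act_def module_hom_mop intro: fs.vector_space_axioms)
  ultimately show ?thesis unfolding is_dmod_def by auto
qed

lemma act_closed: "is_dmod D M \<Longrightarrow> s \<in> dd_gens D \<Longrightarrow> act M s v \<in> coords (mdim M)"
  unfolding is_dmod_def act_def using mop_closed by blast

lemma dd_rep_act: "is_dmod D M \<Longrightarrow> dd_rep D scl (coords (mdim M)) (act M)"
  using act_closed[of M]
  by unfold_locales (auto simp: is_dmod_iff subspace_coords act_def
      module_hom.add[OF module_hom_mop] module_hom.scale[OF module_hom_mop] simp del: scl_apply)

section \<open>The modules with labels in \<open>I\<^sub>n\<close>\<close>

text \<open>Both sides are monic of degree \<open>n\<close> in \<open>\<theta>\<close> and vanish at the \<open>n\<close> distinct values \<open>\<kappa> \<rho>\<^bsup>-k\<^esup>\<close>.\<close>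

lemma prod_root_differences:
  assumes "\<kappa> \<noteq> 0"
  shows "(\<Prod>k<n. (\<theta> - \<kappa> * inverse \<rho> ^ k)) = \<theta> ^ n - \<kappa> ^ n"
proof -
  let ?p = "\<Prod>k<n. [:- (\<kappa> * inverse \<rho> ^ k), 1:]" and ?q = "monom 1 n - [:\<kappa> ^ n:]"
  let ?A = "(\<lambda>k. \<kappa> * inverse \<rho> ^ k) ` {..<n}"
  have inj: "inj_on (\<lambda>k. \<kappa> * inverse \<rho> ^ k) {..<n}"
    using assms rho_inj by (auto simp: inj_on_def power_inverse)
  have rn: "(inverse \<rho> ^ k) ^ n = 1" for k
    by (metis power_commutes power_inverse power_mult power_one rho_n inverse_1 mult.commute)
  have "?p = ?q"
  proof (rule poly_eqI_degree_lead_coeff[of ?p n])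
    show "poly ?p x = poly ?q x" if "x \<in> ?A" for x
      using that rn by (auto simp: poly_prod poly_monom power_mult_distrib)
    show "n \<le> card ?A" by (simp add: card_image[OF inj])
    show "degree ?p \<le> n" by (rule order.trans[OF degree_prod_sum_le]) auto
    show "degree ?q \<le> n" by (rule degree_diff_le) (auto simp: degree_monom_le)
    have "coeff ?p n = 1"
      using lead_coeff_prod[of "\<lambda>k. [:- (\<kappa> * inverse \<rho> ^ k), 1:]" "{..<n}"]
        degree_prod_eq_sum_degree[of "{..<n}" "\<lambda>k. [:- (\<kappa> * inverse \<rho> ^ k), 1:]"]
      by simp
    moreover have "coeff ?q n = 1" using n2 by (cases n) auto
    ultimately show "coeff ?p n = coeff ?q n" by simp
  qed
  then have "poly ?p \<theta> = poly ?q \<theta>" by simp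
  then show ?thesis by (simp add: poly_prod poly_monom)
qed

lemma mdim_simple [simp]: "mdim (simple_mod D l \<mu>) = l"
  by (simp add: simple_mod_def)

lemma simple_carrier: "mact (simple_mod D l \<mu>) s \<in> carrier_mat l l"
  by (cases s) (auto simp: simple_mod_def)

lemma simple_gg: "g \<in> carrier G \<Longrightarrow> act (simple_mod D l \<mu>) (Grp g) v =
    (\<lambda>i. if i < l then inverse (\<chi> g) ^ i * \<mu> (g, \<one>\<^bsub>\<Gamma>\<^esub>) * v i else 0)"
  by (auto simp: act_def mop_def simple_mod_def fun_eq_iff phi_shift_apply Gam_one_apply a_G
      if_distrib[of "\<lambda>x. x * _"] cong: if_cong)

lemma simple_cc: "\<gamma> \<in> carrier \<Gamma> \<Longrightarrow> act (simple_mod D l \<mu>) (Chr \<gamma>) v =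
    (\<lambda>i. if i < l then \<gamma> a ^ i * \<mu> (\<one>\<^bsub>G\<^esub>, \<gamma>) * v i else 0)"
  by (auto simp: act_def mop_def simple_mod_def fun_eq_iff phi_shift_apply char_one[OF chi_Gam]
      if_distrib[of "\<lambda>x. x * _"] cong: if_cong)

text \<open>The scalar by which \<open>x\<close> maps the last basis vector to the first.\<close>

definition wrap :: "nat \<Rightarrow> ('g \<times> ('g \<Rightarrow> 'k) \<Rightarrow> 'k) \<Rightarrow> 'k" where
  "wrap l \<mu> = (if l = n \<and> \<not> nilpotent_type D then \<mu> (a, \<one>\<^bsub>\<Gamma>\<^esub>) ^ n - 1 else 0)"

lemma simple_X: "act (simple_mod D l \<mu>) GenX v =
    (\<lambda>i. if i < l then (if i = 0 then wrap l \<mu> * v (l - 1) else v (i - 1)) else 0)"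
proof
  fix i
  show "act (simple_mod D l \<mu>) GenX v i =
    (if i < l then (if i = 0 then wrap l \<mu> * v (l - 1) else v (i - 1)) else 0)"
  proof (cases "i < l")
    case True
    have "act (simple_mod D l \<mu>) GenX v i =
        (\<Sum>j<l. (if i = j + 1 then 1 else if l = n \<and> \<not> nilpotent_type D \<and> j = l - 1 \<and> i = 0
            then \<mu> (a, \<one>\<^bsub>\<Gamma>\<^esub>) ^ n - 1 else 0) * v j)"
      using True by (simp add: act_def mop_def simple_mod_def)
    also have "\<dots> = (\<Sum>j<l. if j = (if i = 0 then l - 1 else i - 1) then
        (if i = 0 then wrap l \<mu> * v (l - 1) else v (i - 1)) else 0)"
      by (rule sum.cong) (auto simp: wrap_def)
    also have "\<dots> = (if i = 0 then wrap l \<mu> * v (l - 1) else v (i - 1))"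
      using True by (subst sum.delta) auto
    finally show ?thesis using True by simp
  qed (simp add: act_def mop_def simple_mod_def)
qed

lemma simple_Xi: "act (simple_mod D l \<mu>) GenXi v =
    (\<lambda>i. if i + 1 < l then alpha_coeff D \<mu> (i + 1) * v (i + 1) else 0)"
proof
  fix i
  show "act (simple_mod D l \<mu>) GenXi v i = (if i + 1 < l then alpha_coeff D \<mu> (i + 1) * v (i + 1) else 0)"
  proof (cases "i < l")
    case True
    have "act (simple_mod D l \<mu>) GenXi v i = (\<Sum>j<l. (if j = i + 1 then alpha_coeff D \<mu> j else 0) * v j)"
      using True by (simp add: act_def mop_def simple_mod_def)
    also have "\<dots> = (\<Sum>j<l. if j = i + 1 then alpha_coeff D \<mu> (i + 1) * v (i + 1) else 0)"
      by (rule sum.cong) auto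
    also have "\<dots> = (if i + 1 < l then alpha_coeff D \<mu> (i + 1) * v (i + 1) else 0)"
      by (subst sum.delta) auto
    finally show ?thesis .
  qed (simp add: act_def mop_def simple_mod_def)
qed

lemma simple_X_pow:
  assumes "v \<in> coords n" "m \<le> n"
  shows "(act (simple_mod D n \<mu>) GenX ^^ m) v =
    (\<lambda>i. if i < n then (if m \<le> i then v (i - m) else wrap n \<mu> * v (i + n - m)) else 0)"
  using assms(2)
proof (induction m)
  case 0
  then show ?case using assms(1) by (auto simp: coords_def fun_eq_iff)
next
  case (Suc m)
  have "i + n - Suc m = i - 1 + n - m" if "i > 0" for i using that by simp
  moreover have "n - Suc 0 - m = n - Suc m" by simp
  ultimately show ?case
    using Suc by (auto simp: simple_X fun_eq_iff le_diff_conv Suc_le_eq)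
qed

lemma simple_Xi_pow:
  assumes "v \<in> coords l"
  shows "(act (simple_mod D l \<mu>) GenXi ^^ m) v =
    (\<lambda>i. if i + m < l then (\<Prod>k<m. alpha_coeff D \<mu> (i + k + 1)) * v (i + m) else 0)"
proof (induction m)
  case 0
  then show ?case using assms by (auto simp: coords_def fun_eq_iff)
next
  case (Suc m)
  then show ?case
    by (auto simp: simple_Xi fun_eq_iff prod.lessThan_Suc_shift simp del: prod.lessThan_Suc)
qed

lemma prod_acoef: "(\<Prod>k<m. acoef \<kappa> \<theta> (k + 1)) = qfact \<rho> m * (\<Prod>k<m. (\<theta> - \<kappa> * inverse \<rho> ^ k))"
proof (induction m)
  case (Suc m)
  have "\<rho> powi (1 - int (Suc m)) = inverse \<rho> ^ m"
    using rho_nz by (simp add: power_int_minus power_inverse)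
  then show ?case using Suc by (simp add: qfact_Suc acoef_def mult_ac)
qed simp

text \<open>The wrap-around scalar is what the relation between \<open>x\<close> and \<open>\<gamma>\<close> forces in the
  non-nilpotent case.\<close>

lemma wrap_eq:
  assumes "\<mu> \<in> carrier \<Lambda>" "\<not> nilpotent_type D"
  shows "(\<rho> * \<mu> (a, \<one>\<^bsub>\<Gamma>\<^esub>) - \<mu> (\<one>\<^bsub>G\<^esub>, \<chi>)) * (\<Prod>k<n - 1. alpha_coeff D \<mu> (k + 1))
     = qfact \<rho> (n - 1) * wrap n \<mu>"
proof -
  define \<kappa> \<theta> where "\<kappa> = \<mu> (a, \<one>\<^bsub>\<Gamma>\<^esub>)" and "\<theta> = \<mu> (\<one>\<^bsub>G\<^esub>, \<chi>)"
  have \<kappa>: "\<kappa> \<noteq> 0" unfolding \<kappa>_def by (rule Lam_nz[OF assms(1) a_G]) simp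
  obtain m where m: "n = Suc m" using n2 by (cases n) auto
  have "\<mu> (\<one>\<^bsub>G\<^esub>, \<chi> [^]\<^bsub>\<Gamma>\<^esub> j) = \<theta> ^ j" for j :: nat
  proof (induction j)
    case (Suc j)
    have "\<chi> [^]\<^bsub>\<Gamma>\<^esub> j \<in> carrier \<Gamma>" using chi_Gam by simp
    then show ?case using Suc Lam_hom_Gam[OF assms(1) _ chi_Gam] by (simp add: \<theta>_def mult.commute)
  qed (simp add: Lam_one assms)
  then have \<theta>: "\<theta> ^ n = 1" using chi_n[OF assms(2)] Lam_one[OF assms(1)] by metis
  have "inverse \<rho> ^ m = \<rho>"
    using rho_n rho_nz unfolding m by (simp add: power_inverse field_simps)
  then have "(\<rho> * \<kappa> - \<theta>) * (\<Prod>k<m. (\<theta> - \<kappa> * inverse \<rho> ^ k)) = - (\<Prod>k<n. (\<theta> - \<kappa> * inverse \<rho> ^ k))"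
    unfolding m by (simp add: algebra_simps)
  also have "\<dots> = \<kappa> ^ n - 1" using prod_root_differences[OF \<kappa>] \<theta> by simp
  finally show ?thesis
    unfolding alpha_coeff_eq prod_acoef using m assms(2)
    by (simp add: \<kappa>_def \<theta>_def wrap_def mult.left_commute)
qed

lemma simple_n_dmod:
  assumes \<mu>: "\<mu> \<in> carrier \<Lambda>"
  shows "is_dmod D (simple_mod D n \<mu>)"
  unfolding is_dmod_iff
proof (intro conjI ballI)
  fix v :: "nat \<Rightarrow> 'k"
  assume "v \<in> coords (mdim (simple_mod D n \<mu>))"
  then have v: "v \<in> coords n" by simp
  let ?A = "act (simple_mod D n \<mu>)"
  have pow_G: "\<mu> (a [^]\<^bsub>G\<^esub> j, \<one>\<^bsub>\<Gamma>\<^esub>) = \<mu> (a, \<one>\<^bsub>\<Gamma>\<^esub>) ^ j" for j :: nat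
    using a_G by (induction j) (simp_all add: Lam_one \<mu> Lam_hom_G mult.commute)
  have chi_pow: "\<chi> (a [^]\<^bsub>G\<^esub> j) = \<rho> ^ j" for j :: nat
    using a_G chi_Gam by (induction j) (simp_all add: char_one char_mult chi_a mult.commute)
  have aG: "a [^]\<^bsub>G\<^esub> n \<in> carrier G" using a_G by simp
  obtain m where m: "n = Suc m" using n2 by (cases n) auto
  have Xn: "(?A GenX ^^ n) v = scl (alp D) (?A (Grp (a [^]\<^bsub>G\<^esub> n)) v - v)"
  proof
    fix i
    have "wrap n \<mu> * v i = alp D * (\<mu> (a, \<one>\<^bsub>\<Gamma>\<^esub>) ^ n * v i - v i)"
    proof (cases "nilpotent_type D")
      case True
      have "\<mu> (a, \<one>\<^bsub>\<Gamma>\<^esub>) ^ n = 1" if "a [^]\<^bsub>G\<^esub> n = \<one>\<^bsub>G\<^esub>"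
        using that pow_G[of n] Lam_one[OF \<mu>] by simp
      then show ?thesis using True by (auto simp: wrap_def nilpotent_type_def)
    qed (simp add: wrap_def alp_1 algebra_simps)
    then show "(?A GenX ^^ n) v i = scl (alp D) (?A (Grp (a [^]\<^bsub>G\<^esub> n)) v - v) i"
      using v by (auto simp: simple_X_pow simple_gg[OF aG] pow_G chi_pow rho_n coords_def)
  qed
  have comm: "?A GenX (?A GenXi v) - ?A GenXi (?A GenX v) = ?A (Grp a) v - ?A (Chr \<chi>) v"
  proof (rule coords_eqI[of _ n])
    fix i assume i: "i < n"
    let ?\<alpha> = "alpha_coeff D \<mu>"
    have an: "?\<alpha> n = 0" by (simp add: alpha_coeff_eq acoef_def qnum_n)
    have "?A GenX (?A GenXi v) i = ?\<alpha> i * v i"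
      using i by (cases i) (auto simp: simple_X simple_Xi alpha_coeff_eq)
    moreover have "?A GenXi (?A GenX v) i = ?\<alpha> (Suc i) * v i"
      using i an by (cases "Suc i = n") (auto simp: simple_X simple_Xi)
    moreover have "?A (Grp a) v i - ?A (Chr \<chi>) v i = (?\<alpha> i - ?\<alpha> (Suc i)) * v i"
      using i by (simp add: simple_gg[OF a_G] simple_cc[OF chi_Gam] chi_a alpha_coeff_eq acoef_Suc algebra_simps)
    ultimately show "(?A GenX (?A GenXi v) - ?A GenXi (?A GenX v)) i = (?A (Grp a) v - ?A (Chr \<chi>) v) i"
      by (simp add: algebra_simps)
  qed (auto simp: coords_def simple_X simple_Xi simple_gg[OF a_G] simple_cc[OF chi_Gam])
  have xc: "scl (\<gamma> a) (?A GenX (?A (Chr \<gamma>) v)) = ?A (Chr \<gamma>) (?A GenX v) +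
        scl (corr \<gamma> / qfact \<rho> (n - 1)) (?A (Chr \<gamma>)
          (scl \<rho> (?A (Grp a) ((?A GenXi ^^ (n - 1)) v)) - ?A (Chr \<chi>) ((?A GenXi ^^ (n - 1)) v)))"
    if \<gamma>: "\<gamma> \<in> carrier \<Gamma>" for \<gamma>
  proof (rule coords_eqI[of _ n])
    fix i assume i: "i < n"
    show "(scl (\<gamma> a) (?A GenX (?A (Chr \<gamma>) v))) i = (?A (Chr \<gamma>) (?A GenX v) +
        scl (corr \<gamma> / qfact \<rho> (n - 1)) (?A (Chr \<gamma>)
          (scl \<rho> (?A (Grp a) ((?A GenXi ^^ (n - 1)) v)) - ?A (Chr \<chi>) ((?A GenXi ^^ (n - 1)) v)))) i"
    proof (cases i)
      case 0
      let ?P = "\<Prod>k<n - 1. alpha_coeff D \<mu> (k + 1)"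
      have q: "qfact \<rho> (n - 1) \<noteq> 0" using n2 by (intro qfact_nz) simp
      have E: "corr \<gamma> / qfact \<rho> (n - 1) * ((\<rho> * \<mu> (a, \<one>\<^bsub>\<Gamma>\<^esub>) - \<mu> (\<one>\<^bsub>G\<^esub>, \<chi>)) * ?P) = (\<gamma> a ^ n - 1) * wrap n \<mu>"
      proof (cases "nilpotent_type D")
        case False
        then show ?thesis using wrap_eq[OF \<mu> False] q by (simp add: corr_def)
      qed (simp add: corr_def wrap_def)
      have "\<gamma> a * wrap n \<mu> * \<gamma> a ^ m * v m = wrap n \<mu> * v m +
          corr \<gamma> / qfact \<rho> (n - 1) * ((\<rho> * \<mu> (a, \<one>\<^bsub>\<Gamma>\<^esub>) - \<mu> (\<one>\<^bsub>G\<^esub>, \<chi>)) * ?P) * v m"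
        unfolding E unfolding m by (simp add: algebra_simps)
      then have "\<mu> (\<one>\<^bsub>G\<^esub>, \<gamma>) * (\<gamma> a * wrap n \<mu> * \<gamma> a ^ m * v m) = \<mu> (\<one>\<^bsub>G\<^esub>, \<gamma>) * (wrap n \<mu> * v m +
          corr \<gamma> / qfact \<rho> (n - 1) * ((\<rho> * \<mu> (a, \<one>\<^bsub>\<Gamma>\<^esub>) - \<mu> (\<one>\<^bsub>G\<^esub>, \<chi>)) * ?P) * v m)" by simp
      moreover have "m = n - 1" using m by simp
      ultimately show ?thesis using 0 i n2
        by (simp add: simple_X simple_Xi_pow[OF v] simple_gg[OF a_G] simple_cc[OF chi_Gam] simple_cc[OF \<gamma>] algebra_simps)
    next
      case (Suc i')
      then show ?thesis using i
        by (simp add: simple_X simple_Xi_pow[OF v] simple_gg[OF a_G] simple_cc[OF chi_Gam] simple_cc[OF \<gamma>])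
    qed
  qed (auto simp: coords_def simple_X simple_gg[OF a_G] simple_cc[OF chi_Gam] simple_cc[OF \<gamma>])
  show "rel_vec scl ?A v"
    unfolding rel_vec_def
  proof (intro conjI ballI)
    show "?A (Grp \<one>\<^bsub>G\<^esub>) v = v" "?A (Chr \<one>\<^bsub>\<Gamma>\<^esub>) v = v"
      using v by (auto simp: simple_gg simple_cc char_one[OF chi_Gam] Gam_one_apply a_G Lam_one[OF \<mu>] coords_def fun_eq_iff)
  next
    fix g h assume gh: "g \<in> carrier G" "h \<in> carrier G"
    show "?A (Grp g) (?A (Grp h) v) = ?A (Grp (g \<otimes>\<^bsub>G\<^esub> h)) v"
      using gh by (auto simp: simple_gg Lam_hom_G[OF \<mu>] char_mult[OF chi_Gam] power_mult_distrib fun_eq_iff)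
  next
    fix g h assume gh: "g \<in> carrier \<Gamma>" "h \<in> carrier \<Gamma>"
    show "?A (Chr g) (?A (Chr h) v) = ?A (Chr (g \<otimes>\<^bsub>\<Gamma>\<^esub> h)) v"
      using gh by (auto simp: simple_cc Lam_hom_Gam[OF \<mu>] Gam_mult_apply a_G power_mult_distrib fun_eq_iff)
  next
    show "(?A GenXi ^^ n) v = 0" using v by (auto simp: simple_Xi_pow fun_eq_iff)
  next
    fix g assume g: "g \<in> carrier G"
    show "?A GenX (?A (Grp g) v) = scl (\<chi> g) (?A (Grp g) (?A GenX v))"
    proof
      fix i
      have "\<chi> g ^ n = 1" if "\<not> nilpotent_type D" using chi_n_apply[OF that g] .
      then have "wrap n \<mu> * inverse (\<chi> g) ^ m = wrap n \<mu> * \<chi> g"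
        using chi_nz[OF g] m by (auto simp: wrap_def field_simps)
      then have "wrap n \<mu> * (inverse (\<chi> g) ^ m * (\<mu> (g, \<one>\<^bsub>\<Gamma>\<^esub>) * v m)) = wrap n \<mu> * (\<chi> g * (\<mu> (g, \<one>\<^bsub>\<Gamma>\<^esub>) * v m))"
        by (simp flip: mult.assoc)
      then show "?A GenX (?A (Grp g) v) i = scl (\<chi> g) (?A (Grp g) (?A GenX v)) i"
        using chi_nz[OF g] m by (cases i) (auto simp: simple_X simple_gg[OF g] mult_ac)
    qed
  next
    fix \<gamma> assume \<gamma>: "\<gamma> \<in> carrier \<Gamma>"
    show "?A GenXi (?A (Chr \<gamma>) v) = scl (\<gamma> a) (?A (Chr \<gamma>) (?A GenXi v))"
      by (auto simp: simple_Xi simple_cc[OF \<gamma>] fun_eq_iff)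
  next
    fix g \<gamma> assume g: "g \<in> carrier G" "\<gamma> \<in> carrier \<Gamma>"
    then show "?A (Grp g) (?A (Chr \<gamma>) v) = ?A (Chr \<gamma>) (?A (Grp g) v)"
      by (auto simp: simple_gg simple_cc fun_eq_iff)
  next
    fix g assume g: "g \<in> carrier G"
    then show "?A GenXi (?A (Grp g) v) = scl (inverse (\<chi> g)) (?A (Grp g) (?A GenXi v))"
      by (auto simp: simple_Xi simple_gg fun_eq_iff)
  qed (use Xn comm xc in auto)
qed (simp add: simple_carrier)

end

section \<open>Tensor products of coordinate spaces\<close>

lemmas pointwise = plus_fun_apply zero_fun_apply scl_apply minus_apply sum_fun_apply

declare plus_fun_apply [simp del] zero_fun_apply [simp del] scl_apply [simp del]
  minus_apply [simp del] uminus_apply [simp del]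

text \<open>The coordinates of the pure tensor \<open>u \<otimes> w\<close>, in the order used by \<open>kronecker\<close>.\<close>

definition tens :: "nat \<Rightarrow> nat \<Rightarrow> (nat \<Rightarrow> 'k) \<Rightarrow> (nat \<Rightarrow> 'k) \<Rightarrow> nat \<Rightarrow> 'k::field" where
  "tens d e u w = (\<lambda>i. if i < d * e then u (i div e) * w (i mod e) else 0)"

lemma tens_coords: "tens d e u w \<in> coords (d * e)"
  by (simp add: tens_def coords_def)

lemma tens_add_left: "tens d e (u + u') w = tens d e u w + tens d e u' w"
  and tens_add_right: "tens d e u (w + w') = tens d e u w + tens d e u w'"
  and tens_diff_left: "tens d e (u - u') w = tens d e u w - tens d e u' w"
  and tens_diff_right: "tens d e u (w - w') = tens d e u w - tens d e u w'"
  and tens_scale_left: "tens d e (scl c u) w = scl c (tens d e u w)"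
  and tens_scale_right: "tens d e u (scl c w) = scl c (tens d e u w)"
  and tens_zero_left: "tens d e 0 w = 0"
  and tens_zero_right: "tens d e u 0 = 0"
  by (auto simp: pointwise tens_def fun_eq_iff algebra_simps)

lemma sum_tens_index:
  fixes h :: "nat \<Rightarrow> nat \<Rightarrow> 'a::comm_monoid_add"
  shows "(\<Sum>j<d * e. h (j div e) (j mod e)) = (\<Sum>k<d. \<Sum>l<e. h k l)"
proof -
  have "(\<Sum>j<d * e. h (j div e) (j mod e)) = (\<Sum>(k, l)\<in>{..<d} \<times> {..<e}. h k l)"
  proof (rule sum.reindex_bij_witness[of _ "\<lambda>(k, l). k * e + l" "\<lambda>j. (j div e, j mod e)"])
    fix b assume "b \<in> {..<d} \<times> {..<e}"
    then obtain k l where b: "b = (k, l)" "k < d" "l < e" by auto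
    have "k * e + l < (k + 1) * e" using b by simp
    also have "\<dots> \<le> d * e" using b by (intro mult_le_mono1) simp
    finally show "(case b of (k, l) \<Rightarrow> k * e + l) \<in> {..<d * e}" using b by simp
    show "((case b of (k, l) \<Rightarrow> k * e + l) div e, (case b of (k, l) \<Rightarrow> k * e + l) mod e) = b"
      using b by simp
  next
    fix j assume "j \<in> {..<d * e}"
    then show "(j div e, j mod e) \<in> {..<d} \<times> {..<e}"
      by (cases "e = 0") (auto simp: less_mult_imp_div_less)
  qed auto
  then show ?thesis by (simp add: sum.cartesian_product)
qed

lemma kronecker_carrier: "A \<in> carrier_mat d d \<Longrightarrow> B \<in> carrier_mat e e \<Longrightarrow>
    kronecker A B \<in> carrier_mat (d * e) (d * e)"
  by (auto simp: kronecker_def)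

lemma mop_kronecker:
  assumes A: "A \<in> carrier_mat d d" and B: "B \<in> carrier_mat e e"
  shows "mop (kronecker A B) (tens d e u w) = tens d e (mop A u) (mop B w)"
proof
  fix i
  show "mop (kronecker A B) (tens d e u w) i = tens d e (mop A u) (mop B w) i"
  proof (cases "i < d * e")
    case True
    then have e: "i div e < d" "i mod e < e"
      by (auto simp: less_mult_imp_div_less) (metis gr_zeroI mod_less_divisor mult_0_right not_less_zero)
    have "mop (kronecker A B) (tens d e u w) i =
        (\<Sum>j<d * e. A $$ (i div e, j div e) * u (j div e) * (B $$ (i mod e, j mod e) * w (j mod e)))"
      using True A B by (simp add: mop_def kronecker_def tens_def mult_ac)
    also have "\<dots> = (\<Sum>k<d. \<Sum>l<e. A $$ (i div e, k) * u k * (B $$ (i mod e, l) * w l))"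
      by (rule sum_tens_index)
    also have "\<dots> = mop A u (i div e) * mop B w (i mod e)"
      using e A B by (simp add: mop_def sum_product)
    finally show ?thesis using True by (simp add: tens_def)
  qed (use A B in \<open>auto simp: mop_def kronecker_def tens_def\<close>)
qed

lemma unit_tens: "k < d * e \<Longrightarrow> unit_seq k = tens d e (unit_seq (k div e)) (unit_seq (k mod e))"
proof
  fix i assume k: "k < d * e"
  have "i = k" if "i div e = k div e" "i mod e = k mod e" using that by (metis div_mult_mod_eq)
  then show "unit_seq k i = tens d e (unit_seq (k div e)) (unit_seq (k mod e)) i"
    using k by (auto simp: unit_seq_def tens_def)
qed

lemma coords_tens_span:
  "coords (d * e) \<subseteq> fs.span {tens d e u w | u w. u \<in> coords d \<and> w \<in> coords e}"
proof
  fix v :: "nat \<Rightarrow> 'a" assume v: "v \<in> coords (d * e)"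
  have "unit_seq k \<in> {tens d e u w | u w. u \<in> coords d \<and> w \<in> coords e}" if "k < d * e" for k
  proof -
    have "k div e < d" "k mod e < e" using that
      by (auto simp: less_mult_imp_div_less) (metis gr_zeroI mod_less_divisor mult_0_right not_less_zero)
    then show ?thesis using unit_tens[OF that]
      by (intro CollectI exI[of _ "unit_seq (k div e)"] exI[of _ "unit_seq (k mod e)"]) simp
  qed
  then have "(\<Sum>k<d * e. scl (v k) (unit_seq k)) \<in> fs.span {tens d e u w | u w. u \<in> coords d \<and> w \<in> coords e}"
    by (intro fs.span_sum fs.span_scale fs.span_base) (use lessThan_iff in blast)
  then show "v \<in> fs.span {tens d e u w | u w. u \<in> coords d \<and> w \<in> coords e}"
    using coords_expand[OF v] by simp
qed

text \<open>Linear maps on the tensor product agree if they agree on pure tensors; all identities of operators on \<open>T\<close> are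
proved in this way.\<close>

lemma tens_ext:
  assumes f: "module_hom scl scl f" and g: "module_hom scl scl g"
    and eq: "\<And>u w. u \<in> coords d \<Longrightarrow> w \<in> coords e \<Longrightarrow> f (tens d e u w) = g (tens d e u w)"
    and v: "v \<in> coords (d * e)"
  shows "f v = g v"
proof -
  have "fs.subspace {v. f v = g v}"
    using f g by (intro fs.subspaceI)
      (simp_all add: module_hom.zero module_hom.add module_hom.scale)
  then have "fs.span {tens d e u w | u w. u \<in> coords d \<and> w \<in> coords e} \<subseteq> {v. f v = g v}"
    by (intro fs.span_minimal) (use eq in auto)
  then show ?thesis using coords_tens_span v by blast
qed

lemma mh_id: "module_hom scl scl (\<lambda>v. v)"
  and mh_add: "module_hom scl scl f \<Longrightarrow> module_hom scl scl g \<Longrightarrow> module_hom scl scl (\<lambda>v. f v + g v)"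
  and mh_diff: "module_hom scl scl f \<Longrightarrow> module_hom scl scl g \<Longrightarrow> module_hom scl scl (\<lambda>v. f v - g v)"
  and mh_scale: "module_hom scl scl f \<Longrightarrow> module_hom scl scl (\<lambda>v. scl c (f v))"
  and mh_zero: "module_hom scl scl (\<lambda>v. 0)"
  by (unfold_locales; simp add: module_hom.add module_hom.scale fs.scale_right_distrib
      fs.scale_right_diff_distrib mult.commute fs.scale_left_commute)+

lemma mh_mop: "module_hom scl scl f \<Longrightarrow> module_hom scl scl (\<lambda>v. mop A (f v))"
  using module_hom_compose[OF _ module_hom_mop, of scl f A] by (simp add: comp_def)

lemma mh_act: "module_hom scl scl f \<Longrightarrow> module_hom scl scl (\<lambda>v. act M s (f v))"
  unfolding act_def by (rule mh_mop)

lemma mh_act_pow: "module_hom scl scl f \<Longrightarrow> module_hom scl scl (\<lambda>v. (act M s ^^ i) (f v))"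
  using module_hom_compose[OF _ module_hom_funpow[OF module_hom_mop], of scl f i "mact M s"]
  by (simp add: comp_def act_def)

lemma mh_sum: "(\<And>i. i \<in> I \<Longrightarrow> module_hom scl scl (f i)) \<Longrightarrow> module_hom scl scl (\<lambda>v. \<Sum>i\<in>I. f i v)"
  by (induction I rule: infinite_finite_induct) (auto intro: mh_zero mh_add)

lemmas mh_intros = mh_add mh_diff mh_scale mh_act mh_act_pow mh_sum mh_id mh_zero

section \<open>Binomial expansion with \<open>q\<close>-commuting summands\<close>

text \<open>Gaussian binomial coefficients, by the recursion that does not divide: at \<open>q = \<rho>\<close> the quotient formula
would be \<open>0 / 0\<close> at the ends of row \<open>n\<close>.\<close>

fun qbin :: "'k::field \<Rightarrow> nat \<Rightarrow> nat \<Rightarrow> 'k" where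
  "qbin q m 0 = 1"
| "qbin q 0 (Suc p) = 0"
| "qbin q (Suc m) (Suc p) = qbin q m p + q ^ Suc p * qbin q m (Suc p)"

lemma qbin_gt: "m < p \<Longrightarrow> qbin q m p = 0"
  by (induction q m p rule: qbin.induct) auto

lemma qbin_self: "qbin q m m = 1"
  by (induction m) (auto simp: qbin_gt)

context dd
begin

lemma qnum_add: "qnum \<rho> (i + j) = qnum \<rho> i + \<rho> ^ i * qnum \<rho> j"
  by (induction j) (simp_all add: qnum_Suc algebra_simps power_add)

lemma qbin_qfact: "p \<le> m \<Longrightarrow> qbin \<rho> m p * (qfact \<rho> p * qfact \<rho> (m - p)) = qfact \<rho> m"
proof (induction m arbitrary: p)
  case (Suc m)
  show ?case
  proof (cases p)
    case (Suc p')
    show ?thesis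
    proof (cases "p = Suc m")
      case False
      then have le: "p \<le> m" "p' \<le> m" and d: "m - p' = Suc (m - p)" using Suc Suc.prems by auto
      have 1: "qbin \<rho> m p' * (qfact \<rho> p' * qfact \<rho> (m - p')) = qfact \<rho> m" using Suc.IH[OF le(2)] .
      have 2: "qbin \<rho> m p * (qfact \<rho> p * qfact \<rho> (m - p)) = qfact \<rho> m" using Suc.IH[OF le(1)] .
      have "qbin \<rho> (Suc m) p * (qfact \<rho> p * qfact \<rho> (Suc m - p))
          = qnum \<rho> p * (qbin \<rho> m p' * (qfact \<rho> p' * qfact \<rho> (m - p')))
            + \<rho> ^ p * qnum \<rho> (Suc (m - p)) * (qbin \<rho> m p * (qfact \<rho> p * qfact \<rho> (m - p)))"
        using Suc le d by (simp add: qfact_Suc Suc_diff_le algebra_simps)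
      also have "\<dots> = (qnum \<rho> p + \<rho> ^ p * qnum \<rho> (Suc (m - p))) * qfact \<rho> m"
        unfolding 1 2 by (simp add: algebra_simps)
      also have "qnum \<rho> p + \<rho> ^ p * qnum \<rho> (Suc (m - p)) = qnum \<rho> (Suc m)"
        using qnum_add[of p "Suc (m - p)"] le by simp
      finally show ?thesis by (simp add: qfact_Suc)
    qed (simp add: qbin_gt qbin_self)
  qed simp
qed simp

text \<open>The reason why \<open>(x \<otimes> a + 1 \<otimes> x)\<^sup>n\<close> and \<open>(\<xi> \<otimes> 1 + \<chi> \<otimes> \<xi>)\<^sup>n\<close> have only two terms.\<close>

lemma qbin_n: "0 < p \<Longrightarrow> p < n \<Longrightarrow> qbin \<rho> n p = 0"
  using qbin_qfact[of p n] qfact_nz[of p] qfact_nz[of "n - p"] qfact_n by simp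

lemma qbin_divided: "p \<le> m \<Longrightarrow> m < n \<Longrightarrow> qbin \<rho> m p = qfact \<rho> m * (inverse (qfact \<rho> p) * inverse (qfact \<rho> (m - p)))"
  using qbin_qfact[of p m] qfact_nz[of p] qfact_nz[of "m - p"] by (auto simp: field_simps)

end

text \<open>The families \<open>t\<close> arising here are \<open>t m p = A\<^sup>p B\<^bsup>m-p\<^esup> v\<close> with \<open>F = A + B\<close> and \<open>B A = q A B\<close>.\<close>

lemma q_binomial_expansion:
  fixes F :: "(nat \<Rightarrow> 'k::field) \<Rightarrow> nat \<Rightarrow> 'k"
  assumes F: "module_hom scl scl F"
    and t: "\<And>m p. p \<le> m \<Longrightarrow> F (t m p) = scl (q ^ p) (t (Suc m) p) + t (Suc m) (Suc p)"
  shows "(F ^^ m) (t 0 0) = (\<Sum>p\<le>m. scl (qbin q m p) (t m p))"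
proof (induction m)
  case (Suc m)
  have "(F ^^ Suc m) (t 0 0) = (\<Sum>p\<le>m. scl (qbin q m p) (F (t m p)))"
    by (simp add: Suc module_hom.sum[OF F] module_hom.scale[OF F])
  also have "\<dots> = (\<Sum>p\<le>m. scl (q ^ p * qbin q m p) (t (Suc m) p)) + (\<Sum>p\<le>m. scl (qbin q m p) (t (Suc m) (Suc p)))"
    unfolding sum.distrib[symmetric]
    by (rule sum.cong) (simp_all add: t fs.scale_right_distrib mult.commute)
  also have "(\<Sum>p\<le>m. scl (q ^ p * qbin q m p) (t (Suc m) p)) = (\<Sum>p\<le>Suc m. scl (q ^ p * qbin q m p) (t (Suc m) p))"
    by (simp add: qbin_gt)
  also have "\<dots> = t (Suc m) 0 + (\<Sum>p\<le>m. scl (q ^ Suc p * qbin q m (Suc p)) (t (Suc m) (Suc p)))"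
    by (simp only: sum.atMost_Suc_shift) simp
  also have "\<dots> + (\<Sum>p\<le>m. scl (qbin q m p) (t (Suc m) (Suc p)))
      = t (Suc m) 0 + (\<Sum>p\<le>m. scl (qbin q (Suc m) (Suc p)) (t (Suc m) (Suc p)))"
    by (simp add: add.assoc fs.scale_left_distrib add.commute flip: sum.distrib)
  also have "\<dots> = (\<Sum>p\<le>Suc m. scl (qbin q (Suc m) p) (t (Suc m) p))"
    by (simp only: sum.atMost_Suc_shift) simp
  finally show ?case .
qed simp

section \<open>Commutation rules for powers\<close>

context dd_rep
begin

text \<open>Divided powers of \<open>\<xi>\<close>. Because \<open>qfact \<rho> n = 0\<close> and \<open>inverse 0 = 0\<close>, the \<open>n\<close>-th one is \<open>0\<close>; the
telescoping sum in \<open>T_Xi_Th\<close> relies on this value.\<close>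

definition dp :: "nat \<Rightarrow> 'v \<Rightarrow> 'v" where
  "dp r v = inverse (qfact \<rho> r) \<odot> (Xi ^^ r) v"

lemma dp_W: "v \<in> W \<Longrightarrow> dp r v \<in> W"
  by (simp add: dp_def W_closed W_rules)

lemma dp_lin: "dp r (u + v) = dp r u + dp r v" "dp r (c \<odot> v) = c \<odot> dp r v"
  by (simp_all add: dp_def Ap_add Ap_scale vs.scale_right_distrib mult.commute)

lemma dp_0 [simp]: "dp 0 v = v"
  by (simp add: dp_def)

lemma Lp_W: "v \<in> W \<Longrightarrow> (L ^^ p) v \<in> W"
  and Kp_W: "v \<in> W \<Longrightarrow> (K ^^ p) v \<in> W"
  by (induction p) (auto simp: W_closed)

lemma Xi_big: "v \<in> W \<Longrightarrow> n \<le> m \<Longrightarrow> (Xi ^^ m) v = 0"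
  using Xi_n[OF Xip_W, of v "m - n"] by (simp add: funpow_add[symmetric, THEN fun_cong, unfolded comp_def])

text \<open>Each of the \<open>r + 1\<close> exchanges of \<open>x\<close> with a factor \<open>\<xi>\<close> contributes \<open>a - \<chi>\<close>; collecting them in front produces
the powers of \<open>\<rho>\<close> that sum to \<open>q\<close>-numbers.\<close>

lemma X_Xip: "v \<in> W \<Longrightarrow> X ((Xi ^^ Suc r) v) = (Xi ^^ Suc r) (X v) +
    qnum \<rho> (Suc r) \<odot> (inverse \<rho> ^ r \<odot> K ((Xi ^^ r) v) - L ((Xi ^^ r) v))"
proof (induction r)
  case 0
  then show ?case using X_Xi[of v] by (simp add: qnum_def algebra_simps)
next
  case (Suc r)
  let ?y = "(Xi ^^ Suc r) v"
  have y: "?y \<in> W" "(Xi ^^ r) v \<in> W" using Xip_W[OF Suc.prems] by blast+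
  have k: "Xi (K ((Xi ^^ r) v)) = inverse \<rho> \<odot> K ?y" "Xi (L ((Xi ^^ r) v)) = \<rho> \<odot> L ?y"
    using K_Xi[OF y(2)] L_Xi[OF y(2)] rho_nz by auto
  have "X (Xi ?y) = Xi (X ?y) + K ?y - L ?y" using X_Xi[OF y(1)] by (simp add: algebra_simps)
  also have "Xi (X ?y) = (Xi ^^ Suc (Suc r)) (X v)
      + qnum \<rho> (Suc r) \<odot> (inverse \<rho> ^ Suc r \<odot> K ?y - \<rho> \<odot> L ?y)"
    unfolding Suc.IH[OF Suc.prems] A_lin k by (simp add: A_lin mult.commute)
  also have "\<dots> + K ?y - L ?y = (Xi ^^ Suc (Suc r)) (X v)
      + ((qnum \<rho> (Suc r) * inverse \<rho> ^ Suc r + 1) \<odot> K ?y - (qnum \<rho> (Suc r) * \<rho> + 1) \<odot> L ?y)"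
    by (simp add: algebra_simps)
  also have "qnum \<rho> (Suc r) * \<rho> + 1 = qnum \<rho> (Suc (Suc r))"
    using qnum_add[of 1 "Suc r"] qnum_Suc[of 0] by (simp add: mult.commute)
  also have "qnum \<rho> (Suc r) * inverse \<rho> ^ Suc r + 1 = qnum \<rho> (Suc (Suc r)) * inverse \<rho> ^ Suc r"
    unfolding qnum_Suc[of "Suc r"] using rho_nz by (simp add: field_simps)
  finally show ?case by (simp add: algebra_simps)
qed

lemma X_dp: "v \<in> W \<Longrightarrow> Suc r < n \<Longrightarrow>
    X (dp (Suc r) v) = dp (Suc r) (X v) + (inverse \<rho> ^ r \<odot> K (dp r v) - L (dp r v))"
proof -
  assume v: "v \<in> W" and r: "Suc r < n"
  have q: "inverse (qfact \<rho> (Suc r)) * qnum \<rho> (Suc r) = inverse (qfact \<rho> r)"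
    using qnum_nz[of "Suc r"] r by (simp add: qfact_Suc)
  have "X (dp (Suc r) v) = dp (Suc r) (X v) +
     (inverse (qfact \<rho> (Suc r)) * qnum \<rho> (Suc r)) \<odot> (inverse \<rho> ^ r \<odot> K ((Xi ^^ r) v) - L ((Xi ^^ r) v))"
    unfolding dp_def A_lin X_Xip[OF v] by (simp only: vs.scale_right_distrib vs.scale_scale)
  then show ?thesis unfolding q by (simp add: dp_def A_lin vs.scale_right_diff_distrib mult.commute)
qed

lemma Xi_dp: "v \<in> W \<Longrightarrow> r < n \<Longrightarrow> Xi (dp r v) = qnum \<rho> (Suc r) \<odot> dp (Suc r) v"
proof (cases "Suc r = n")
  case True
  assume "v \<in> W"
  then have "(Xi ^^ Suc r) v = 0" using Xi_n True by simp
  then show ?thesis by (simp add: dp_def A_lin)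
next
  case False
  assume "r < n"
  then show ?thesis using False qnum_nz[of "Suc r"] by (simp add: dp_def A_lin qfact_Suc)
qed

lemma dp_n: "dp n v = 0"
  by (simp add: dp_def qfact_n)

lemma dp_Xi: "v \<in> W \<Longrightarrow> r < n \<Longrightarrow> dp r (Xi v) = qnum \<rho> (Suc r) \<odot> dp (Suc r) v"
  using Xi_dp[of v r] by (simp add: dp_def A_lin funpow_swap1)

lemma Xip_dp: "v \<in> W \<Longrightarrow> n \<le> i + j \<Longrightarrow> (Xi ^^ i) (dp j v) = 0"
  using Xi_big[of v "i + j"] by (simp add: dp_def Ap_scale funpow_add)

lemma dp_dp: "v \<in> W \<Longrightarrow> n \<le> i + j \<Longrightarrow> dp i (dp j v) = 0"
  using Xip_dp[of v i j] by (simp add: dp_def[of i])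

lemma X_Lp: "v \<in> W \<Longrightarrow> X ((L ^^ p) v) = inverse \<rho> ^ p \<odot> (L ^^ p) (X v)"
proof (induction p)
  case (Suc p)
  have "X (L ((L ^^ p) v)) = inverse \<rho> \<odot> L (X ((L ^^ p) v))"
    using L_X[OF Lp_W[OF Suc.prems]] rho_nz by simp
  then show ?case using Suc by (simp add: A_lin)
qed simp

lemma Xi_Lp: "v \<in> W \<Longrightarrow> Xi ((L ^^ p) v) = \<rho> ^ p \<odot> (L ^^ p) (Xi v)"
proof (induction p)
  case (Suc p)
  have "Xi (L ((L ^^ p) v)) = \<rho> \<odot> L (Xi ((L ^^ p) v))"
    using L_Xi[OF Lp_W[OF Suc.prems]] rho_nz by simp
  then show ?case using Suc by (simp add: A_lin)
qed simp

lemma Xip_Lp: "v \<in> W \<Longrightarrow> (Xi ^^ j) ((L ^^ p) v) = \<rho> ^ (j * p) \<odot> (L ^^ p) ((Xi ^^ j) v)"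
  by (induction j) (simp_all add: A_lin Xi_Lp Xip_W power_add mult.commute)

lemma dp_Lp: "v \<in> W \<Longrightarrow> dp j ((L ^^ p) v) = \<rho> ^ (j * p) \<odot> (L ^^ p) (dp j v)"
  by (simp add: dp_def Xip_Lp Ap_scale mult.commute)

lemma X_Kp: "v \<in> W \<Longrightarrow> X ((K ^^ p) v) = \<rho> ^ p \<odot> (K ^^ p) (X v)"
proof (induction p)
  case (Suc p)
  have "X (K ((K ^^ p) v)) = \<rho> \<odot> K (X ((K ^^ p) v))"
    using K_X[OF Kp_W[OF Suc.prems]] rho_nz by simp
  then show ?case using Suc by (simp add: A_lin)
qed simp

lemma Xip_gg: "v \<in> W \<Longrightarrow> g \<in> carrier G \<Longrightarrow> (Xi ^^ j) (gg g v) = inverse (\<chi> g) ^ j \<odot> gg g ((Xi ^^ j) v)"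
  by (induction j) (simp_all add: A_lin Xi_gg Xip_W mult.commute)

lemma dp_gg: "v \<in> W \<Longrightarrow> g \<in> carrier G \<Longrightarrow> dp j (gg g v) = inverse (\<chi> g) ^ j \<odot> gg g (dp j v)"
  by (simp add: dp_def Xip_gg A_lin mult.commute)

lemma Xip_cc: "v \<in> W \<Longrightarrow> \<gamma> \<in> carrier \<Gamma> \<Longrightarrow> (Xi ^^ j) (cc \<gamma> v) = \<gamma> a ^ j \<odot> cc \<gamma> ((Xi ^^ j) v)"
  by (induction j) (simp_all add: A_lin Xi_cc Xip_W mult.commute)

lemma dp_cc: "v \<in> W \<Longrightarrow> \<gamma> \<in> carrier \<Gamma> \<Longrightarrow> dp j (cc \<gamma> v) = \<gamma> a ^ j \<odot> cc \<gamma> (dp j v)"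
  by (simp add: dp_def Xip_cc A_lin mult.commute)

lemma gg_Lp: "v \<in> W \<Longrightarrow> g \<in> carrier G \<Longrightarrow> gg g ((L ^^ p) v) = (L ^^ p) (gg g v)"
  by (induction p) (simp_all add: gg_cc chi_Gam Lp_W)

lemma cc_comm: "v \<in> W \<Longrightarrow> \<gamma> \<in> carrier \<Gamma> \<Longrightarrow> \<delta> \<in> carrier \<Gamma> \<Longrightarrow> cc \<gamma> (cc \<delta> v) = cc \<delta> (cc \<gamma> v)"
  using comm_groupE(4)[OF Gam_comm] by (simp add: cc_mult)

lemma cc_Lp: "v \<in> W \<Longrightarrow> \<gamma> \<in> carrier \<Gamma> \<Longrightarrow> cc \<gamma> ((L ^^ p) v) = (L ^^ p) (cc \<gamma> v)"
  by (induction p) (simp_all add: cc_comm[of _ \<gamma> \<chi>] chi_Gam Lp_W)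

lemma Lp_eq: "v \<in> W \<Longrightarrow> (L ^^ p) v = cc (\<chi> [^]\<^bsub>\<Gamma>\<^esub> p) v"
proof (induction p)
  case (Suc p)
  have "\<chi> [^]\<^bsub>\<Gamma>\<^esub> p \<in> carrier \<Gamma>" using chi_Gam by simp
  then show ?case using Suc chi_Gam by (simp add: cc_mult comm_groupE(4)[OF Gam_comm, of "\<chi> [^]\<^bsub>\<Gamma>\<^esub> p"])
qed (simp add: cc_one)

lemma Kp_eq: "v \<in> W \<Longrightarrow> (K ^^ p) v = gg (a [^]\<^bsub>G\<^esub> p) v"
proof (induction p)
  case (Suc p)
  then show ?case using a_G by (simp add: gg_mult G.m_comm)
qed (simp add: gg_one)

lemma L_n: "\<not> nilpotent_type D \<Longrightarrow> v \<in> W \<Longrightarrow> (L ^^ n) v = v"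
  by (simp add: Lp_eq chi_n cc_one)

end

section \<open>The tensor product is a module\<close>

context dd
begin

lemma comult_letters:
  assumes "s \<in> dd_gens D" "(P, Q) \<in> set (dd_comult D s)"
  shows "set1_ncpoly P \<subseteq> dd_gens D \<and> set1_ncpoly Q \<subseteq> dd_gens D"
proof -
  have pow: "set1_ncpoly (Gen s ^ i :: (('g, 'k) gen, 'k) ncpoly) \<subseteq> dd_gens D"
    if "s \<in> dd_gens D" for s and i :: nat
    using that set1_ncpoly_power[of s i] by blast
  have chip: "\<chi> [^]\<^bsub>\<Gamma>\<^esub> (p::nat) \<in> carrier \<Gamma>" for p using chi_Gam by simp
  show ?thesis
    using assms chr_gens[OF chi_Gam] chr_gens[OF chip] grp_gens[OF a_G] pow[OF xi_gens] x_gens xi_gens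
    by (cases s) (auto simp: Let_def times_ncpoly_def one_ncpoly_def split: if_splits
      dest!: subsetD[OF pow[OF xi_gens]])
qed

end

locale dd_tensor = dd D for D :: "('g, 'k::field_char_0) gdatum" +
  fixes M N :: "('g, 'k) dmod"
  assumes M: "is_dmod D M" and N: "is_dmod D N"
begin

abbreviation "d \<equiv> mdim M"
abbreviation "e \<equiv> mdim N"
abbreviation "tn \<equiv> tens d e :: (nat \<Rightarrow> 'k) \<Rightarrow> (nat \<Rightarrow> 'k) \<Rightarrow> nat \<Rightarrow> 'k"
abbreviation "T \<equiv> mod_tensor D M N"

sublocale RM: dd_rep D scl "coords d" "act M" by (rule dd_rep_act[OF M])
sublocale RN: dd_rep D scl "coords e" "act N" by (rule dd_rep_act[OF N])

lemmas tn_lin = tens_add_left tens_add_right tens_diff_left tens_diff_right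
  tens_scale_left tens_scale_right tens_zero_left tens_zero_right

abbreviation "kfold ps \<equiv>
  foldr (\<lambda>(p, q) A. kronecker (meval M p) (meval N q) + A) ps (0\<^sub>m (d * e) (d * e))"

lemma fold_kronecker:
  assumes "\<And>P Q. (P, Q) \<in> set ps \<Longrightarrow> set1_ncpoly P \<subseteq> dd_gens D \<and> set1_ncpoly Q \<subseteq> dd_gens D"
  shows "kfold ps \<in> carrier_mat (d * e) (d * e)"
    and "u \<in> coords d \<Longrightarrow> w \<in> coords e \<Longrightarrow> mop (kfold ps) (tn u w) =
      (\<Sum>(P, Q)\<leftarrow>ps. tn (ev scl (act M) P u) (ev scl (act N) Q w))"
proof -
  have "kfold ps \<in> carrier_mat (d * e) (d * e) \<and> (u \<in> coords d \<longrightarrow> w \<in> coords e \<longrightarrow> mop (kfold ps) (tn u w) =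
      (\<Sum>(P, Q)\<leftarrow>ps. tn (ev scl (act M) P u) (ev scl (act N) Q w)))"
    using assms
  proof (induction ps)
    case (Cons x ps)
    obtain P Q where x: "x = (P, Q)" by (cases x)
    have PQ: "set1_ncpoly P \<subseteq> dd_gens D" "set1_ncpoly Q \<subseteq> dd_gens D" using Cons.prems x by auto
    have car: "\<And>s. s \<in> dd_gens D \<Longrightarrow> mact M s \<in> carrier_mat d d" "\<And>s. s \<in> dd_gens D \<Longrightarrow> mact N s \<in> carrier_mat e e"
      using M N by (auto simp: is_dmod_def)
    have cl: "meval M P \<in> carrier_mat d d" "meval N Q \<in> carrier_mat e e"
      using PQ car by (auto intro!: eval_nc_closed[where S = "dd_gens D"])
    have kc: "kronecker (meval M P) (meval N Q) \<in> carrier_mat (d * e) (d * e)" by (rule kronecker_carrier[OF cl])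
    have IH: "kfold ps \<in> carrier_mat (d * e) (d * e)" "u \<in> coords d \<longrightarrow> w \<in> coords e \<longrightarrow> mop (kfold ps) (tn u w) =
      (\<Sum>(P, Q)\<leftarrow>ps. tn (ev scl (act M) P u) (ev scl (act N) Q w))" using Cons by auto
    show ?case
      using kc IH mop_plus[OF kc IH(1)] mop_kronecker[OF cl, of u w]
        mop_eval_nc[OF PQ(1) car(1), where v = u] mop_eval_nc[OF PQ(2) car(2), where v = w]
      by (simp add: x act_def[abs_def])
  qed simp
  then show "kfold ps \<in> carrier_mat (d * e) (d * e)" "u \<in> coords d \<Longrightarrow> w \<in> coords e \<Longrightarrow> mop (kfold ps) (tn u w) =
      (\<Sum>(P, Q)\<leftarrow>ps. tn (ev scl (act M) P u) (ev scl (act N) Q w))" by auto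
qed

lemma mdim_T [simp]: "mdim T = d * e"
  by (simp add: mod_tensor_def)

lemma T_carrier: "s \<in> dd_gens D \<Longrightarrow> mact T s \<in> carrier_mat (d * e) (d * e)"
  unfolding mod_tensor_def using fold_kronecker(1)[OF comult_letters] by simp

lemma T_closed: "s \<in> dd_gens D \<Longrightarrow> act T s v \<in> coords (d * e)"
  unfolding act_def by (rule mop_closed[OF T_carrier])

lemma T_act: "s \<in> dd_gens D \<Longrightarrow> u \<in> coords d \<Longrightarrow> w \<in> coords e \<Longrightarrow> act T s (tn u w) =
    (\<Sum>(P, Q)\<leftarrow>dd_comult D s. tn (ev scl (act M) P u) (ev scl (act N) Q w))"
  unfolding act_def mod_tensor_def using fold_kronecker(2)[OF comult_letters]
  by (simp add: act_def[abs_def])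

lemma T_gg: "u \<in> coords d \<Longrightarrow> w \<in> coords e \<Longrightarrow> g \<in> carrier G \<Longrightarrow>
    act T (Grp g) (tn u w) = tn (RM.gg g u) (RN.gg g w)"
  by (simp add: T_act grp_gens)

lemma T_X: "u \<in> coords d \<Longrightarrow> w \<in> coords e \<Longrightarrow>
    act T GenX (tn u w) = tn (RM.X u) (RN.K w) + tn u (RN.X w)"
  by (simp add: T_act x_gens one_ncpoly_def)

lemma T_Xi: "u \<in> coords d \<Longrightarrow> w \<in> coords e \<Longrightarrow>
    act T GenXi (tn u w) = tn (RM.Xi u) w + tn (RM.L u) (RN.Xi w)"
  by (simp add: T_act xi_gens one_ncpoly_def)

text \<open>The operator \<open>f \<otimes> h\<close>, extended linearly from pure tensors.\<close>

definition kop :: "((nat \<Rightarrow> 'k) \<Rightarrow> nat \<Rightarrow> 'k) \<Rightarrow> ((nat \<Rightarrow> 'k) \<Rightarrow> nat \<Rightarrow> 'k) \<Rightarrow> (nat \<Rightarrow> 'k) \<Rightarrow> nat \<Rightarrow> 'k" where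
  "kop f h = mop (kronecker (mat_of d d f) (mat_of e e h))"

lemma kop_tn:
  assumes "module_hom scl scl f" "module_hom scl scl h"
    and "\<And>u. u \<in> coords d \<Longrightarrow> f u \<in> coords d" "\<And>w. w \<in> coords e \<Longrightarrow> h w \<in> coords e"
    and "u \<in> coords d" "w \<in> coords e"
  shows "kop f h (tn u w) = tn (f u) (h w)"
proof -
  have "mop (mat_of d d f) u = f u"
    by (rule mop_mat_of) (use assms in \<open>auto simp: module_hom.add module_hom.scale\<close>)
  moreover have "mop (mat_of e e h) w = h w"
    by (rule mop_mat_of) (use assms in \<open>auto simp: module_hom.add module_hom.scale\<close>)
  ultimately show ?thesis by (simp add: kop_def mop_kronecker)
qed

lemma kop_closed: "kop f h v \<in> coords (d * e)"
  unfolding kop_def by (rule mop_closed[OF kronecker_carrier]) auto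

lemma mh_kop: "module_hom scl scl f' \<Longrightarrow> module_hom scl scl (\<lambda>v. kop f h (f' v))"
  unfolding kop_def by (rule mh_mop)

text \<open>In the tensor product \<open>\<gamma>\<close> acts by \<open>(\<gamma> \<otimes> \<gamma>) (1 + corr \<gamma> \<cdot> \<Theta>)\<close> with an operator \<open>\<Theta>\<close> that does not depend on
\<open>\<gamma>\<close> (\<open>T_cc\<close>). The two factors are \<open>cc2 \<gamma>\<close> and, with \<open>Th\<close> for \<open>\<Theta>\<close>, the bracket.\<close>

definition cc2 :: "('g \<Rightarrow> 'k) \<Rightarrow> (nat \<Rightarrow> 'k) \<Rightarrow> nat \<Rightarrow> 'k" where
  "cc2 \<gamma> = kop (RM.cc \<gamma>) (RN.cc \<gamma>)"

definition Th :: "(nat \<Rightarrow> 'k) \<Rightarrow> nat \<Rightarrow> 'k" where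
  "Th v = (\<Sum>p\<in>{1..<n}. kop (\<lambda>u. (RM.L ^^ p) (RM.dp (n - p) u)) (RN.dp p) v)"

lemma mh_cc2: "module_hom scl scl f \<Longrightarrow> module_hom scl scl (\<lambda>v. cc2 \<gamma> (f v))"
  unfolding cc2_def by (rule mh_kop)

lemma mh_Th: "module_hom scl scl f \<Longrightarrow> module_hom scl scl (\<lambda>v. Th (f v))"
  unfolding Th_def by (intro mh_sum mh_kop)

lemmas cc2_lin = module_hom.add[OF mh_cc2[OF mh_id]] module_hom.scale[OF mh_cc2[OF mh_id]]
  module_hom.zero[OF mh_cc2[OF mh_id]] module_hom.diff[OF mh_cc2[OF mh_id]]
lemmas Th_lin = module_hom.add[OF mh_Th[OF mh_id]] module_hom.scale[OF mh_Th[OF mh_id]]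
  module_hom.zero[OF mh_Th[OF mh_id]] module_hom.diff[OF mh_Th[OF mh_id]]
lemmas T_lin = module_hom.add[OF mh_act[OF mh_id, of T]] module_hom.scale[OF mh_act[OF mh_id, of T]]
  module_hom.zero[OF mh_act[OF mh_id, of T]] module_hom.diff[OF mh_act[OF mh_id, of T]]

lemma cc2_closed: "cc2 \<gamma> v \<in> coords (d * e)"
  unfolding cc2_def by (rule kop_closed)

lemmas V_rules = fs.subspace_add[OF subspace_coords] fs.subspace_scale[OF subspace_coords]
  fs.subspace_diff[OF subspace_coords] fs.subspace_sum[OF subspace_coords]

lemma Th_closed: "Th v \<in> coords (d * e)"
  unfolding Th_def by (intro V_rules kop_closed)

lemmas cl = RM.W_closed RN.W_closed RM.W_rules RN.W_rules RM.dp_W RN.dp_W RM.Lp_W RN.Lp_W RM.Kp_W RN.Kp_W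

lemma cc2_tn: "u \<in> coords d \<Longrightarrow> w \<in> coords e \<Longrightarrow> \<gamma> \<in> carrier \<Gamma> \<Longrightarrow>
    cc2 \<gamma> (tn u w) = tn (RM.cc \<gamma> u) (RN.cc \<gamma> w)"
  unfolding cc2_def by (rule kop_tn) (auto simp: cl RM.lin RN.lin)

lemma mh_dp: "module_hom scl scl (RM.dp r)" "module_hom scl scl (RN.dp r)"
  by unfold_locales (simp_all add: RM.dp_lin RN.dp_lin)

lemma Th_tn: "u \<in> coords d \<Longrightarrow> w \<in> coords e \<Longrightarrow>
    Th (tn u w) = (\<Sum>p\<in>{1..<n}. tn ((RM.L ^^ p) (RM.dp (n - p) u)) (RN.dp p w))"
  unfolding Th_def
  by (rule sum.cong[OF refl], rule kop_tn) (auto simp: cl mh_act_pow mh_dp)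

lemma T_cc_tn: "u \<in> coords d \<Longrightarrow> w \<in> coords e \<Longrightarrow> \<gamma> \<in> carrier \<Gamma> \<Longrightarrow>
    act T (Chr \<gamma>) (tn u w) = cc2 \<gamma> (tn u w + scl (corr \<gamma>) (Th (tn u w)))"
proof -
  assume u: "u \<in> coords d" and w: "w \<in> coords e" and \<gamma>: "\<gamma> \<in> carrier \<Gamma>"
  have pow: "ev scl A (Gen s ^ i) v = (A s ^^ i) v" for A :: "('g, 'k) gen \<Rightarrow> (nat \<Rightarrow> 'k) \<Rightarrow> nat \<Rightarrow> 'k" and s i v
    by (induction i) (simp_all add: one_ncpoly_def times_ncpoly_def)
  show ?thesis
  proof (cases "nilpotent_type D")
    case True
    then show ?thesis using u w \<gamma> by (simp add: T_act chr_gens corr_def cc2_tn)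
  next
    case False
    let ?t = "\<lambda>p. scl (corr \<gamma>) (tn (RM.cc \<gamma> ((RM.L ^^ p) (RM.dp (n - p) u))) (RN.cc \<gamma> (RN.dp p w)))"
    have "act T (Chr \<gamma>) (tn u w) = tn (RM.cc \<gamma> u) (RN.cc \<gamma> w) +
       (\<Sum>p\<leftarrow>[1..<n]. tn (scl ((\<gamma> a ^ n - 1) / (qfact \<rho> p * qfact \<rho> (n - p)))
          (RM.cc \<gamma> (act M (Chr (\<chi> [^]\<^bsub>\<Gamma>\<^esub> p)) ((RM.Xi ^^ (n - p)) u)))) (RN.cc \<gamma> ((RN.Xi ^^ p) w)))"
      using False by (simp add: T_act u w chr_gens[OF \<gamma>] Let_def comp_def times_ncpoly_def pow[unfolded times_ncpoly_def])
    also have "(\<Sum>p\<leftarrow>[1..<n]. tn (scl ((\<gamma> a ^ n - 1) / (qfact \<rho> p * qfact \<rho> (n - p)))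
          (RM.cc \<gamma> (act M (Chr (\<chi> [^]\<^bsub>\<Gamma>\<^esub> p)) ((RM.Xi ^^ (n - p)) u)))) (RN.cc \<gamma> ((RN.Xi ^^ p) w)))
       = (\<Sum>p\<leftarrow>[1..<n]. ?t p)"
      using False by (intro arg_cong[of _ _ sum_list] map_cong refl)
        (simp add: RM.Lp_eq[symmetric] cl u RM.dp_def RN.dp_def RM.A_lin RN.A_lin RM.Ap_scale tn_lin corr_def divide_inverse mult_ac)
    also have "\<dots> = (\<Sum>p\<in>{1..<n}. ?t p)"
      by (simp add: interv_sum_list_conv_sum_set_nat)
    also have "\<dots> = scl (corr \<gamma>) (cc2 \<gamma> (Th (tn u w)))"
      unfolding Th_tn[OF u w] module_hom.sum[OF mh_cc2[OF mh_id]] fs.scale_sum_right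
      by (rule sum.cong) (simp_all add: cc2_tn cl u w \<gamma>)
    finally show ?thesis by (simp add: cc2_lin cc2_tn u w \<gamma>)
  qed
qed

lemma T_cc: "v \<in> coords (d * e) \<Longrightarrow> \<gamma> \<in> carrier \<Gamma> \<Longrightarrow>
    act T (Chr \<gamma>) v = cc2 \<gamma> (v + scl (corr \<gamma>) (Th v))"
  by (rule tens_ext[where d = d and e = e]) (auto intro!: mh_intros mh_cc2 mh_Th simp: T_cc_tn)

lemma T_L: "u \<in> coords d \<Longrightarrow> w \<in> coords e \<Longrightarrow> act T (Chr \<chi>) (tn u w) = tn (RM.L u) (RN.L w)"
  by (simp add: T_cc_tn chi_Gam corr_chi cc2_tn)

subsection \<open>Powers of \<open>x\<close> and \<open>\<xi>\<close>\<close>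

lemma T_Xi_pow: "u \<in> coords d \<Longrightarrow> w \<in> coords e \<Longrightarrow> (act T GenXi ^^ m) (tn u w) =
    (\<Sum>p\<le>m. scl (qbin \<rho> m p) (tn ((RM.L ^^ p) ((RM.Xi ^^ (m - p)) u)) ((RN.Xi ^^ p) w)))"
proof -
  assume u: "u \<in> coords d" and w: "w \<in> coords e"
  show ?thesis
    using q_binomial_expansion[of "act T GenXi" "\<lambda>m p. tn ((RM.L ^^ p) ((RM.Xi ^^ (m - p)) u)) ((RN.Xi ^^ p) w)" \<rho> m]
    by (simp add: T_Xi cl u w RM.Xi_Lp tn_lin Suc_diff_le mh_act mh_id)
qed

lemma T_X_pow: "u \<in> coords d \<Longrightarrow> w \<in> coords e \<Longrightarrow> (act T GenX ^^ m) (tn u w) =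
    (\<Sum>p\<le>m. scl (qbin \<rho> m p) (tn ((RM.X ^^ p) u) ((RN.K ^^ p) ((RN.X ^^ (m - p)) w))))"
proof -
  assume u: "u \<in> coords d" and w: "w \<in> coords e"
  show ?thesis
    using q_binomial_expansion[of "act T GenX" "\<lambda>m p. tn ((RM.X ^^ p) u) ((RN.K ^^ p) ((RN.X ^^ (m - p)) w))" \<rho> m]
    by (simp add: T_X cl u w RN.X_Kp tn_lin Suc_diff_le mh_act mh_id add.commute)
qed

lemma sum_qbin_n: "(\<Sum>p\<le>n. scl (qbin \<rho> n p) (t p)) = t 0 + t n"
proof -
  have "(\<Sum>p\<le>n. scl (qbin \<rho> n p) (t p)) = (\<Sum>p\<in>{0, n}. scl (qbin \<rho> n p) (t p))"
    by (rule sum.mono_neutral_right) (auto simp: qbin_n)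
  then show ?thesis using n2 by (simp add: qbin_self)
qed

lemma T_Xi_n: "v \<in> coords (d * e) \<Longrightarrow> (act T GenXi ^^ n) v = 0"
  by (rule tens_ext[where d = d and e = e])
    (auto intro!: mh_intros simp: T_Xi_pow sum_qbin_n RM.Xi_n RN.Xi_n tn_lin)

lemma T_X_n: "v \<in> coords (d * e) \<Longrightarrow> (act T GenX ^^ n) v = scl (alp D) (act T (Grp (a [^]\<^bsub>G\<^esub> n)) v - v)"
proof (rule tens_ext[where d = d and e = e and f = "\<lambda>v. (act T GenX ^^ n) v" and
      g = "\<lambda>v. scl (alp D) (act T (Grp (a [^]\<^bsub>G\<^esub> n)) v - v)"])
  fix u w :: "nat \<Rightarrow> 'k" assume u: "u \<in> coords d" and w: "w \<in> coords e"
  have "a [^]\<^bsub>G\<^esub> n \<in> carrier G" using a_G by simp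
  then show "(act T GenX ^^ n) (tn u w) = scl (alp D) (act T (Grp (a [^]\<^bsub>G\<^esub> n)) (tn u w) - tn u w)"
    by (simp add: T_X_pow u w sum_qbin_n RM.X_n RN.X_n RN.Kp_eq T_gg tn_lin fs.scale_right_diff_distrib)
qed (auto intro!: mh_intros)

lemma T_Xi_pow_divided: "u \<in> coords d \<Longrightarrow> w \<in> coords e \<Longrightarrow> m < n \<Longrightarrow> (act T GenXi ^^ m) (tn u w) =
    scl (qfact \<rho> m) (\<Sum>p\<le>m. tn ((RM.L ^^ p) (RM.dp (m - p) u)) (RN.dp p w))"
  unfolding T_Xi_pow fs.scale_sum_right
  by (rule sum.cong) (simp_all add: qbin_divided RM.dp_def RN.dp_def RM.Ap_scale tn_lin mult_ac)

end

context dd_rep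
begin

text \<open>The correction term in the relation between \<open>x\<close> and \<open>\<gamma>\<close>, up to \<open>\<gamma>\<close> and a scalar.\<close>

definition Yop :: "'v \<Rightarrow> 'v" where
  "Yop v = \<rho> \<odot> K ((Xi ^^ (n - 1)) v) - L ((Xi ^^ (n - 1)) v)"

lemma Yop_W: "v \<in> W \<Longrightarrow> Yop v \<in> W"
  by (simp add: Yop_def W_closed W_rules)

lemma Yop_hom: "module_hom sc sc Yop"
  by unfold_locales (simp_all add: Yop_def A_lin Ap_add Ap_scale algebra_simps)

lemma Yop_dp: "v \<in> W \<Longrightarrow> 0 < r \<Longrightarrow> Yop (dp r v) = 0"
  using n2 by (simp add: Yop_def Xip_dp A_lin)

lemma Yop_Lp_dp: "v \<in> W \<Longrightarrow> 0 < r \<Longrightarrow> Yop ((L ^^ p) (dp r v)) = 0"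
  using n2 by (simp add: Yop_def Xip_dp Xip_Lp dp_W A_lin Ap_zero)

lemma Yop_eq: "v \<in> W \<Longrightarrow> inverse (qfact \<rho> (n - 1)) \<odot> Yop v = \<rho> \<odot> K (dp (n - 1) v) - L (dp (n - 1) v)"
  by (simp add: Yop_def dp_def A_lin vs.scale_right_diff_distrib mult.commute)

lemma dp_L: "v \<in> W \<Longrightarrow> dp j (L v) = \<rho> ^ j \<odot> L (dp j v)"
  using dp_Lp[of v j 1] by simp

end

context dd_tensor
begin

subsection \<open>The correction operator\<close>

lemma V_T: "act T (Grp a) v \<in> coords (d * e)" "act T (Chr \<chi>) v \<in> coords (d * e)"
  "act T GenX v \<in> coords (d * e)" "act T GenXi v \<in> coords (d * e)"
  using T_closed grp_gens[OF a_G] chr_gens[OF chi_Gam] x_gens xi_gens by auto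

text \<open>The difference of the two sides is a telescoping sum whose boundary terms contain the
  vanishing \<open>n\<close>-th divided power of \<open>\<xi>\<close>.\<close>

lemma T_Xi_Th: "v \<in> coords (d * e) \<Longrightarrow> act T GenXi (Th v) = Th (act T GenXi v)"
proof (rule tens_ext[where d = d and e = e and f = "\<lambda>v. act T GenXi (Th v)" and g = "\<lambda>v. Th (act T GenXi v)"])
  fix u w :: "nat \<Rightarrow> 'k" assume u: "u \<in> coords d" and w: "w \<in> coords e"
  define Gt where "Gt p = tn ((RM.L ^^ p) (RM.dp (Suc n - p) u)) (RN.dp p w)" for p
  define H where "H p = scl ((\<rho> ^ p - 1) * qnum \<rho> (Suc n - p)) (Gt p)" for p
  have l: "act T GenXi (Th (tn u w)) = (\<Sum>p\<in>{1..<n}. scl (\<rho> ^ p * qnum \<rho> (Suc n - p)) (Gt p) + scl (qnum \<rho> (Suc p)) (Gt (Suc p)))"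
    unfolding Th_tn[OF u w] module_hom.sum[OF mh_act[OF mh_id]]
    by (rule sum.cong) (simp_all add: T_Xi cl u w RM.Xi_Lp RM.Xi_dp RN.Xi_dp RM.Ap_scale tn_lin Gt_def Suc_diff_le)
  have r: "Th (act T GenXi (tn u w)) = (\<Sum>p\<in>{1..<n}. scl (qnum \<rho> (Suc n - p)) (Gt p) + scl (\<rho> ^ (n - p) * qnum \<rho> (Suc p)) (Gt (Suc p)))"
    unfolding T_Xi[OF u w] Th_lin Th_tn[OF RM.Xi_W[OF u] w] Th_tn[OF RM.cc_W[OF chi_Gam u] RN.Xi_W[OF w]] sum.distrib[symmetric]
    by (rule sum.cong) (simp_all add: cl u w RM.dp_Xi RN.dp_Xi RM.dp_L RM.Ap_scale tn_lin Gt_def Suc_diff_le funpow_swap1 mult.commute)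
  have q: "(1 - \<rho> ^ (n - p)) * qnum \<rho> (Suc p) = (1 - \<rho> ^ Suc p) * qnum \<rho> (n - p)" for p
  proof -
    have "(1 - \<rho>) * ((1 - \<rho> ^ (n - p)) * qnum \<rho> (Suc p)) = (1 - \<rho>) * ((1 - \<rho> ^ Suc p) * qnum \<rho> (n - p))"
      unfolding mult.left_commute[of "1 - \<rho>" "1 - _"] qnum_eq by (rule mult.commute)
    then show ?thesis using rho_1 by simp
  qed
  have "act T GenXi (Th (tn u w)) - Th (act T GenXi (tn u w)) = (\<Sum>p\<in>{1..<n}. - (H (Suc p) - H p))"
    unfolding l r sum_subtractf[symmetric]
  proof (rule sum.cong[OF refl])
    fix p
    have "H (Suc p) = scl (- ((1 - \<rho> ^ (n - p)) * qnum \<rho> (Suc p))) (Gt (Suc p))"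
      unfolding q H_def by (simp flip: fs.scale_minus_left mult_minus_left)
    then show "scl (\<rho> ^ p * qnum \<rho> (Suc n - p)) (Gt p) + scl (qnum \<rho> (Suc p)) (Gt (Suc p)) -
      (scl (qnum \<rho> (Suc n - p)) (Gt p) + scl (\<rho> ^ (n - p) * qnum \<rho> (Suc p)) (Gt (Suc p))) = - (H (Suc p) - H p)"
      by (simp add: H_def fs.scale_left_diff_distrib left_diff_distrib)
  qed
  also have "\<dots> = - (H n - H 1)"
    unfolding sum_negf using sum_Suc_diff'[of 1 n H] n2 by simp
  also have "\<dots> = 0" by (simp add: H_def Gt_def RM.dp_n RN.dp_n RM.A_lin tn_lin)
  finally show "act T GenXi (Th (tn u w)) = Th (act T GenXi (tn u w))" by simp
qed (auto intro!: mh_intros mh_Th)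

text \<open>All terms of \<open>\<Theta>\<close> have total degree \<open>n\<close> in \<open>\<xi>\<close>, and \<open>\<chi>\<^sup>n = 1\<close>.\<close>

lemma T_gg_Th: "\<not> nilpotent_type D \<Longrightarrow> g \<in> carrier G \<Longrightarrow> v \<in> coords (d * e) \<Longrightarrow>
    Th (act T (Grp g) v) = act T (Grp g) (Th v)"
proof (rule tens_ext[where d = d and e = e and f = "\<lambda>v. Th (act T (Grp g) v)" and g = "\<lambda>v. act T (Grp g) (Th v)"])
  assume nn: "\<not> nilpotent_type D" and g: "g \<in> carrier G"
  fix u w :: "nat \<Rightarrow> 'k" assume u: "u \<in> coords d" and w: "w \<in> coords e"
  have c: "inverse (\<chi> g) ^ p * inverse (\<chi> g) ^ (n - p) = 1" if "p < n" for p
  proof -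
    have "inverse (\<chi> g) ^ p * inverse (\<chi> g) ^ (n - p) = inverse (\<chi> g ^ n)"
      using that by (simp flip: power_add power_inverse)
    then show ?thesis using chi_n_apply[OF nn g] by simp
  qed
  show "Th (act T (Grp g) (tn u w)) = act T (Grp g) (Th (tn u w))"
    unfolding T_gg[OF u w g] Th_tn[OF u w] Th_tn[OF RM.gg_W[OF g u] RN.gg_W[OF g w]] module_hom.sum[OF mh_act[OF mh_id]]
    by (rule sum.cong) (simp_all add: c T_gg cl u w g RM.dp_gg RN.dp_gg RM.gg_Lp RM.Ap_scale tn_lin)
qed (auto intro!: mh_intros mh_Th)

lemma Th_cc2: "\<gamma> \<in> carrier \<Gamma> \<Longrightarrow> v \<in> coords (d * e) \<Longrightarrow> Th (cc2 \<gamma> v) = scl (\<gamma> a ^ n) (cc2 \<gamma> (Th v))"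
proof (rule tens_ext[where d = d and e = e and f = "\<lambda>v. Th (cc2 \<gamma> v)" and g = "\<lambda>v. scl (\<gamma> a ^ n) (cc2 \<gamma> (Th v))"])
  assume g: "\<gamma> \<in> carrier \<Gamma>"
  fix u w :: "nat \<Rightarrow> 'k" assume u: "u \<in> coords d" and w: "w \<in> coords e"
  have c: "\<gamma> a ^ p * \<gamma> a ^ (n - p) = \<gamma> a ^ n" if "p < n" for p
    using that by (simp flip: power_add)
  show "Th (cc2 \<gamma> (tn u w)) = scl (\<gamma> a ^ n) (cc2 \<gamma> (Th (tn u w)))"
    unfolding cc2_tn[OF u w g] Th_tn[OF u w] Th_tn[OF RM.cc_W[OF g u] RN.cc_W[OF g w]]
      module_hom.sum[OF mh_cc2[OF mh_id]] fs.scale_sum_right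
    by (rule sum.cong) (simp_all add: c cc2_tn cl u w g RM.dp_cc RN.dp_cc RM.cc_Lp RM.Ap_scale tn_lin)
qed (auto intro!: mh_intros mh_Th mh_cc2)

lemma cc2_mult: "\<gamma> \<in> carrier \<Gamma> \<Longrightarrow> \<delta> \<in> carrier \<Gamma> \<Longrightarrow> v \<in> coords (d * e) \<Longrightarrow> cc2 \<gamma> (cc2 \<delta> v) = cc2 (\<gamma> \<otimes>\<^bsub>\<Gamma>\<^esub> \<delta>) v"
  by (rule tens_ext[where d = d and e = e])
    (auto intro!: mh_intros mh_cc2 simp: cc2_tn cl RM.cc_mult RN.cc_mult)

lemma cc2_one: "v \<in> coords (d * e) \<Longrightarrow> cc2 \<one>\<^bsub>\<Gamma>\<^esub> v = v"
  by (rule tens_ext[where d = d and e = e])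
    (auto intro!: mh_intros mh_cc2 simp: cc2_tn cl RM.cc_one RN.cc_one)

lemma cc2_gg: "\<gamma> \<in> carrier \<Gamma> \<Longrightarrow> g \<in> carrier G \<Longrightarrow> v \<in> coords (d * e) \<Longrightarrow>
    act T (Grp g) (cc2 \<gamma> v) = cc2 \<gamma> (act T (Grp g) v)"
  by (rule tens_ext[where d = d and e = e])
    (auto intro!: mh_intros mh_cc2 simp: cc2_tn T_gg cl RM.gg_cc RN.gg_cc)

lemma cc2_Xi: "\<gamma> \<in> carrier \<Gamma> \<Longrightarrow> v \<in> coords (d * e) \<Longrightarrow>
    act T GenXi (cc2 \<gamma> v) = scl (\<gamma> a) (cc2 \<gamma> (act T GenXi v))"
  by (rule tens_ext[where d = d and e = e])
    (auto intro!: mh_intros mh_cc2 simp: cc2_tn T_Xi cl cc2_lin tn_lin RM.Xi_cc RN.Xi_cc RM.cc_comm[OF _ chi_Gam] fs.scale_right_distrib)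

lemma T_L_cc2: "v \<in> coords (d * e) \<Longrightarrow> act T (Chr \<chi>) v = cc2 \<chi> v"
  by (simp add: T_cc chi_Gam corr_chi)

text \<open>The total degree in \<open>\<xi>\<close> is \<open>2 n\<close>, so in one of the two factors the degree is at least \<open>n\<close>.\<close>

lemma Th_Th: "v \<in> coords (d * e) \<Longrightarrow> Th (Th v) = 0"
proof (rule tens_ext[where d = d and e = e and f = "\<lambda>v. Th (Th v)" and g = "\<lambda>v. 0"])
  fix u w :: "nat \<Rightarrow> 'k" assume u: "u \<in> coords d" and w: "w \<in> coords e"
  have "Th (tn ((RM.L ^^ p) (RM.dp (n - p) u)) (RN.dp p w)) = 0" if p: "p \<in> {1..<n}" for p
  proof -
    have "tn ((RM.L ^^ p') (RM.dp (n - p') ((RM.L ^^ p) (RM.dp (n - p) u)))) (RN.dp p' (RN.dp p w)) = 0"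
      if p': "p' \<in> {1..<n}" for p'
    proof (cases "n \<le> p' + p")
      case True
      then show ?thesis by (simp add: RN.dp_dp w tn_lin)
    next
      case False
      then show ?thesis using p p' by (simp add: RM.dp_dp RM.dp_Lp cl u RM.Ap_zero RM.Ap_scale tn_lin)
    qed
    then show ?thesis by (simp add: Th_tn cl u w)
  qed
  then show "Th (Th (tn u w)) = 0"
    unfolding Th_tn[OF u w] module_hom.sum[OF mh_Th[OF mh_id]] by simp
qed (auto intro!: mh_intros mh_Th)

text \<open>The total degree in \<open>\<xi>\<close> is \<open>2 n - 1\<close>, so in one of the two factors the degree is at least \<open>n\<close>.\<close>

lemma T_Xip_Th: "v \<in> coords (d * e) \<Longrightarrow> (act T GenXi ^^ (n - 1)) (Th v) = 0"
proof (rule tens_ext[where d = d and e = e and f = "\<lambda>v. (act T GenXi ^^ (n - 1)) (Th v)" and g = "\<lambda>v. 0"])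
  fix u w :: "nat \<Rightarrow> 'k" assume u: "u \<in> coords d" and w: "w \<in> coords e"
  have "(act T GenXi ^^ (n - 1)) (tn ((RM.L ^^ p) (RM.dp (n - p) u)) (RN.dp p w)) = 0" if p: "p \<in> {1..<n}" for p
  proof -
    have "tn ((RM.L ^^ j) ((RM.Xi ^^ (n - 1 - j)) ((RM.L ^^ p) (RM.dp (n - p) u)))) ((RN.Xi ^^ j) (RN.dp p w)) = 0"
      if j: "j \<le> n - 1" for j
    proof (cases "n \<le> j + p")
      case True
      then show ?thesis by (simp add: RN.Xip_dp w tn_lin)
    next
      case False
      then show ?thesis using p j by (simp add: RM.Xip_dp RM.Xip_Lp cl u RM.Ap_zero RM.Ap_scale tn_lin)
    qed
    then show ?thesis by (simp add: T_Xi_pow cl u w)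
  qed
  then show "(act T GenXi ^^ (n - 1)) (Th (tn u w)) = 0"
    unfolding Th_tn[OF u w] module_hom.sum[OF mh_act_pow[OF mh_id]] by simp
qed (auto intro!: mh_intros mh_Th)

text \<open>What is left when \<open>x\<close> is moved past \<open>\<gamma> \<otimes> \<gamma>\<close> (\<open>X_cc2\<close>): the correction term of either tensor factor.\<close>

definition Ey :: "(nat \<Rightarrow> 'k) \<Rightarrow> nat \<Rightarrow> 'k" where
  "Ey v = kop RM.Yop RN.K v + kop (\<lambda>u. u) RN.Yop v"

lemma mh_Ey: "module_hom scl scl f \<Longrightarrow> module_hom scl scl (\<lambda>v. Ey (f v))"
  unfolding Ey_def by (intro mh_add mh_kop)

lemmas Ey_lin = module_hom.add[OF mh_Ey[OF mh_id]] module_hom.scale[OF mh_Ey[OF mh_id]]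

lemma Ey_tn: "u \<in> coords d \<Longrightarrow> w \<in> coords e \<Longrightarrow> Ey (tn u w) = tn (RM.Yop u) (RN.K w) + tn u (RN.Yop w)"
  unfolding Ey_def
  using kop_tn[OF RM.Yop_hom RN.lin RM.Yop_W RN.gg_W[OF a_G], of u w]
    kop_tn[OF mh_id RN.Yop_hom _ RN.Yop_W, of u w] by simp

lemma Ey_Th: "v \<in> coords (d * e) \<Longrightarrow> Ey (Th v) = 0"
proof (rule tens_ext[where d = d and e = e and f = "\<lambda>v. Ey (Th v)" and g = "\<lambda>v. 0"])
  fix u w :: "nat \<Rightarrow> 'k" assume u: "u \<in> coords d" and w: "w \<in> coords e"
  have "Ey (tn ((RM.L ^^ p) (RM.dp (n - p) u)) (RN.dp p w)) = 0" if p: "p \<in> {1..<n}" for p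
    using p by (simp add: Ey_tn cl u w RM.Yop_Lp_dp RN.Yop_dp tn_lin)
  then show "Ey (Th (tn u w)) = 0"
    unfolding Th_tn[OF u w] module_hom.sum[OF mh_Ey[OF mh_id]] by simp
qed (auto intro!: mh_intros mh_Th mh_Ey)

lemma X_cc2: "\<gamma> \<in> carrier \<Gamma> \<Longrightarrow> v \<in> coords (d * e) \<Longrightarrow> scl (\<gamma> a) (act T GenX (cc2 \<gamma> v)) =
    cc2 \<gamma> (act T GenX v + scl (corr \<gamma> / qfact \<rho> (n - 1)) (Ey v))"
proof (rule tens_ext[where d = d and e = e and f = "\<lambda>v. scl (\<gamma> a) (act T GenX (cc2 \<gamma> v))" and
      g = "\<lambda>v. cc2 \<gamma> (act T GenX v + scl (corr \<gamma> / qfact \<rho> (n - 1)) (Ey v))"])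
  assume g: "\<gamma> \<in> carrier \<Gamma>"
  fix u w :: "nat \<Rightarrow> 'k" assume u: "u \<in> coords d" and w: "w \<in> coords e"
  have 1: "scl (\<gamma> a) (RM.X (RM.cc \<gamma> u)) = RM.cc \<gamma> (RM.X u) + scl (corr \<gamma> / qfact \<rho> (n - 1)) (RM.cc \<gamma> (RM.Yop u))"
    using RM.X_cc[OF u g] by (simp add: RM.Yop_def)
  have 2: "scl (\<gamma> a) (RN.X (RN.cc \<gamma> w)) = RN.cc \<gamma> (RN.X w) + scl (corr \<gamma> / qfact \<rho> (n - 1)) (RN.cc \<gamma> (RN.Yop w))"
    using RN.X_cc[OF w g] by (simp add: RN.Yop_def)
  have "scl (\<gamma> a) (act T GenX (cc2 \<gamma> (tn u w))) =
      tn (scl (\<gamma> a) (RM.X (RM.cc \<gamma> u))) (RN.cc \<gamma> (RN.K w)) + tn (RM.cc \<gamma> u) (scl (\<gamma> a) (RN.X (RN.cc \<gamma> w)))"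
    by (simp add: cc2_tn u w g T_X cl RN.gg_cc[OF w a_G g] tn_lin fs.scale_right_distrib)
  also have "\<dots> = cc2 \<gamma> (act T GenX (tn u w) + scl (corr \<gamma> / qfact \<rho> (n - 1)) (Ey (tn u w)))"
    unfolding 1 2
    by (simp add: cc2_lin cc2_tn u w g T_X Ey_tn cl RM.Yop_W RN.Yop_W tn_lin fs.scale_right_distrib add_ac)
  finally show "scl (\<gamma> a) (act T GenX (cc2 \<gamma> (tn u w))) =
    cc2 \<gamma> (act T GenX (tn u w) + scl (corr \<gamma> / qfact \<rho> (n - 1)) (Ey (tn u w)))" .
qed (auto intro!: mh_intros mh_Ey mh_cc2)

text \<open>The heart of the compatibility of the comultiplication with the relation between \<open>x\<close> and \<open>\<gamma>\<close>. Expand \<open>\<Theta>\<close> in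
divided powers and commute \<open>x\<close> with each of them. Among the terms of degree \<open>n - 1\<close> in \<open>\<xi>\<close> that appear, those with \<open>a\<close> in
both factors (\<open>B\<close>) or \<open>\<chi>\<close> in both factors (\<open>F\<close>) make up the right-hand side, except for one term of each kind; the mixed terms (\<open>C\<close>)
telescope. \<open>Ey\<close> supplies the missing terms and cancels the boundary of the telescope, by \<open>\<chi>\<^sup>n = 1\<close>.\<close>

lemma X_Th: "\<not> nilpotent_type D \<Longrightarrow> v \<in> coords (d * e) \<Longrightarrow>
    act T GenX (Th v) - Th (act T GenX v) + scl (inverse (qfact \<rho> (n - 1))) (Ey v) =
    scl (inverse (qfact \<rho> (n - 1))) (scl \<rho> (act T (Grp a) ((act T GenXi ^^ (n - 1)) v)) -
      act T (Chr \<chi>) ((act T GenXi ^^ (n - 1)) v))"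
proof (rule tens_ext[where d = d and e = e and
      f = "\<lambda>v. act T GenX (Th v) - Th (act T GenX v) + scl (inverse (qfact \<rho> (n - 1))) (Ey v)" and
      g = "\<lambda>v. scl (inverse (qfact \<rho> (n - 1))) (scl \<rho> (act T (Grp a) ((act T GenXi ^^ (n - 1)) v)) -
      act T (Chr \<chi>) ((act T GenXi ^^ (n - 1)) v))"])
  assume nn: "\<not> nilpotent_type D"
  fix u w :: "nat \<Rightarrow> 'k" assume u: "u \<in> coords d" and w: "w \<in> coords e"
  define B where "B p = tn ((RM.L ^^ p) (RM.K (RM.dp (n - 1 - p) u))) (RN.K (RN.dp p w))" for p
  define C where "C p = tn ((RM.L ^^ Suc p) (RM.dp (n - 1 - p) u)) (RN.K (RN.dp p w))" for p
  define F where "F p = tn ((RM.L ^^ Suc p) (RM.dp (n - 1 - p) u)) (RN.L (RN.dp p w))" for p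
  define H where "H p = scl (inverse \<rho> ^ p) (C p)" for p
  have rn: "inverse \<rho> ^ p * inverse \<rho> ^ (n - Suc p) = \<rho>" if "p < n" for p
  proof -
    have "inverse \<rho> ^ Suc (n - 1) = 1" using rho_n n2 by (simp add: power_inverse)
    then have "inverse \<rho> ^ (n - 1) = \<rho>" using rho_nz by (simp add: field_simps)
    then show ?thesis using that by (simp flip: power_add)
  qed
  have "act T GenX (Th (tn u w)) - Th (act T GenX (tn u w)) =
      (\<Sum>p\<in>{1..<n}. scl \<rho> (B p) - F (p - 1) - (H (Suc (p - 1)) - H (p - 1)))"
    unfolding Th_tn[OF u w] T_X[OF u w] Th_lin Th_tn[OF RM.X_W[OF u] RN.gg_W[OF a_G w]]
      Th_tn[OF u RN.X_W[OF w]] module_hom.sum[OF mh_act[OF mh_id]] sum.distrib[symmetric] sum_subtractf[symmetric]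
  proof (rule sum.cong[OF refl])
    fix p assume "p \<in> {1..<n}"
    then obtain k m where k: "p = Suc k" "p < n" "n - p = Suc m" "n - Suc k = Suc m" "n - 1 - p = m" "n - 1 - k = Suc m" "m = n - Suc p"
      by (cases p) auto
    have m: "Suc m < n" and k': "Suc k < n" using k by auto
    have 1: "RM.X (RM.dp (n - p) u) - RM.dp (n - p) (RM.X u) = scl (inverse \<rho> ^ m) (RM.K (RM.dp m u)) - RM.L (RM.dp m u)"
      using RM.X_dp[OF u m] unfolding k(3) by simp
    have 2: "RN.X (RN.dp p w) - RN.dp p (RN.X w) = scl (inverse \<rho> ^ k) (RN.K (RN.dp k w)) - RN.L (RN.dp k w)"
      using RN.X_dp[OF w k'] unfolding k(1) by simp
    have Ls: "(RM.L ^^ i) (RM.L y) = (RM.L ^^ Suc i) y" for i y by (simp add: funpow_swap1)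
    have "act T GenX (tn ((RM.L ^^ p) (RM.dp (n - p) u)) (RN.dp p w)) -
        (tn ((RM.L ^^ p) (RM.dp (n - p) (RM.X u))) (RN.dp p (RN.K w)) + tn ((RM.L ^^ p) (RM.dp (n - p) u)) (RN.dp p (RN.X w)))
      = scl (inverse \<rho> ^ p) (tn ((RM.L ^^ p) (RM.X (RM.dp (n - p) u) - RM.dp (n - p) (RM.X u))) (RN.K (RN.dp p w)))
        + tn ((RM.L ^^ p) (RM.dp (n - p) u)) (RN.X (RN.dp p w) - RN.dp p (RN.X w))"
      by (simp add: T_X cl u w RM.X_Lp RN.dp_gg[OF w a_G] chi_a tn_lin RM.Ap_diff fs.scale_right_diff_distrib)
    also have "\<dots> = scl (inverse \<rho> ^ p * inverse \<rho> ^ m) (B p) - scl (inverse \<rho> ^ p) (C p)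
        + (scl (inverse \<rho> ^ k) (C k) - F k)"
      unfolding 1 2 unfolding B_def C_def F_def k(5,6) k(3)
      by (simp add: tn_lin RM.Ap_diff RM.Ap_scale RM.A_lin fs.scale_right_diff_distrib Ls k(1) del: funpow.simps)
    also have "inverse \<rho> ^ p * inverse \<rho> ^ m = \<rho>" using rn[of p] k by simp
    finally show "act T GenX (tn ((RM.L ^^ p) (RM.dp (n - p) u)) (RN.dp p w)) -
        (tn ((RM.L ^^ p) (RM.dp (n - p) (RM.X u))) (RN.dp p (RN.K w)) + tn ((RM.L ^^ p) (RM.dp (n - p) u)) (RN.dp p (RN.X w)))
      = scl \<rho> (B p) - F (p - 1) - (H (Suc (p - 1)) - H (p - 1))"
      unfolding H_def k(1) by simp
  qed
  also have "\<dots> = (\<Sum>p\<in>{1..<n}. scl \<rho> (B p)) - (\<Sum>p<n - 1. F p) - (H (n - 1) - H 0)"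
  proof -
    have sh: "(\<Sum>p\<in>{1..<n}. f (p - 1)) = (\<Sum>p<n - 1. f p)" for f :: "nat \<Rightarrow> nat \<Rightarrow> 'k"
      using n2 sum.shift_bounds_Suc_ivl[of "\<lambda>p. f (p - 1)" 0 "n - 1"] by (simp add: lessThan_atLeast0)
    show ?thesis
      unfolding sum_subtractf sh[of F] sh[of H] sh[of "\<lambda>p. H (Suc p)"]
      using sum_lessThan_telescope[of H "n - 1"] by (simp add: sum_subtractf)
  qed
  finally have D1: "act T GenX (Th (tn u w)) - Th (act T GenX (tn u w)) =
      (\<Sum>p\<in>{1..<n}. scl \<rho> (B p)) - (\<Sum>p<n - 1. F p) - (H (n - 1) - H 0)" .
  have D2: "(\<Sum>p\<in>{1..<n}. scl \<rho> (B p)) - (\<Sum>p<n - 1. F p) - (H (n - 1) - H 0) + scl (inverse (qfact \<rho> (n - 1))) (Ey (tn u w)) = (\<Sum>p<n. scl \<rho> (B p)) - (\<Sum>p<n. F p)"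
  proof -
    have "H (n - 1) = scl \<rho> (tn u (RN.K (RN.dp (n - 1) w)))"
      using rn[of "n - 1"] n2 RM.L_n[OF nn u] by (simp add: H_def C_def del: funpow.simps)
    moreover have "F (n - 1) = tn u (RN.L (RN.dp (n - 1) w))"
      using n2 RM.L_n[OF nn u] by (simp add: F_def del: funpow.simps)
    moreover have "H 0 = tn (RM.L (RM.dp (n - 1) u)) (RN.K w)" by (simp add: H_def C_def)
    moreover have "B 0 = tn (RM.K (RM.dp (n - 1) u)) (RN.K w)" by (simp add: B_def)
    moreover have "scl (inverse (qfact \<rho> (n - 1))) (Ey (tn u w)) =
        tn (scl \<rho> (RM.K (RM.dp (n - 1) u)) - RM.L (RM.dp (n - 1) u)) (RN.K w)
        + tn u (scl \<rho> (RN.K (RN.dp (n - 1) w)) - RN.L (RN.dp (n - 1) w))"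
      unfolding Ey_tn[OF u w] fs.scale_right_distrib tens_scale_left[of d e _ "RM.Yop u" "RN.K w", symmetric]
        tens_scale_right[of d e u _ "RN.Yop w", symmetric] RM.Yop_eq[OF u] RN.Yop_eq[OF w] ..
    moreover have "(\<Sum>p<n. F p) = (\<Sum>p<n - 1. F p) + F (n - 1)"
      using n2 sum.lessThan_Suc[of F "n - 1"] by simp
    moreover have "(\<Sum>p<n. scl \<rho> (B p)) = scl \<rho> (B 0) + (\<Sum>p\<in>{1..<n}. scl \<rho> (B p))"
      using n2 sum.atLeast_Suc_lessThan[of 0 n "\<lambda>p. scl \<rho> (B p)"] by (simp add: lessThan_atLeast0)
    ultimately show ?thesis by (simp add: tn_lin)
  qed
  have D3: "(\<Sum>p<n. scl \<rho> (B p)) - (\<Sum>p<n. F p) = scl (inverse (qfact \<rho> (n - 1))) (scl \<rho> (act T (Grp a) ((act T GenXi ^^ (n - 1)) (tn u w))) -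
      act T (Chr \<chi>) ((act T GenXi ^^ (n - 1)) (tn u w)))"
  proof -
    have q: "qfact \<rho> (n - 1) \<noteq> 0" using n2 by (intro qfact_nz) simp
    have I: "{..n - 1} = {..<n}" and nl: "n - 1 < n" using n2 by auto
    have "act T (Grp a) ((act T GenXi ^^ (n - 1)) (tn u w)) = scl (qfact \<rho> (n - 1)) (\<Sum>p<n. B p)"
      unfolding T_Xi_pow_divided[OF u w nl] T_lin module_hom.sum[OF mh_act[OF mh_id]] I B_def
      by (intro arg_cong[of _ _ "scl _"] sum.cong refl) (simp add: T_gg a_G cl u w RM.gg_Lp)
    moreover have "act T (Chr \<chi>) ((act T GenXi ^^ (n - 1)) (tn u w)) = scl (qfact \<rho> (n - 1)) (\<Sum>p<n. F p)"
      unfolding T_Xi_pow_divided[OF u w nl] T_lin module_hom.sum[OF mh_act[OF mh_id]] I F_def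
      by (intro arg_cong[of _ _ "scl _"] sum.cong refl) (simp add: T_L cl u w)
    ultimately show ?thesis
      using q by (simp add: fs.scale_right_diff_distrib fs.scale_sum_right mult.left_commute[of _ \<rho>])
  qed
  show "act T GenX (Th (tn u w)) - Th (act T GenX (tn u w)) + scl (inverse (qfact \<rho> (n - 1))) (Ey (tn u w)) =
    scl (inverse (qfact \<rho> (n - 1))) (scl \<rho> (act T (Grp a) ((act T GenXi ^^ (n - 1)) (tn u w))) -
      act T (Chr \<chi>) ((act T GenXi ^^ (n - 1)) (tn u w)))"
    unfolding D1 D2 by (rule D3)
qed (auto intro!: mh_intros mh_Ey mh_Th)

subsection \<open>The remaining relations\<close>

lemma T_Xip_V: "v \<in> coords (d * e) \<Longrightarrow> (act T GenXi ^^ m) v \<in> coords (d * e)"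
  by (induction m) (auto simp: V_T)

lemma Th_Xip: "v \<in> coords (d * e) \<Longrightarrow> Th ((act T GenXi ^^ m) v) = (act T GenXi ^^ m) (Th v)"
  by (induction m) (simp_all add: T_Xi_Th[symmetric] T_Xip_V)

text \<open>\<open>1 + c \<Theta>\<close> is multiplicative because \<open>\<Theta>\<^sup>2 = 0\<close>, and \<open>corr_mult\<close> accounts for moving \<open>\<Theta>\<close> past \<open>\<delta> \<otimes> \<delta>\<close>.\<close>

lemma T_cc_mult: "v \<in> coords (d * e) \<Longrightarrow> \<gamma> \<in> carrier \<Gamma> \<Longrightarrow> \<delta> \<in> carrier \<Gamma> \<Longrightarrow>
    act T (Chr \<gamma>) (act T (Chr \<delta>) v) = act T (Chr (\<gamma> \<otimes>\<^bsub>\<Gamma>\<^esub> \<delta>)) v"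
proof -
  assume v: "v \<in> coords (d * e)" and g: "\<gamma> \<in> carrier \<Gamma>" "\<delta> \<in> carrier \<Gamma>"
  have V: "v + scl (corr \<delta>) (Th v) \<in> coords (d * e)" by (intro V_rules v Th_closed)
  have "act T (Chr \<gamma>) (act T (Chr \<delta>) v) = cc2 \<gamma> (cc2 \<delta> (v + scl (corr \<delta>) (Th v))
      + scl (corr \<gamma>) (Th (cc2 \<delta> (v + scl (corr \<delta>) (Th v)))))"
    by (simp add: T_cc v g cc2_closed)
  also have "Th (cc2 \<delta> (v + scl (corr \<delta>) (Th v))) = cc2 \<delta> (scl (\<delta> a ^ n) (Th v))"
    unfolding Th_cc2[OF g(2) V] Th_lin Th_Th[OF v] by (simp add: cc2_lin)
  also have "cc2 \<delta> (v + scl (corr \<delta>) (Th v)) + scl (corr \<gamma>) (cc2 \<delta> (scl (\<delta> a ^ n) (Th v)))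
      = cc2 \<delta> (v + scl (corr (\<gamma> \<otimes>\<^bsub>\<Gamma>\<^esub> \<delta>)) (Th v))"
    by (simp add: corr_mult cc2_lin fs.scale_left_distrib)
  also have "cc2 \<gamma> \<dots> = act T (Chr (\<gamma> \<otimes>\<^bsub>\<Gamma>\<^esub> \<delta>)) v"
    using g by (simp add: cc2_mult V_rules v Th_closed T_cc)
  finally show ?thesis .
qed

lemma T_X_cc: "v \<in> coords (d * e) \<Longrightarrow> \<gamma> \<in> carrier \<Gamma> \<Longrightarrow>
    scl (\<gamma> a) (act T GenX (act T (Chr \<gamma>) v)) = act T (Chr \<gamma>) (act T GenX v) +
      scl (corr \<gamma> / qfact \<rho> (n - 1)) (act T (Chr \<gamma>) (scl \<rho> (act T (Grp a) ((act T GenXi ^^ (n - 1)) v))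
        - act T (Chr \<chi>) ((act T GenXi ^^ (n - 1)) v)))"
proof -
  assume v: "v \<in> coords (d * e)" and g: "\<gamma> \<in> carrier \<Gamma>"
  let ?Y = "scl \<rho> (act T (Grp a) ((act T GenXi ^^ (n - 1)) v)) - act T (Chr \<chi>) ((act T GenXi ^^ (n - 1)) v)"
  let ?c = "corr \<gamma>" and ?q = "inverse (qfact \<rho> (n - 1))"
  have V: "v + scl ?c (Th v) \<in> coords (d * e)" "?Y \<in> coords (d * e)"
    by (intro V_rules v Th_closed V_T)+
  have l: "scl (\<gamma> a) (act T GenX (act T (Chr \<gamma>) v)) =
      cc2 \<gamma> (act T GenX v + scl ?c (act T GenX (Th v)) + scl (?c * ?q) (Ey v))"
    unfolding T_cc[OF v g] X_cc2[OF g V(1)]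
    by (simp add: T_lin Ey_lin Ey_Th v divide_inverse)
  show ?thesis
  proof (cases "nilpotent_type D")
    case True
    then show ?thesis unfolding l by (simp add: corr_def T_cc V_T g)
  next
    case False
    have yV: "(act T GenXi ^^ (n - 1)) v \<in> coords (d * e)" by (rule T_Xip_V[OF v])
    have "Th ?Y = 0"
      unfolding Th_lin T_gg_Th[OF False a_G yV] T_L_cc2[OF yV] Th_cc2[OF chi_Gam yV] Th_Xip[OF v] T_Xip_Th[OF v]
      by (simp add: T_lin cc2_lin)
    then have "act T (Chr \<gamma>) ?Y = cc2 \<gamma> ?Y"
      unfolding T_cc[OF V(2) g] by (simp only: fs.scale_zero_right add_0_right)
    moreover have "scl (?c * ?q) ?Y = scl ?c (act T GenX (Th v) - Th (act T GenX v) + scl ?q (Ey v))"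
      unfolding X_Th[OF False v] by (simp only: fs.scale_scale)
    ultimately have "act T (Chr \<gamma>) (act T GenX v) + scl (?c / qfact \<rho> (n - 1)) (act T (Chr \<gamma>) ?Y)
        = cc2 \<gamma> (act T GenX v + scl ?c (Th (act T GenX v)) + scl ?c (act T GenX (Th v) - Th (act T GenX v) + scl ?q (Ey v)))"
      by (simp only: divide_inverse T_cc[OF V_T(3) g] cc2_lin(1,2)[symmetric])
    then show ?thesis unfolding l by (simp add: fs.scale_right_distrib fs.scale_right_diff_distrib add.assoc)
  qed
qed

theorem tensor_dmod: "is_dmod D T"
  unfolding is_dmod_iff
proof (intro conjI ballI)
  show "mact T s \<in> carrier_mat (mdim T) (mdim T)" if "s \<in> dd_gens D" for s
    using T_carrier[OF that] by simp
next
  fix v :: "nat \<Rightarrow> 'k" assume "v \<in> coords (mdim T)"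
  then have v: "v \<in> coords (d * e)" by simp
  show "rel_vec scl (act T) v"
    unfolding rel_vec_def
  proof (intro conjI ballI)
    show "act T (Grp \<one>\<^bsub>G\<^esub>) v = v"
      using v by (rule tens_ext[where d = d and e = e, rotated -1])
        (auto intro!: mh_intros simp: T_gg RM.gg_one RN.gg_one)
    show "act T (Chr \<one>\<^bsub>\<Gamma>\<^esub>) v = v" using v by (simp add: T_cc corr_one cc2_one)
  next
    fix g h assume g: "g \<in> carrier G" "h \<in> carrier G"
    show "act T (Grp g) (act T (Grp h) v) = act T (Grp (g \<otimes>\<^bsub>G\<^esub> h)) v"
      using v by (rule tens_ext[where d = d and e = e, rotated -1])
        (auto intro!: mh_intros simp: T_gg g cl RM.gg_mult RN.gg_mult)
  next
    fix g assume g: "g \<in> carrier G"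
    show "act T GenX (act T (Grp g) v) = scl (\<chi> g) (act T (Grp g) (act T GenX v))"
      using v by (rule tens_ext[where d = d and e = e, rotated -1])
        (auto intro!: mh_intros simp: T_gg T_X g cl RM.X_gg RN.X_gg RN.gg_mult a_G G.m_comm T_lin tn_lin fs.scale_right_distrib)
    show "act T GenXi (act T (Grp g) v) = scl (inverse (\<chi> g)) (act T (Grp g) (act T GenXi v))"
      using v by (rule tens_ext[where d = d and e = e, rotated -1])
        (auto intro!: mh_intros simp: T_gg T_Xi g cl RM.Xi_gg RN.Xi_gg RM.gg_cc[OF _ _ chi_Gam] T_lin tn_lin fs.scale_right_distrib)
  next
    fix \<gamma> assume g: "\<gamma> \<in> carrier \<Gamma>"
    show "act T GenXi (act T (Chr \<gamma>) v) = scl (\<gamma> a) (act T (Chr \<gamma>) (act T GenXi v))"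
      using v g by (simp add: T_cc cc2_Xi V_rules Th_closed V_T T_lin T_Xi_Th)
  next
    fix g \<gamma> assume g: "g \<in> carrier G" "\<gamma> \<in> carrier \<Gamma>"
    have "scl (corr \<gamma>) (Th (act T (Grp g) v)) = scl (corr \<gamma>) (act T (Grp g) (Th v))"
      using T_gg_Th[OF _ g(1) v] by (cases "nilpotent_type D") (simp_all add: corr_def)
    then show "act T (Grp g) (act T (Chr \<gamma>) v) = act T (Chr \<gamma>) (act T (Grp g) v)"
      using v g by (auto simp add: T_cc cc2_gg V_rules Th_closed T_closed grp_gens T_lin)
  next
    show "act T GenX (act T GenXi v) - act T GenXi (act T GenX v) = act T (Grp a) v - act T (Chr \<chi>) v"
    proof (rule tens_ext[where d = d and e = e and f = "\<lambda>v. act T GenX (act T GenXi v) - act T GenXi (act T GenX v)"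
          and g = "\<lambda>v. act T (Grp a) v - act T (Chr \<chi>) v"])
      fix u w :: "nat \<Rightarrow> 'k" assume u: "u \<in> coords d" and w: "w \<in> coords e"
      have 1: "RM.X (RM.Xi u) = RM.Xi (RM.X u) + RM.K u - RM.L u"
        using RM.X_Xi[OF u] by (simp add: algebra_simps)
      have 2: "RN.X (RN.Xi w) = RN.Xi (RN.X w) + RN.K w - RN.L w"
        using RN.X_Xi[OF w] by (simp add: algebra_simps)
      show "act T GenX (act T GenXi (tn u w)) - act T GenXi (act T GenX (tn u w)) = act T (Grp a) (tn u w) - act T (Chr \<chi>) (tn u w)"
        using rho_nz by (simp add: T_X T_Xi T_gg T_L a_G u w cl T_lin 1 2 tn_lin RM.L_X RN.K_Xi)
    qed (auto intro!: mh_intros v)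
  qed (use T_Xi_n T_X_n T_cc_mult T_X_cc v in auto)
qed

end

section \<open>Homomorphisms\<close>

text \<open>Left multiplication by \<open>h\<close> permutes the terms of the average.\<close>

lemma average_eigenvector:
  fixes sc :: "'k::field \<Rightarrow> 'v \<Rightarrow> 'v::ab_group_add"
  assumes K: "group K" "h \<in> carrier K" and R: "module_hom sc sc (R h)"
    and act: "\<And>g. g \<in> carrier K \<Longrightarrow> R h (R g v) = R (h \<otimes>\<^bsub>K\<^esub> g) v"
    and c: "\<And>g. g \<in> carrier K \<Longrightarrow> c (h \<otimes>\<^bsub>K\<^esub> g) = c h * c g" "c h \<noteq> 0"
  shows "R h (\<Sum>g\<in>carrier K. sc (inverse (c g)) (R g v)) = sc (c h) (\<Sum>g\<in>carrier K. sc (inverse (c g)) (R g v))"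
proof -
  interpret group K by fact
  interpret module_hom sc sc "R h" by fact
  have bij: "bij_betw (\<lambda>g. h \<otimes>\<^bsub>K\<^esub> g) (carrier K) (carrier K)"
    using K(2) inj_on_cmult[OF K(2)] surj_const_mult[OF K(2)] by (simp add: bij_betw_def)
  have "R h (\<Sum>g\<in>carrier K. sc (inverse (c g)) (R g v)) = (\<Sum>g\<in>carrier K. sc (inverse (c g)) (R (h \<otimes>\<^bsub>K\<^esub> g) v))"
    by (simp add: sum scale act)
  also have "\<dots> = (\<Sum>g\<in>carrier K. sc (c h * inverse (c (h \<otimes>\<^bsub>K\<^esub> g))) (R (h \<otimes>\<^bsub>K\<^esub> g) v))"
    by (rule sum.cong) (auto simp: c simp flip: mult.assoc)
  also have "\<dots> = (\<Sum>g\<in>carrier K. sc (c h * inverse (c g)) (R g v))"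
    by (rule sum.reindex_bij_betw[OF bij])
  finally show ?thesis by (simp add: m1.scale_sum_right)
qed

context dd
begin

lemma mod_hom_carrier: "f \<in> mod_hom D M N \<Longrightarrow> f \<in> carrier_mat (mdim N) (mdim M)"
  by (simp add: mod_hom_def)

lemma mod_hom_closed: "f \<in> mod_hom D M N \<Longrightarrow> mop f v \<in> coords (mdim N)"
  using mod_hom_carrier mop_closed by blast

lemma mod_hom_act:
  assumes "f \<in> mod_hom D M N" "s \<in> dd_gens D"
    "mact M s \<in> carrier_mat (mdim M) (mdim M)" "mact N s \<in> carrier_mat (mdim N) (mdim N)"
  shows "mop f (act M s v) = act N s (mop f v)"
  using assms mop_mult[OF mod_hom_carrier[OF assms(1)] assms(3), of v]
    mop_mult[OF assms(4) mod_hom_carrier[OF assms(1)], of v]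
  by (simp add: mod_hom_def act_def)

lemma dmod_carrier: "is_dmod D M \<Longrightarrow> s \<in> dd_gens D \<Longrightarrow> mact M s \<in> carrier_mat (mdim M) (mdim M)"
  by (simp add: is_dmod_def)

lemma dmod_hom_act: "f \<in> mod_hom D M N \<Longrightarrow> s \<in> dd_gens D \<Longrightarrow> is_dmod D M \<Longrightarrow> is_dmod D N \<Longrightarrow>
    mop f (act M s v) = act N s (mop f v)"
  by (simp add: mod_hom_act dmod_carrier)

lemmas mop_lin = module_hom.add[OF module_hom_mop] module_hom.scale[OF module_hom_mop]
  module_hom.zero[OF module_hom_mop] module_hom.diff[OF module_hom_mop] module_hom.sum[OF module_hom_mop]

lemma mod_homE:
  assumes "\<And>s. s \<in> dd_gens D \<Longrightarrow> mact M s \<in> carrier_mat (mdim M) (mdim M)"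
    and "\<And>s. s \<in> dd_gens D \<Longrightarrow> mact N s \<in> carrier_mat (mdim N) (mdim N)"
    and add: "\<And>u v. u \<in> coords (mdim M) \<Longrightarrow> v \<in> coords (mdim M) \<Longrightarrow> F (u + v) = F u + F v"
    and scale: "\<And>c u. u \<in> coords (mdim M) \<Longrightarrow> F (scl c u) = scl c (F u)"
    and closed: "\<And>u. u \<in> coords (mdim M) \<Longrightarrow> F u \<in> coords (mdim N)"
    and act: "\<And>s u. s \<in> dd_gens D \<Longrightarrow> u \<in> coords (mdim M) \<Longrightarrow> F (act M s u) = act N s (F u)"
  obtains f where "f \<in> mod_hom D M N" "\<And>u. u \<in> coords (mdim M) \<Longrightarrow> mop f u = F u"
proof
  let ?f = "mat_of (mdim N) (mdim M) F"
  show eq: "mop ?f u = F u" if "u \<in> coords (mdim M)" for u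
    by (rule mop_mat_of[OF add scale closed that])
  have "?f * mact M s = mact N s * ?f" if s: "s \<in> dd_gens D" for s
  proof (rule mat_eq_of_mop[of _ "mdim N" "mdim M"])
    fix v :: "nat \<Rightarrow> 'k" assume v: "v \<in> coords (mdim M)"
    have "mop (mact M s) v \<in> coords (mdim M)" by (rule mop_closed[OF assms(1)[OF s]])
    then show "mop (?f * mact M s) v = mop (mact N s * ?f) v"
      using act[OF s v] by (simp add: mop_mult[OF mat_of_carrier assms(1)[OF s]]
          mop_mult[OF assms(2)[OF s] mat_of_carrier] eq v act_def)
  qed (rule mult_carrier_mat[OF mat_of_carrier assms(1)[OF s]] mult_carrier_mat[OF assms(2)[OF s] mat_of_carrier])+
  then show "?f \<in> mod_hom D M N" by (simp add: mod_hom_def)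
qed

abbreviation wtv :: "('g, 'k) dmod \<Rightarrow> ('g \<times> ('g \<Rightarrow> 'k) \<Rightarrow> 'k) \<Rightarrow> (nat \<Rightarrow> 'k) \<Rightarrow> bool" where
  "wtv N \<equiv> dd_rep.wt D scl (coords (mdim N)) (act N)"

lemma wtv_iff: "is_dmod D N \<Longrightarrow> wtv N \<psi> v \<longleftrightarrow> v \<in> coords (mdim N) \<and>
    (\<forall>g\<in>carrier G. act N (Grp g) v = scl (\<psi> (g, \<one>\<^bsub>\<Gamma>\<^esub>)) v) \<and>
    (\<forall>\<gamma>\<in>carrier \<Gamma>. act N (Chr \<gamma>) v = scl (\<psi> (\<one>\<^bsub>G\<^esub>, \<gamma>)) v)"
  by (rule dd_rep.wt_def[OF dd_rep_act])

lemma hom_wtv: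
  assumes "is_dmod D M" "is_dmod D N" "f \<in> mod_hom D M N" "wtv M \<psi> v"
  shows "wtv N \<psi> (mop f v)"
  using assms(4) unfolding wtv_iff[OF assms(1)] wtv_iff[OF assms(2)]
  by (auto simp: mod_hom_closed[OF assms(3)] mop_lin grp_gens chr_gens
      dmod_hom_act[OF assms(3) _ assms(1,2), symmetric])

text \<open>Averaging over the finite groups \<open>G\<close> and \<open>\<Gamma>\<close> projects a preimage to the weight space.\<close>

lemma weight_lift:
  assumes M: "is_dmod D M" and N: "is_dmod D N" and f: "f \<in> mod_hom D M N" "surj_mat f"
    and \<psi>: "\<psi> \<in> carrier \<Lambda>" and w: "wtv N \<psi> w"
  obtains m where "wtv M \<psi> m" "mop f m = w"
proof -
  interpret RM: dd_rep D scl "coords (mdim M)" "act M" by (rule dd_rep_act[OF M])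
  have w': "w \<in> coords (mdim N)" "\<And>g. g \<in> carrier G \<Longrightarrow> act N (Grp g) w = scl (\<psi> (g, \<one>\<^bsub>\<Gamma>\<^esub>)) w"
    "\<And>\<gamma>. \<gamma> \<in> carrier \<Gamma> \<Longrightarrow> act N (Chr \<gamma>) w = scl (\<psi> (\<one>\<^bsub>G\<^esub>, \<gamma>)) w"
    using w unfolding wtv_iff[OF N] by auto
  obtain m0 where m0: "m0 \<in> coords (mdim M)" "mop f m0 = w"
    using f(2) w'(1) unfolding surj_mat_iff[OF mod_hom_carrier[OF f(1)]] by blast
  have int: "mop f (act M s v) = act N s (mop f v)" if "s \<in> dd_gens D" for s v
    by (rule dmod_hom_act[OF f(1) that M N])
  define m1 where "m1 = (\<Sum>g\<in>carrier G. scl (inverse (\<psi> (g, \<one>\<^bsub>\<Gamma>\<^esub>))) (act M (Grp g) m0))"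
  have m1W: "m1 \<in> coords (mdim M)"
    unfolding m1_def by (intro fs.subspace_sum[OF subspace_coords] RM.W_rules RM.gg_W m0)
  have m1g: "act M (Grp h) m1 = scl (\<psi> (h, \<one>\<^bsub>\<Gamma>\<^esub>)) m1" if h: "h \<in> carrier G" for h
    unfolding m1_def
    by (rule average_eigenvector[where R = "\<lambda>g. act M (Grp g)" and c = "\<lambda>g. \<psi> (g, \<one>\<^bsub>\<Gamma>\<^esub>)", OF G_group h RM.lin])
      (use h m0 \<psi> in \<open>auto simp: RM.gg_mult Lam_hom_G Lam_nz\<close>)
  have f1: "mop f m1 = scl (of_nat (card (carrier G))) w"
  proof -
    have "mop f m1 = (\<Sum>g\<in>carrier G. scl (inverse (\<psi> (g, \<one>\<^bsub>\<Gamma>\<^esub>))) (scl (\<psi> (g, \<one>\<^bsub>\<Gamma>\<^esub>)) w))"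
      unfolding m1_def mop_lin by (rule sum.cong) (simp_all add: int grp_gens m0 w')
    also have "\<dots> = (\<Sum>g\<in>carrier G. w)"
      by (rule sum.cong) (simp_all add: Lam_nz \<psi>)
    finally show ?thesis by (simp add: fun_eq_iff pointwise)
  qed
  define m2 where "m2 = (\<Sum>\<gamma>\<in>carrier \<Gamma>. scl (inverse (\<psi> (\<one>\<^bsub>G\<^esub>, \<gamma>))) (act M (Chr \<gamma>) m1))"
  have m2W: "m2 \<in> coords (mdim M)"
    unfolding m2_def by (intro fs.subspace_sum[OF subspace_coords] RM.W_rules RM.cc_W m1W)
  have m2c: "act M (Chr h) m2 = scl (\<psi> (\<one>\<^bsub>G\<^esub>, h)) m2" if h: "h \<in> carrier \<Gamma>" for h
    unfolding m2_def
    by (rule average_eigenvector[where R = "\<lambda>g. act M (Chr g)" and c = "\<lambda>g. \<psi> (\<one>\<^bsub>G\<^esub>, g)", OF Gam.is_group h RM.lin])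
      (use h m1W \<psi> in \<open>auto simp: RM.cc_mult Lam_hom_Gam Lam_nz\<close>)
  have m2g: "act M (Grp h) m2 = scl (\<psi> (h, \<one>\<^bsub>\<Gamma>\<^esub>)) m2" if h: "h \<in> carrier G" for h
    unfolding m2_def RM.A_sum fs.scale_sum_right
    by (rule sum.cong) (simp_all add: RM.A_lin RM.gg_cc m1W h m1g mult.commute)
  have f2: "mop f m2 = scl (of_nat (card (carrier \<Gamma>)) * of_nat (card (carrier G))) w"
  proof -
    have "mop f m2 = (\<Sum>g\<in>carrier \<Gamma>. scl (inverse (\<psi> (\<one>\<^bsub>G\<^esub>, g))) (scl (of_nat (card (carrier G))) (scl (\<psi> (\<one>\<^bsub>G\<^esub>, g)) w)))"
      unfolding m2_def mop_lin
      by (rule sum.cong) (simp_all add: int chr_gens f1 w' module_hom.scale[OF mh_act[OF mh_id]])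
    also have "\<dots> = (\<Sum>g\<in>carrier \<Gamma>. scl (of_nat (card (carrier G))) w)"
      by (rule sum.cong) (simp_all add: Lam_nz \<psi>)
    finally show ?thesis by (simp add: fun_eq_iff pointwise)
  qed
  let ?c = "inverse (of_nat (card (carrier \<Gamma>)) * of_nat (card (carrier G))) :: 'k"
  have nz: "card (carrier \<Gamma>) \<noteq> 0" "card (carrier G) \<noteq> 0"
    using Gam_finite G_finite Gam.one_closed G.one_closed by (auto simp del: Gam.one_closed G.one_closed)
  show thesis
  proof (rule that)
    show "wtv M \<psi> (scl ?c m2)"
      unfolding wtv_iff[OF M] by (simp add: RM.W_rules m2W RM.A_lin m2c m2g mult.commute)
    show "mop f (scl ?c m2) = w"
      using nz left_inverse[of "of_nat (card (carrier \<Gamma>)) * of_nat (card (carrier G)) :: 'k"]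
      unfolding mop_lin f2 fs.scale_scale by simp
  qed
qed

section \<open>The modules \<open>V(n, \<mu>)\<close> as Verma modules\<close>

lemma simple_unit_gg: "g \<in> carrier G \<Longrightarrow> j < l \<Longrightarrow>
    act (simple_mod D l \<mu>) (Grp g) (unit_seq j) = scl (inverse (\<chi> g) ^ j * \<mu> (g, \<one>\<^bsub>\<Gamma>\<^esub>)) (unit_seq j)"
  by (auto simp: simple_gg unit_seq_def fun_eq_iff pointwise)

lemma simple_unit_cc: "\<gamma> \<in> carrier \<Gamma> \<Longrightarrow> j < l \<Longrightarrow>
    act (simple_mod D l \<mu>) (Chr \<gamma>) (unit_seq j) = scl (\<gamma> a ^ j * \<mu> (\<one>\<^bsub>G\<^esub>, \<gamma>)) (unit_seq j)"
  by (auto simp: simple_cc unit_seq_def fun_eq_iff pointwise)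

lemma simple_unit_X: "Suc j < l \<Longrightarrow> act (simple_mod D l \<mu>) GenX (unit_seq j) = unit_seq (Suc j)"
  by (auto simp: simple_X unit_seq_def fun_eq_iff)

lemma simple_unit_Xp: "j < l \<Longrightarrow> (act (simple_mod D l \<mu>) GenX ^^ j) (unit_seq 0) = unit_seq j"
  by (induction j) (auto simp: simple_unit_X)

lemma simple_unit_Xi: "j < l \<Longrightarrow> act (simple_mod D l \<mu>) GenXi (unit_seq j) =
    (if j = 0 then 0 else scl (alpha_coeff D \<mu> j) (unit_seq (j - 1)))"
  by (auto simp: simple_Xi unit_seq_def fun_eq_iff pointwise)

lemma simple_unit_Xip: "j < l \<Longrightarrow> (act (simple_mod D l \<mu>) GenXi ^^ j) (unit_seq j) =
    scl (\<Prod>k<j. alpha_coeff D \<mu> (Suc k)) (unit_seq 0)"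
  by (subst simple_Xi_pow, simp)
    (auto simp: unit_seq_def[of j] unit_seq_def[of 0] fun_eq_iff pointwise)

lemma simple_unit_wtv:
  assumes "is_dmod D (simple_mod D l \<mu>)" "j < l"
  shows "wtv (simple_mod D l \<mu>) (phi_shift D j \<mu>) (unit_seq j)"
  unfolding wtv_iff[OF assms(1)] using assms(2)
  by (simp add: simple_unit_gg simple_unit_cc phi_shift_apply char_one[OF chi_Gam] Gam_one_apply a_G)

end

context dd_rep
begin

text \<open>A highest weight vector cannot be raised more often than it has been lowered.\<close>

lemma Xip_Xp_zero:
  assumes "eig \<kappa> \<theta> z" "Xi z = 0"
  shows "i < k \<Longrightarrow> (Xi ^^ k) ((X ^^ i) z) = 0"
proof (induction k arbitrary: i)
  case (Suc k)
  have *: "Xi ((X ^^ i) z) = acoef \<kappa> \<theta> i \<odot> (X ^^ (i - 1)) z"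
    using Xi_Xp[OF assms(1), of i] assms(2) by (simp add: Ap_zero)
  have "(Xi ^^ Suc k) ((X ^^ i) z) = acoef \<kappa> \<theta> i \<odot> (Xi ^^ k) ((X ^^ (i - 1)) z)"
    by (simp add: funpow_swap1 * Ap_scale del: funpow.simps) (simp add: funpow_swap1 * Ap_scale)
  also have "\<dots> = 0" using Suc by (cases i) auto
  finally show ?case .
qed simp

lemma highest_Xp_cc:
  assumes z: "wt \<mu> z" "Xi z = 0" and \<gamma>: "\<gamma> \<in> carrier \<Gamma>"
  shows "i < n \<Longrightarrow> cc \<gamma> ((X ^^ i) z) = (\<gamma> a ^ i * \<mu> (\<one>\<^bsub>G\<^esub>, \<gamma>)) \<odot> (X ^^ i) z"
proof (induction i)
  case 0
  then show ?case using z \<gamma> by (simp add: wt_def)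
next
  case (Suc i)
  have "(Xi ^^ (n - 1)) ((X ^^ i) z) = 0"
    by (rule Xip_Xp_zero[OF wt_eig[OF z(1)] z(2)]) (use Suc.prems in simp)
  then show ?case
    using Suc cc_X[OF Xp_W[of z i] \<gamma>] z(1) by (simp add: wt_def A_lin mult_ac)
qed

end

context dd
begin

text \<open>A vector of weight \<open>\<mu>\<close> killed by \<open>\<xi>\<close> satisfies all relations that hold for \<open>v\<^sub>0\<close>: the action on \<open>x\<^sup>i z\<close> is determined by
the commutation rules and by \<open>x\<^sup>n\<close>, as in \<open>V(n, \<mu>)\<close>.\<close>

lemma verma_hom:
  assumes \<mu>: "\<mu> \<in> carrier \<Lambda>" and N: "is_dmod D N" and z: "wtv N \<mu> z" "act N GenXi z = 0"
  obtains f where "f \<in> mod_hom D (simple_mod D n \<mu>) N"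
    "\<And>i. i < n \<Longrightarrow> mop f (unit_seq i) = (act N GenX ^^ i) z"
proof -
  interpret R: dd_rep D scl "coords (mdim N)" "act N" by (rule dd_rep_act[OF N])
  let ?S = "simple_mod D n \<mu>"
  define F where "F v = (\<Sum>i<n. scl (v i) ((R.X ^^ i) z))" for v
  have zW: "z \<in> coords (mdim N)" using z(1) by (simp add: R.wt_def)
  have e: "R.eig (\<mu> (a, \<one>\<^bsub>\<Gamma>\<^esub>)) (\<mu> (\<one>\<^bsub>G\<^esub>, \<chi>)) z" by (rule R.wt_eig[OF z(1)])
  obtain m where m: "n = Suc m" using n2 by (cases n) auto
  have Xn: "(R.X ^^ n) z = scl (wrap n \<mu>) z"
  proof -
    have K: "act N (Grp (a [^]\<^bsub>G\<^esub> j)) z = scl (\<mu> (a, \<one>\<^bsub>\<Gamma>\<^esub>) ^ j) z" for j :: nat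
      using R.Kp_eq[OF zW, of j, symmetric] e
      by (induction j) (auto simp: R.eig_def R.A_lin mult.commute simp flip: R.Kp_eq[OF zW])
    show ?thesis
    proof (cases "nilpotent_type D")
      case True
      then show ?thesis using R.X_n[OF zW] R.gg_one[OF zW]
        by (auto simp: nilpotent_type_def wrap_def)
    next
      case False
      then show ?thesis using R.X_n[OF zW] K[of n] by (simp add: wrap_def alp_1 fs.scale_left_diff_distrib)
    qed
  qed
  have Xi: "R.Xi ((R.X ^^ i) z) = scl (alpha_coeff D \<mu> i) ((R.X ^^ (i - 1)) z)" for i
    using R.Xi_Xp[OF e, of i] z(2) by (simp add: R.Ap_zero alpha_coeff_eq)
  have act: "F (act ?S s u) = act N s (F u)" if s: "s \<in> dd_gens D" and u: "u \<in> coords n" for s u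
  proof (cases s)
    case (Grp g)
    then have g: "g \<in> carrier G" using s by (auto simp: dd_gens_def)
    have "act N (Grp g) ((R.X ^^ i) z) = scl (inverse (\<chi> g) ^ i * \<mu> (g, \<one>\<^bsub>\<Gamma>\<^esub>)) ((R.X ^^ i) z)" for i
      using R.gg_Xp[OF g zW] z(1) g by (simp add: R.wt_def R.Ap_scale)
    then show ?thesis
      unfolding Grp F_def R.A_sum by (intro sum.cong refl) (simp add: simple_gg g R.A_lin mult.commute)
  next
    case (Chr \<gamma>)
    then have g: "\<gamma> \<in> carrier \<Gamma>" using s by (auto simp: dd_gens_def)
    show ?thesis
      unfolding Chr F_def R.A_sum
      by (intro sum.cong refl) (simp add: simple_cc g R.A_lin R.highest_Xp_cc[OF z g] mult.commute)
  next
    case GenX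
    have "F (act ?S GenX u) = scl (wrap n \<mu> * u m) z + (\<Sum>i<m. scl (u i) ((R.X ^^ Suc i) z))"
      unfolding F_def m sum.lessThan_Suc_shift by (simp add: simple_X)
    also have "\<dots> = act N GenX (F u)"
      using Xn unfolding F_def R.A_sum m by (simp add: R.A_lin mult.commute)
    finally show ?thesis using GenX by simp
  next
    case GenXi
    have "F (act ?S GenXi u) = (\<Sum>i<m. scl (alpha_coeff D \<mu> (Suc i) * u (Suc i)) ((R.X ^^ i) z))"
      unfolding F_def m by (simp add: simple_Xi)
    also have "\<dots> = act N GenXi (F u)"
      unfolding F_def R.A_sum m sum.lessThan_Suc_shift
      by (simp add: R.A_lin R.A_sum Xi z(2) mult.commute del: funpow.simps)
    finally show ?thesis using GenXi by simp
  qed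
  obtain f where f: "f \<in> mod_hom D ?S N" "\<And>u. u \<in> coords n \<Longrightarrow> mop f u = F u"
  proof (rule mod_homE[of ?S N F])
    show "F (u + v) = F u + F v" for u v
      by (simp add: F_def pointwise fs.scale_left_distrib sum.distrib)
    show "F (scl c u) = scl c (F u)" for c u
      by (simp add: F_def pointwise fs.scale_sum_right)
    show "F u \<in> coords (mdim N)" for u
      unfolding F_def by (intro fs.subspace_sum[OF subspace_coords] R.W_rules R.Xp_W zW)
  qed (use act dmod_carrier[OF N] in \<open>auto simp: simple_carrier\<close>)
  have "mop f (unit_seq i) = (R.X ^^ i) z" if i: "i < n" for i
  proof -
    have "F (unit_seq i) = (\<Sum>j<n. if j = i then (R.X ^^ i) z else 0)"
      unfolding F_def by (rule sum.cong) (auto simp: unit_seq_def)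
    then show ?thesis using f(2)[of "unit_seq i"] i by simp
  qed
  then show thesis using that f(1) by blast
qed

text \<open>\<open>\<alpha>\<^sub>i\<close> vanishes only if \<open>\<mu>(a \<chi>\<^sup>-\<^sup>1) = \<rho>\<^bsup>i-1\<^esup>\<close>, and the label sets exclude this for \<open>i < l\<close>.\<close>

lemma alpha_nonzero:
  assumes "\<mu> \<in> I_set D l" "1 \<le> i" "i < l" "l \<le> n"
  shows "alpha_coeff D \<mu> i \<noteq> 0"
proof
  have \<mu>: "\<mu> \<in> carrier \<Lambda>"
    using assms by (auto simp: I_set_def I_n_prime_def I_n_dprime_def split: if_splits)
  assume "alpha_coeff D \<mu> i = 0"
  then have "\<mu> (\<one>\<^bsub>G\<^esub>, \<chi>) = \<mu> (a, \<one>\<^bsub>\<Gamma>\<^esub>) * \<rho> powi (1 - int i)"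
    using qnum_nz[of i] assms by (simp add: alpha_coeff_def)
  also have "\<rho> powi (1 - int i) = inverse (\<rho> ^ (i - 1))"
    using assms(2) by (simp add: power_int_def nat_diff_distrib power_inverse)
  finally have "\<mu> (\<one>\<^bsub>G\<^esub>, \<chi>) * \<rho> ^ (i - 1) = at_achi D \<mu> * \<mu> (\<one>\<^bsub>G\<^esub>, \<chi>)"
    using rho_nz at_achi_eq[OF \<mu>] by simp
  then have eq: "at_achi D \<mu> = \<rho> ^ (i - 1)"
    using Lam_nz[OF \<mu> G.one_closed chi_Gam] by simp
  have i: "i - 1 < n" "i - 1 \<le> n - 1" "i - 1 \<noteq> l - 1" using assms by auto
  show False
  proof (cases "at_achi D \<mu> = \<rho> ^ (l - 1)")
    case True
    then show False using rho_inj[of "i - 1" "l - 1"] eq i assms by simp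
  next
    case False
    then have "l = n" "\<mu> \<in> I_n_prime D"
      using assms by (auto simp: I_set_def I_n_dprime_def split: if_splits)
    then show False using eq i(2) by (auto simp: I_n_prime_def)
  qed
qed

lemma I_set_Lam: "\<mu> \<in> I_set D l \<Longrightarrow> \<mu> \<in> carrier \<Lambda>"
  by (auto simp: I_set_def I_n_prime_def I_n_dprime_def split: if_splits)

text \<open>\<open>V(n, \<mu>)\<close> is generated by its highest weight vector, which up to a nonzero scalar is \<open>\<xi>\<^bsup>n-1\<^esup>\<close> applied
  to the lowest one; lifting the latter as a weight vector and applying \<open>\<xi>\<^bsup>n-1\<^esup>\<close> gives a highest weight vector.\<close>

lemma simple_n_projective:
  assumes \<mu>: "\<mu> \<in> I_set D n"
  shows "projective_dmod D (simple_mod D n \<mu>)"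
  unfolding projective_dmod_def
proof (intro conjI allI impI)
  let ?S = "simple_mod D n \<mu>"
  have \<mu>L: "\<mu> \<in> carrier \<Lambda>" by (rule I_set_Lam[OF \<mu>])
  show S: "is_dmod D ?S" by (rule simple_n_dmod[OF \<mu>L])
  fix M N f h
  assume H: "is_dmod D M \<and> is_dmod D N \<and> f \<in> mod_hom D M N \<and> surj_mat f \<and> h \<in> mod_hom D ?S N"
  then have M: "is_dmod D M" and N: "is_dmod D N" and f: "f \<in> mod_hom D M N" "surj_mat f"
    and h: "h \<in> mod_hom D ?S N" by auto
  interpret RM: dd_rep D scl "coords (mdim M)" "act M" by (rule dd_rep_act[OF M])
  interpret RN: dd_rep D scl "coords (mdim N)" "act N" by (rule dd_rep_act[OF N])
  let ?w = "mop h (unit_seq (n - 1))"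
  let ?\<psi> = "phi_shift D (n - 1) \<mu>"
  define \<beta> where "\<beta> = (\<Prod>k<n - 1. alpha_coeff D \<mu> (Suc k))"
  have \<beta>: "\<beta> \<noteq> 0" unfolding \<beta>_def using alpha_nonzero[OF \<mu>] by (subst prod_zero_iff) auto
  have nn: "n - 1 < n" using n2 by simp
  have hX: "mop h ((act ?S s ^^ i) v) = (act N s ^^ i) (mop h v)" if "s \<in> dd_gens D" for s i v
    by (induction i) (simp_all add: dmod_hom_act[OF h that S N])
  have fX: "mop f ((act M s ^^ i) v) = (act N s ^^ i) (mop f v)" if "s \<in> dd_gens D" for s i v
    by (induction i) (simp_all add: dmod_hom_act[OF f(1) that M N])
  have "wtv N ?\<psi> ?w" by (rule hom_wtv[OF S N h simple_unit_wtv[OF S nn]])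
  then obtain m where m: "wtv M ?\<psi> m" "mop f m = ?w"
    using weight_lift[OF M N f phi_shift_Lam[OF \<mu>L]] by blast
  have mW: "m \<in> coords (mdim M)" using m(1) by (simp add: RM.wt_def)
  define z where "z = scl (inverse \<beta>) ((RM.Xi ^^ (n - 1)) m)"
  have "RM.Xi ((RM.Xi ^^ (n - 1)) m) = (RM.Xi ^^ n) m" using n2 by (cases n) auto
  then have z0: "RM.Xi z = 0" using RM.Xi_n[OF mW] by (simp add: z_def RM.A_lin)
  have "wtv M \<mu> z"
    unfolding wtv_iff[OF M]
  proof (intro conjI ballI)
    show "z \<in> coords (mdim M)" by (simp add: z_def RM.W_rules RM.Xip_W mW)
    show "act M (Grp g) z = scl (\<mu> (g, \<one>\<^bsub>\<Gamma>\<^esub>)) z" if g: "g \<in> carrier G" for g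
      using g chi_nz[OF g] by (simp add: z_def RM.A_lin RM.wt_Xip_gg[OF m(1) g] phi_shift_apply Gam_one_apply a_G
          mult_ac power_inverse)
    show "act M (Chr \<gamma>) z = scl (\<mu> (\<one>\<^bsub>G\<^esub>, \<gamma>)) z" if g: "\<gamma> \<in> carrier \<Gamma>" for \<gamma>
      using g char_nz[OF g a_G] by (simp add: z_def RM.A_lin RM.wt_Xip_cc[OF m(1) g] phi_shift_apply char_one[OF chi_Gam]
          mult_ac power_inverse)
  qed
  then obtain k where k: "k \<in> mod_hom D ?S M" "\<And>i. i < n \<Longrightarrow> mop k (unit_seq i) = (RM.X ^^ i) z"
    using verma_hom[OF \<mu>L M _ z0] by blast
  have fz: "mop f z = mop h (unit_seq 0)"
    unfolding z_def mop_lin fX[OF xi_gens] m(2) hX[OF xi_gens, symmetric] simple_unit_Xip[OF nn]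
    using \<beta> by (simp add: \<beta>_def mop_lin)
  have "f * k = h"
  proof (rule mat_eq_of_mop[of _ "mdim N" n])
    show "f * k \<in> carrier_mat (mdim N) n" "h \<in> carrier_mat (mdim N) n"
      using mod_hom_carrier[OF f(1)] mod_hom_carrier[OF k(1)] mod_hom_carrier[OF h] by auto
    fix v :: "nat \<Rightarrow> 'k" assume v: "v \<in> coords n"
    have "mop (f * k) (unit_seq i) = mop h (unit_seq i)" if i: "i < n" for i
    proof -
      have "mop (f * k) (unit_seq i) = mop f (mop k (unit_seq i))"
        by (rule mop_mult[OF mod_hom_carrier[OF f(1)] mod_hom_carrier[OF k(1)]])
      also have "\<dots> = mop h ((act ?S GenX ^^ i) (unit_seq 0))"
        by (simp add: k(2) i fX[OF x_gens] fz hX[OF x_gens])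
      finally show ?thesis by (simp add: simple_unit_Xp i)
    qed
    then show "mop (f * k) v = mop h v"
      by (subst (1 2) coords_expand[OF v]) (simp add: mop_lin)
  qed
  then show "\<exists>k\<in>mod_hom D ?S M. f * k = h" using k(1) by blast
qed

lemma simple_n_cover:
  assumes \<mu>: "\<mu> \<in> I_set D n"
  shows "projective_cover D (simple_mod D n \<mu>) (simple_mod D n \<mu>)"
proof -
  let ?S = "simple_mod D n \<mu>"
  have S: "is_dmod D ?S" by (rule simple_n_dmod[OF I_set_Lam[OF \<mu>]])
  have id: "1\<^sub>m n \<in> mod_hom D ?S ?S"
    by (auto simp: mod_hom_def left_mult_one_mat[OF simple_carrier] right_mult_one_mat[OF simple_carrier])
  have "surj_mat (1\<^sub>m n :: 'k mat)"
    by (subst surj_mat_iff[of _ n n]) (auto simp: mop_one)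
  moreover have "1\<^sub>m n * h = h" if "h \<in> mod_hom D N ?S" for N h
    using mod_hom_carrier[OF that] by simp
  ultimately show ?thesis
    unfolding projective_cover_def using S id simple_n_projective[OF \<mu>] by auto
qed

end

section \<open>Polynomials without common roots\<close>

lemma bezout_mult:
  fixes Q R R' :: "'k::field poly"
  assumes "\<exists>A B. A * Q + B * R = 1" "\<exists>A B. A * Q + B * R' = 1"
  shows "\<exists>A B. A * Q + B * (R * R') = 1"
proof -
  obtain A B A' B' where "A * Q + B * R = 1" "A' * Q + B' * R' = 1" using assms by blast
  then have "(A * Q + B * R) * (A' * Q + B' * R') = 1" by simp
  then have "(A * (A' * Q + B' * R') + B * R * A') * Q + (B * B') * (R * R') = 1"
    by (simp add: algebra_simps)
  then show ?thesis by blast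
qed

text \<open>Division with remainder shows that \<open>Q\<close> is coprime to every single \<open>X - c i\<close>, and coprimality passes to products.\<close>

lemma bezout_linear_factors:
  fixes Q :: "'k::field poly"
  assumes "finite I" "\<And>i. i \<in> I \<Longrightarrow> poly Q (c i) \<noteq> 0"
  shows "\<exists>A B. A * Q + B * (\<Prod>i\<in>I. [:- c i, 1:] ^ m) = 1"
proof -
  have alg: "I * P + (- I * R) * L = I * C" if "P = C + L * R" for I P R L C :: "'k poly"
    unfolding that by (simp add: algebra_simps)
  have lin: "\<exists>A B. A * Q + B * [:- x, 1:] = 1" if "poly Q x \<noteq> 0" for x
  proof -
    have "poly (Q - [:poly Q x:]) x = 0" by simp
    then obtain R where R: "Q - [:poly Q x:] = [:- x, 1:] * R" unfolding poly_eq_0_iff_dvd by blast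
    then have "Q = [:poly Q x:] + [:- x, 1:] * R" by (simp add: algebra_simps)
    then have "[:inverse (poly Q x):] * Q + (- [:inverse (poly Q x):] * R) * [:- x, 1:]
        = [:inverse (poly Q x):] * [:poly Q x:]" by (rule alg)
    also have "\<dots> = 1" using that by (simp add: one_pCons)
    finally show ?thesis by blast
  qed
  have pow: "\<exists>A B. A * Q + B * [:- x, 1:] ^ m = 1" if "poly Q x \<noteq> 0" for x
  proof (induction m)
    case 0
    show ?case by (intro exI[of _ 0] exI[of _ 1]) simp
  next
    case (Suc m)
    show ?case unfolding power_Suc by (rule bezout_mult[OF lin[OF that] Suc])
  qed
  show ?thesis
    using assms
  proof (induction I rule: finite_induct)
    case empty
    show ?case by (intro exI[of _ 0] exI[of _ 1]) simp
  next
    case (insert i I)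
    then show ?case using bezout_mult[OF pow[of "c i"], of "\<Prod>i\<in>I. [:- c i, 1:] ^ m"] by simp
  qed
qed

section \<open>Submodules\<close>

context dd_rep
begin

lemma pact_submodule:
  assumes "vs.subspace U" "\<And>s u. s \<in> dd_gens D \<Longrightarrow> u \<in> U \<Longrightarrow> A s u \<in> U"
  shows "v \<in> U \<Longrightarrow> pact p v \<in> U"
proof -
  note sub = vs.subspace_add[OF assms(1)] vs.subspace_scale[OF assms(1)] vs.subspace_0[OF assms(1)]
  have cas: "cas u \<in> U" if "u \<in> U" for u
    unfolding cas_def
    by (intro sub assms(2) that) (auto simp: dd_gens_def a_G chi_Gam)
  assume "v \<in> U"
  then show "pact p v \<in> U" by (induction p) (auto simp: pact_pCons intro: sub cas)
qed

lemma level_minimal: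
  assumes "vs.subspace U" "z \<in> U" "\<And>u. u \<in> U \<Longrightarrow> X u \<in> U" "\<And>u. u \<in> U \<Longrightarrow> Xi u \<in> U"
  shows "level z i \<subseteq> U"
  unfolding level_def
proof (rule vs.span_minimal[OF _ assms(1)])
  have "(Xi ^^ j) z \<in> U" for j by (induction j) (auto simp: assms)
  then have "(X ^^ i) ((Xi ^^ j) z) \<in> U" for i j by (induction i) (auto simp: assms)
  then show "(\<lambda>(i, j). pbw z i j) ` ({..i} \<times> {..<n}) \<subseteq> U" by (auto simp: pbw_def)
qed

lemma pact_sum: "finite I \<Longrightarrow> pact (\<Sum>i\<in>I. p i) v = (\<Sum>i\<in>I. pact (p i) v)"
  by (induction I rule: finite_induct) (auto simp: pact_add)

end

lemma (in dd) hom_pact: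
  assumes R1: "dd_rep D sc1 W1 A1" and R2: "dd_rep D sc2 W2 A2"
    and add: "\<And>u v. u \<in> W1 \<Longrightarrow> v \<in> W1 \<Longrightarrow> f (u + v) = f u + f v"
    and scale: "\<And>c u. u \<in> W1 \<Longrightarrow> f (sc1 c u) = sc2 c (f u)"
    and act: "\<And>s u. s \<in> dd_gens D \<Longrightarrow> u \<in> W1 \<Longrightarrow> f (A1 s u) = A2 s (f u)"
    and v: "v \<in> W1"
  shows "f (dd_rep.pact D sc1 A1 p v) = dd_rep.pact D sc2 A2 p (f v)"
proof -
  interpret R1: dd_rep D sc1 W1 A1 by fact
  interpret R2: dd_rep D sc2 W2 A2 by fact
  have cas: "f (R1.cas u) = R2.cas (f u)" if "u \<in> W1" for u
    using that by (simp add: R1.cas_def R2.cas_def add scale act R1.W_rules R1.W_closed x_gens xi_gens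
        grp_gens[OF a_G] chr_gens[OF chi_Gam])
  have zero: "f 0 = 0" using scale[of v 0] v by simp
  show ?thesis
    by (induction p) (simp_all add: zero R1.pact_pCons R2.pact_pCons add scale cas v R1.W_rules R1.cas_W R1.pact_W)
qed

section \<open>The tensor product of two Verma modules\<close>

locale dd_verma_tensor = dd D for D :: "('g, 'k::field_char_0) gdatum" +
  fixes \<mu> \<mu>' :: "'g \<times> ('g \<Rightarrow> 'k) \<Rightarrow> 'k"
  assumes mu: "\<mu> \<in> I_set D n" and mu': "\<mu>' \<in> I_set D n"
begin

lemma mu_Lam: "\<mu> \<in> carrier \<Lambda>" "\<mu>' \<in> carrier \<Lambda>"
  using I_set_Lam mu mu' by auto

sublocale dd_tensor D "simple_mod D n \<mu>" "simple_mod D n \<mu>'"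
  by unfold_locales (auto intro: simple_n_dmod mu_Lam)

sublocale RT: dd_rep D scl "coords (mdim T)" "act T"
  by (rule dd_rep_act[OF tensor_dmod])

definition \<nu> :: "'g \<times> ('g \<Rightarrow> 'k) \<Rightarrow> 'k" where "\<nu> = \<mu> \<otimes>\<^bsub>\<Lambda>\<^esub> \<mu>'"

definition t :: "nat \<Rightarrow> 'k" where "t = tn (unit_seq 0) (unit_seq (n - 1))"

abbreviation "\<psi> \<equiv> phi_shift D (n - 1) \<nu>"

lemma nu_Lam: "\<nu> \<in> carrier \<Lambda>"
  unfolding \<nu>_def using mu_Lam by simp

lemma n_pos: "0 < n" "n - 1 < n"
  using n2 by auto

lemma dim_T: "mdim T = n * n"
  by simp

lemmas tn_simps = T_gg[unfolded mdim_simple] T_X[unfolded mdim_simple] T_Xi[unfolded mdim_simple]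
  T_cc_tn[unfolded mdim_simple] cc2_tn[unfolded mdim_simple]

text \<open>\<open>\<xi>\<close> kills \<open>v\<^sub>0\<close>, so on \<open>v\<^sub>0 \<otimes> w\<close> every \<open>\<gamma>\<close> acts as if it were grouplike.\<close>

lemma Th_highest: "w \<in> coords n \<Longrightarrow> Th (tn (unit_seq 0) w) = 0"
proof -
  assume w: "w \<in> coords n"
  have "RM.dp r (unit_seq 0) = 0" if "0 < r" for r
  proof -
    have "(RM.Xi ^^ r) (unit_seq 0) = (RM.Xi ^^ (r - 1)) (RM.Xi (unit_seq 0))"
      using that by (cases r) (simp_all add: funpow_swap1)
    then show ?thesis using n_pos by (simp add: RM.dp_def simple_unit_Xi RM.Ap_zero)
  qed
  then show ?thesis using w n_pos by (simp add: Th_tn[unfolded mdim_simple] RM.Ap_zero tn_lin)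
qed

lemma t_wt: "wtv T \<psi> t"
  unfolding wtv_iff[OF tensor_dmod]
proof (intro conjI ballI)
  show "t \<in> coords (mdim T)" unfolding t_def mdim_T by (rule tens_coords)
  show "act T (Grp g) t = scl (\<psi> (g, \<one>\<^bsub>\<Gamma>\<^esub>)) t" if g: "g \<in> carrier G" for g
    using n_pos g by (simp add: t_def tn_simps simple_unit_gg tn_lin phi_shift_apply \<nu>_def Lam_mult_apply
        Gam_one_apply a_G mult_ac)
  show "act T (Chr \<gamma>) t = scl (\<psi> (\<one>\<^bsub>G\<^esub>, \<gamma>)) t" if g: "\<gamma> \<in> carrier \<Gamma>" for \<gamma>
    using n_pos g by (simp add: t_def tn_simps Th_highest[unfolded mdim_simple] cc2_lin simple_unit_cc tn_lin phi_shift_apply \<nu>_def Lam_mult_apply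
        char_one[OF chi_Gam] mult_ac)
qed

abbreviation "lev \<equiv> RT.level t (n - 1)"

lemma lev_rules: "u \<in> lev \<Longrightarrow> v \<in> lev \<Longrightarrow> u + v \<in> lev" "u \<in> lev \<Longrightarrow> scl c u \<in> lev"
  "u \<in> lev \<Longrightarrow> v \<in> lev \<Longrightarrow> u - v \<in> lev" "0 \<in> lev"
  using RT.level_rules by blast+

text \<open>From \<open>t = v\<^sub>0 \<otimes> v\<^sub>n\<^sub>-\<^sub>1\<close> the operator \<open>\<xi>\<close> reaches all \<open>v\<^sub>0 \<otimes> v\<^sub>j\<close>, because the \<open>\<alpha>\<^sub>j\<close> of the second factor are nonzero; then
\<open>x\<close> leads from \<open>v\<^sub>i \<otimes> w\<close> to \<open>v\<^sub>i\<^sub>+\<^sub>1 \<otimes> a w\<close> modulo \<open>v\<^sub>i \<otimes> x w\<close>.\<close>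

lemma tn_in_level: "i < n \<Longrightarrow> w \<in> coords n \<Longrightarrow> tn (unit_seq i) w \<in> lev"
proof (induction i arbitrary: w)
  case 0
  have "tn (unit_seq 0) (unit_seq (n - 1 - k)) \<in> lev" if "k < n" for k
    using that
  proof (induction k)
    case 0
    show ?case using RT.z_level[OF t_wt] by (simp add: t_def)
  next
    case (Suc k)
    define j where "j = n - 1 - k"
    have j: "0 < j" "j < n" "n - 1 - Suc k = j - 1" using Suc.prems by (auto simp: j_def)
    let ?c = "\<mu> (\<one>\<^bsub>G\<^esub>, \<chi>) * alpha_coeff D \<mu>' j"
    have c: "?c \<noteq> 0"
      using Lam_nz[OF mu_Lam(1) G.one_closed chi_Gam] alpha_nonzero[OF mu', of j] j by simp
    have "act T GenXi (tn (unit_seq 0) (unit_seq j)) = scl ?c (tn (unit_seq 0) (unit_seq (j - 1)))"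
      using j n_pos by (simp add: tn_simps simple_unit_Xi simple_unit_cc[OF chi_Gam] tn_lin)
    moreover have "act T GenXi (tn (unit_seq 0) (unit_seq j)) \<in> lev"
      using RT.Xi_level[OF t_wt] Suc by (simp add: j_def)
    ultimately have "scl (inverse ?c) (scl ?c (tn (unit_seq 0) (unit_seq (j - 1)))) \<in> lev"
      using lev_rules(2) by metis
    then have "tn (unit_seq 0) (unit_seq (j - 1)) \<in> lev"
      by (simp only: fs.scale_scale left_inverse[OF c] fs.scale_one)
    then show ?case using j(3) by simp
  qed
  then have u: "tn (unit_seq 0) (unit_seq j) \<in> lev" if "j < n" for j
    using that[THEN Suc_diff_Suc] that by (metis Suc_pred' diff_Suc_Suc diff_diff_cancel diff_less_Suc less_Suc_eq_le n_pos(1))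
  have "tn (unit_seq 0) (\<Sum>j<n. scl (w j) (unit_seq j)) \<in> lev"
  proof -
    have "tn (unit_seq 0) (\<Sum>j\<in>I. scl (w j) (unit_seq j)) \<in> lev" if "finite I" "I \<subseteq> {..<n}" for I
      using that
    proof (induction I rule: finite_induct)
      case empty
      show ?case unfolding sum.empty tn_lin by (rule lev_rules(4))
    next
      case (insert j I)
      then show ?case
        unfolding sum.insert[OF insert.hyps] tn_lin by (intro lev_rules u) auto
    qed
    then show ?thesis by simp
  qed
  then show ?case unfolding coords_expand[OF 0(2), symmetric] .
next
  case (Suc i)
  define w' where "w' = RN.gg (inv\<^bsub>G\<^esub> a) w"
  have w: "w \<in> coords n" and w': "w' \<in> coords n"
    using RN.gg_W[of "inv\<^bsub>G\<^esub> a" w] Suc.prems a_G by (auto simp: w'_def)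
  have Kw: "RN.K w' = w"
    unfolding w'_def using w a_G RN.gg_mult[of w a "inv\<^bsub>G\<^esub> a"] RN.gg_one[of w] by simp
  have Xw: "RN.X w' \<in> coords n" using RN.X_W[of w'] w' by simp
  have "act T GenX (tn (unit_seq i) w') = tn (unit_seq (Suc i)) w + tn (unit_seq i) (RN.X w')"
    using Suc.prems w' by (simp add: tn_simps simple_unit_X Kw)
  then have "tn (unit_seq (Suc i)) w = act T GenX (tn (unit_seq i) w') - tn (unit_seq i) (RN.X w')"
    by simp
  moreover have "act T GenX (tn (unit_seq i) w') \<in> lev"
    using RT.X_level_top[OF t_wt] Suc w' by simp
  moreover have "tn (unit_seq i) (RN.X w') \<in> lev" using Suc Xw by simp
  ultimately show ?case using lev_rules(3) by metis
qed

lemma coords_level: "coords (mdim T) \<subseteq> lev"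
proof
  fix v :: "nat \<Rightarrow> 'k" assume "v \<in> coords (mdim T)"
  then have v: "v \<in> coords (n * n)" by simp
  have u: "unit_seq k \<in> lev" if "k < n * n" for k
  proof -
    have "k div n < n" "k mod n < n" using that n_pos by (auto simp: less_mult_imp_div_less)
    then have "tens n n (unit_seq (k div n)) (unit_seq (k mod n)) \<in> lev"
      using tn_in_level[of "k div n" "unit_seq (k mod n)"] by simp
    then show ?thesis by (simp only: unit_tens[OF that])
  qed
  have "(\<Sum>k\<in>I. scl (v k) (unit_seq k)) \<in> lev" if "finite I" "I \<subseteq> {..<n * n}" for I
    using that
  proof (induction I rule: finite_induct)
    case empty
    show ?case unfolding sum.empty by (rule lev_rules(4))
  next
    case (insert k I)
    then show ?case unfolding sum.insert[OF insert.hyps] by (intro lev_rules u) auto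
  qed
  from this[of "{..<n * n}"] show "v \<in> lev"
    unfolding coords_expand[OF v, symmetric] by simp
qed

text \<open>The \<open>n\<^sup>2\<close> vectors \<open>x\<^sup>i \<xi>\<^sup>j t\<close> span an \<open>n\<^sup>2\<close>-dimensional space, hence are independent.\<close>

lemma pbw_independent:
  assumes c: "(\<Sum>p\<in>{..<n} \<times> {..<n}. scl (c p) (RT.pbw t (fst p) (snd p))) = 0"
    and p: "p \<in> {..<n} \<times> {..<n}"
  shows "c p = 0"
proof -
  define F where "F v = (\<Sum>p\<in>{..<n} \<times> {..<n}. scl (v (fst p * n + snd p)) (RT.pbw t (fst p) (snd p)))"
    for v :: "nat \<Rightarrow> 'k"
  define B where "B = mat_of (n * n) (n * n) F"
  have B: "B \<in> carrier_mat (n * n) (n * n)" by (simp add: B_def)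
  have mopB: "mop B v = F v" if "v \<in> coords (n * n)" for v
    unfolding B_def
  proof (rule mop_mat_of)
    show "F u \<in> coords (n * n)" for u
      unfolding F_def using RT.pbw_W[OF t_wt]
      by (intro fs.subspace_sum[OF subspace_coords] fs.subspace_scale[OF subspace_coords]) simp
  qed (use that in \<open>auto simp: F_def pointwise fs.scale_left_distrib sum.distrib fs.scale_sum_right\<close>)
  define vec where "vec c' = (\<lambda>k. if k < n * n then c' (k div n, k mod n) else 0)" for c' :: "nat \<times> nat \<Rightarrow> 'k"
  have vec: "vec c' \<in> coords (n * n)" for c' by (simp add: vec_def coords_def)
  have vec_at: "vec c' (i * n + j) = c' (i, j)" if "i < n" "j < n" for c' i j
  proof -
    have "i * n + j < (i + 1) * n" using that by simp
    also have "\<dots> \<le> n * n" using that by (intro mult_le_mono1) simp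
    finally show ?thesis using that by (simp add: vec_def)
  qed
  have Fvec: "F (vec c') = (\<Sum>p\<in>{..<n} \<times> {..<n}. scl (c' p) (RT.pbw t (fst p) (snd p)))" for c'
    unfolding F_def by (rule sum.cong) (auto simp: vec_at)
  have "surj_mat B"
    unfolding surj_mat_iff[OF B]
  proof
    fix w :: "nat \<Rightarrow> 'k" assume "w \<in> coords (n * n)"
    then have "w \<in> lev" using coords_level dim_T by auto
    then obtain c' where "w = F (vec c')" unfolding RT.level_family[OF t_wt] Fvec by blast
    then show "\<exists>v\<in>coords (n * n). mop B v = w" using mopB[OF vec] vec by metis
  qed
  from surj_right_inverse[OF B this] obtain B' where B': "B' \<in> carrier_mat (n * n) (n * n)" "B * B' = 1\<^sub>m (n * n)" .
  have "B' * B = 1\<^sub>m (n * n)" by (rule mat_mult_left_right_inverse[OF B B'])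
  then have "vec c = mop B' (mop B (vec c))"
    using mop_mult[OF B'(1) B, symmetric] mop_one[OF vec] by simp
  also have "\<dots> = 0" using c by (simp add: mopB[OF vec] Fvec mop_lin)
  finally show ?thesis using vec_at[of "fst p" "snd p" c] p by (auto simp: zero_fun_apply)
qed

lemma T_hom:
  assumes N: "is_dmod D N" and w: "wtv N \<psi> w"
  obtains f where "f \<in> mod_hom D T N" "mop f t = w"
proof -
  obtain F where F: "\<And>u v. u \<in> coords (mdim T) \<Longrightarrow> v \<in> coords (mdim T) \<Longrightarrow> F (u + v) = F u + F v"
    "\<And>c u. u \<in> coords (mdim T) \<Longrightarrow> F (scl c u) = scl c (F u)"
    "\<And>u. u \<in> coords (mdim T) \<Longrightarrow> F u \<in> coords (mdim N)"
    "\<And>s u. s \<in> dd_gens D \<Longrightarrow> u \<in> coords (mdim T) \<Longrightarrow> F (act T s u) = act N s (F u)" "F t = w"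
  proof (rule free_weight_hom[OF dd_rep_act[OF tensor_dmod] dd_rep_act[OF N] t_wt w coords_level])
    fix c p assume "(\<Sum>p\<in>{..<n} \<times> {..<n}. scl (c p) (RT.pbw t (fst p) (snd p))) = 0" "p \<in> {..<n} \<times> {..<n}"
    then show "c p = 0" by (rule pbw_independent[where c = c and p = p])
  qed blast
  obtain f where "f \<in> mod_hom D T N" "\<And>u. u \<in> coords (mdim T) \<Longrightarrow> mop f u = F u"
    using mod_homE[of T N F, OF dmod_carrier[OF tensor_dmod] dmod_carrier[OF N] F(1-4)] by blast
  then show thesis using that F(5) RT.z_W[OF t_wt] by auto
qed

text \<open>The eigenvalue of the Casimir operator at a highest weight vector of weight \<open>\<phi>\<^sup>s \<nu>\<close>.\<close>

definition cval :: "nat \<Rightarrow> 'k" where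
  "cval s = \<rho> * inverse \<rho> ^ s * \<nu> (a, \<one>\<^bsub>\<Gamma>\<^esub>) + \<rho> ^ s * \<nu> (\<one>\<^bsub>G\<^esub>, \<chi>)"

lemma psi_vals: "\<psi> (a, \<one>\<^bsub>\<Gamma>\<^esub>) = \<rho> * \<nu> (a, \<one>\<^bsub>\<Gamma>\<^esub>)" "\<psi> (\<one>\<^bsub>G\<^esub>, \<chi>) = \<rho> ^ (n - 1) * \<nu> (\<one>\<^bsub>G\<^esub>, \<chi>)"
proof -
  have "inverse \<rho> ^ Suc (n - 1) = 1" using rho_n n2 by (simp add: power_inverse)
  then have "inverse \<rho> ^ (n - 1) = \<rho>" using rho_nz by (simp add: field_simps)
  then show "\<psi> (a, \<one>\<^bsub>\<Gamma>\<^esub>) = \<rho> * \<nu> (a, \<one>\<^bsub>\<Gamma>\<^esub>)" "\<psi> (\<one>\<^bsub>G\<^esub>, \<chi>) = \<rho> ^ (n - 1) * \<nu> (\<one>\<^bsub>G\<^esub>, \<chi>)"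
    by (simp_all add: phi_shift_apply a_G chi_Gam Gam_one_apply char_one[OF chi_Gam] chi_a)
qed

lemma cval_shift: "k < n \<Longrightarrow> \<rho> ^ Suc k * \<psi> (a, \<one>\<^bsub>\<Gamma>\<^esub>) + inverse \<rho> ^ k * \<psi> (\<one>\<^bsub>G\<^esub>, \<chi>) = cval (n - Suc k)"
proof -
  assume k: "k < n"
  have "\<rho> ^ k * \<rho> ^ (n - Suc k) = \<rho> ^ (n - 1)" using k by (simp flip: power_add)
  then have 1: "inverse \<rho> ^ k * \<rho> ^ (n - 1) = \<rho> ^ (n - Suc k)"
    using rho_nz by (simp add: power_inverse field_simps)
  have "\<rho> ^ Suc k * \<rho> ^ (n - Suc k) = 1" using k rho_n by (simp flip: power_add power_Suc)
  then have 2: "\<rho> ^ Suc k = inverse \<rho> ^ (n - Suc k)"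
    using rho_nz by (simp add: power_inverse field_simps)
  show ?thesis
    unfolding psi_vals cval_def 2 mult.assoc[symmetric] 1
    by (simp only: mult.commute[of \<rho>])
qed

lemma pact_diag: "j \<le> n \<Longrightarrow> RT.pact (\<Prod>k<j. [:- cval (n - Suc k), 1:]) t = scl ((1 - \<rho>) ^ j) (RT.pbw t j j)"
proof -
  assume "j \<le> n"
  then have "(\<Prod>k<j. [:- cval (n - Suc k), 1:]) =
      (\<Prod>k<j. [:- (\<rho> ^ Suc k * \<psi> (a, \<one>\<^bsub>\<Gamma>\<^esub>) + inverse \<rho> ^ k * \<psi> (\<one>\<^bsub>G\<^esub>, \<chi>)), 1:])"
    by (intro prod.cong refl) (simp only: cval_shift lessThan_iff)
  then show ?thesis
    using RT.pact_prod[OF RT.wt_eig[OF t_wt], of j] by (simp only: RT.pbw_def)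
qed

text \<open>By \<open>pact_diag\<close> for \<open>j = n\<close> the product maps \<open>t\<close> to a multiple of \<open>x\<^sup>n \<xi>\<^sup>n t = 0\<close>, and it commutes with the
action, so it kills the module that \<open>t\<close> generates.\<close>

lemma cas_annihilates: "u \<in> coords (mdim T) \<Longrightarrow> RT.pact (\<Prod>k<n. [:- cval k, 1:]) u = 0"
proof -
  have "(\<Prod>k<n. [:- cval k, 1:]) = (\<Prod>k<n. [:- cval (n - Suc k), 1:])"
    by (rule prod.nat_diff_reindex[symmetric])
  then have 0: "RT.pact (\<Prod>k<n. [:- cval k, 1:]) t = 0"
    using pact_diag[of n] RT.Xi_n[OF RT.z_W[OF t_wt]] by (simp add: RT.pbw_def RT.Ap_zero)
  let ?U = "{u \<in> coords (mdim T). RT.pact (\<Prod>k<n. [:- cval k, 1:]) u = 0}"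
  have "lev \<subseteq> ?U"
  proof (rule RT.level_minimal)
    show "fs.subspace ?U"
      by (rule fs.subspaceI) (auto simp: RT.W_rules RT.pact_vadd RT.pact_vscale RT.pact_vzero simp del: mdim_T)
    show "t \<in> ?U" using 0 RT.z_W[OF t_wt] by simp
  qed (auto simp: RT.W_closed RT.pact_gens x_gens xi_gens RT.A_lin simp del: mdim_T)
  moreover assume "u \<in> coords (mdim T)"
  ultimately show ?thesis using coords_level by blast
qed

text \<open>On \<open>x\<^sup>i \<xi>\<^sup>j t\<close> the element \<open>a\<close> has the eigenvalue \<open>\<rho>\<^bsup>j-i\<^esup> \<psi>(a)\<close>, so only the monomials with \<open>i = j\<close> contribute.\<close>

lemma weight_space: "z \<in> coords (mdim T) \<Longrightarrow> act T (Grp a) z = scl (\<psi> (a, \<one>\<^bsub>\<Gamma>\<^esub>)) z \<Longrightarrow> \<exists>q. z = RT.pact q t"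
proof -
  assume z: "z \<in> coords (mdim T)" and K: "act T (Grp a) z = scl (\<psi> (a, \<one>\<^bsub>\<Gamma>\<^esub>)) z"
  let ?I = "{..<n} \<times> {..<n}" and ?b = "\<lambda>p. RT.pbw t (fst p) (snd p)"
  obtain c where c: "z = (\<Sum>p\<in>?I. scl (c p) (?b p))"
    using subsetD[OF coords_level z] unfolding RT.level_family[OF t_wt] by blast
  have "(\<Sum>p\<in>?I. scl (c p * ((inverse \<rho> ^ fst p * \<rho> ^ snd p - 1) * \<psi> (a, \<one>\<^bsub>\<Gamma>\<^esub>))) (?b p))
      = act T (Grp a) z - scl (\<psi> (a, \<one>\<^bsub>\<Gamma>\<^esub>)) z"
    unfolding c RT.A_sum fs.scale_sum_right sum_subtractf[symmetric]
    by (rule sum.cong) (simp_all add: RT.A_lin RT.gg_pbw[OF t_wt a_G] chi_a algebra_simps)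
  then have 0: "(\<Sum>p\<in>?I. scl (c p * ((inverse \<rho> ^ fst p * \<rho> ^ snd p - 1) * \<psi> (a, \<one>\<^bsub>\<Gamma>\<^esub>))) (?b p)) = 0"
    using K by simp
  have off: "c p = 0" if p: "p \<in> ?I" "fst p \<noteq> snd p" for p
  proof -
    have "\<rho> ^ snd p \<noteq> \<rho> ^ fst p" using rho_inj[of "fst p" "snd p"] p by auto
    then have "inverse \<rho> ^ fst p * \<rho> ^ snd p \<noteq> 1"
      using rho_nz by (simp add: power_inverse field_simps)
    moreover have "\<psi> (a, \<one>\<^bsub>\<Gamma>\<^esub>) \<noteq> 0"
      by (rule Lam_nz[OF phi_shift_Lam[OF nu_Lam] a_G]) simp
    ultimately show ?thesis using pbw_independent[OF 0 p(1)] by simp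
  qed
  have "z = (\<Sum>p\<in>(\<lambda>i. (i, i)) ` {..<n}. scl (c p) (?b p))"
    unfolding c
  proof (rule sum.mono_neutral_right)
    show "\<forall>p\<in>?I - (\<lambda>i. (i, i)) ` {..<n}. scl (c p) (?b p) = 0"
    proof
      fix p assume p: "p \<in> ?I - (\<lambda>i. (i, i)) ` {..<n}"
      obtain i j where ij: "p = (i, j)" by (cases p)
      then have "fst p \<noteq> snd p" using p by auto
      then show "scl (c p) (?b p) = 0" using off p by simp
    qed
  qed auto
  also have "\<dots> = (\<Sum>i<n. scl (c (i, i)) (RT.pbw t i i))"
    by (subst sum.reindex) (auto simp: inj_on_def)
  also have "\<dots> = (\<Sum>i<n. RT.pact (smult (c (i, i) * inverse ((1 - \<rho>) ^ i)) (\<Prod>k<i. [:- cval (n - Suc k), 1:])) t)"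
    using rho_1 by (intro sum.cong refl) (simp add: RT.pact_smult pact_diag)
  also have "\<dots> = RT.pact (\<Sum>i<n. smult (c (i, i) * inverse ((1 - \<rho>) ^ i)) (\<Prod>k<i. [:- cval (n - Suc k), 1:])) t"
    by (simp add: RT.pact_sum)
  finally show ?thesis by blast
qed

end

section \<open>Biproducts of matrix modules\<close>

context dd
begin

text \<open>Homomorphisms as functions on coordinate vectors. The matrices of the generators need not satisfy the
relations, so that direct sums can be handled before they are known to be modules.\<close>

definition fhom :: "('g, 'k) dmod \<Rightarrow> ('g, 'k) dmod \<Rightarrow> ((nat \<Rightarrow> 'k) \<Rightarrow> nat \<Rightarrow> 'k) \<Rightarrow> bool" where
  "fhom M N F \<longleftrightarrow> module_hom scl scl F \<and> (\<forall>v\<in>coords (mdim M). F v \<in> coords (mdim N)) \<and>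
     (\<forall>s\<in>dd_gens D. \<forall>v\<in>coords (mdim M). F (act M s v) = act N s (F v))"

definition carriers_ok :: "('g, 'k) dmod \<Rightarrow> bool" where
  "carriers_ok M \<longleftrightarrow> (\<forall>s\<in>dd_gens D. mact M s \<in> carrier_mat (mdim M) (mdim M))"

text \<open>\<open>Q\<close> is the direct sum of the \<open>P s\<close> with injections \<open>\<iota> s\<close> and projections \<open>p s\<close>. This description does not depend on how
the summands are bracketed, which matters for the nested sum in the final statement.\<close>

definition biprod :: "('g, 'k) dmod \<Rightarrow> 'j set \<Rightarrow> ('j \<Rightarrow> ('g, 'k) dmod) \<Rightarrow>
    ('j \<Rightarrow> (nat \<Rightarrow> 'k) \<Rightarrow> nat \<Rightarrow> 'k) \<Rightarrow> ('j \<Rightarrow> (nat \<Rightarrow> 'k) \<Rightarrow> nat \<Rightarrow> 'k) \<Rightarrow> bool" where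
  "biprod Q J P \<iota> p \<longleftrightarrow> finite J \<and> (\<forall>s\<in>J. fhom (P s) Q (\<iota> s) \<and> fhom Q (P s) (p s)) \<and>
     (\<forall>i\<in>J. \<forall>j\<in>J. \<forall>v\<in>coords (mdim (P j)). p i (\<iota> j v) = (if i = j then v else 0)) \<and>
     (\<forall>v\<in>coords (mdim Q). v = (\<Sum>s\<in>J. \<iota> s (p s v)))"

lemma act_coords: "carriers_ok M \<Longrightarrow> s \<in> dd_gens D \<Longrightarrow> act M s v \<in> coords (mdim M)"
  unfolding carriers_ok_def act_def using mop_closed by blast

lemma fhom_comp: "fhom M N F \<Longrightarrow> fhom N R H \<Longrightarrow> fhom M R (\<lambda>v. H (F v))"
  using module_hom_compose[of scl scl F scl H] unfolding fhom_def by (simp add: comp_def)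

lemma fhom_id: "fhom M M (\<lambda>v. v)"
  by (simp add: fhom_def mh_id)

lemma biprod_single: "biprod (P x) {x} P (\<lambda>_ v. v) (\<lambda>_ v. v)"
  by (simp add: biprod_def fhom_id)

lemma biprod_merge:
  assumes i: "fhom M Q i1" "fhom Q M q1" "fhom R Q i2" "fhom Q R q2"
    and id: "\<And>v. v \<in> coords (mdim M) \<Longrightarrow> q1 (i1 v) = v" "\<And>v. v \<in> coords (mdim M) \<Longrightarrow> q2 (i1 v) = 0"
      "\<And>v. v \<in> coords (mdim R) \<Longrightarrow> q2 (i2 v) = v" "\<And>v. v \<in> coords (mdim R) \<Longrightarrow> q1 (i2 v) = 0"
      "\<And>v. v \<in> coords (mdim Q) \<Longrightarrow> v = i1 (q1 v) + i2 (q2 v)"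
    and M: "biprod M J1 P \<iota>1 p1" and R: "biprod R J2 P \<iota>2 p2" and disj: "J1 \<inter> J2 = {}"
  shows "biprod Q (J1 \<union> J2) P (\<lambda>s v. if s \<in> J1 then i1 (\<iota>1 s v) else i2 (\<iota>2 s v))
    (\<lambda>s v. if s \<in> J1 then p1 s (q1 v) else p2 s (q2 v))"
proof -
  have fin: "finite J1" "finite J2" using M R by (auto simp: biprod_def)
  have h1: "fhom (P s) M (\<iota>1 s)" "fhom M (P s) (p1 s)" if "s \<in> J1" for s using M that by (auto simp: biprod_def)
  have h2: "fhom (P s) R (\<iota>2 s)" "fhom R (P s) (p2 s)" if "s \<in> J2" for s using R that by (auto simp: biprod_def)
  have n1: "s \<notin> J1" if "s \<in> J2" for s using disj that by blast
  have z1: "p1 s 0 = 0" if "s \<in> J1" for s using h1(2)[OF that] module_hom.zero[of scl scl] unfolding fhom_def by blast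
  have z2: "p2 s 0 = 0" if "s \<in> J2" for s using h2(2)[OF that] module_hom.zero[of scl scl] unfolding fhom_def by blast
  have c1: "\<iota>1 s v \<in> coords (mdim M)" if "s \<in> J1" "v \<in> coords (mdim (P s))" for s v
    using h1(1)[OF that(1)] that(2) by (simp add: fhom_def)
  have c2: "\<iota>2 s v \<in> coords (mdim R)" if "s \<in> J2" "v \<in> coords (mdim (P s))" for s v
    using h2(1)[OF that(1)] that(2) by (simp add: fhom_def)
  show ?thesis
    unfolding biprod_def
  proof (intro conjI ballI)
    show "finite (J1 \<union> J2)" using fin by simp
  next
    fix s assume "s \<in> J1 \<union> J2"
    then show "fhom (P s) Q (\<lambda>v. if s \<in> J1 then i1 (\<iota>1 s v) else i2 (\<iota>2 s v))"
      "fhom Q (P s) (\<lambda>v. if s \<in> J1 then p1 s (q1 v) else p2 s (q2 v))"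
      using fhom_comp[OF h1(1) i(1)] fhom_comp[OF h2(1) i(3)] fhom_comp[OF i(2) h1(2)] fhom_comp[OF i(4) h2(2)]
      by (cases "s \<in> J1"; simp)+
  next
    fix r s and v :: "nat \<Rightarrow> 'k" assume "r \<in> J1 \<union> J2" "s \<in> J1 \<union> J2" "v \<in> coords (mdim (P s))"
    then show "(if r \<in> J1 then p1 r (q1 (if s \<in> J1 then i1 (\<iota>1 s v) else i2 (\<iota>2 s v)))
        else p2 r (q2 (if s \<in> J1 then i1 (\<iota>1 s v) else i2 (\<iota>2 s v)))) = (if r = s then v else 0)"
      using M R n1 by (auto simp: id c1 c2 z1 z2 biprod_def)
  next
    fix v :: "nat \<Rightarrow> 'k" assume v: "v \<in> coords (mdim Q)"
    have q: "q1 v \<in> coords (mdim M)" "q2 v \<in> coords (mdim R)" using i v by (auto simp: fhom_def)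
    have lin: "module_hom scl scl i1" "module_hom scl scl i2" using i by (auto simp: fhom_def)
    have "q1 v = (\<Sum>s\<in>J1. \<iota>1 s (p1 s (q1 v)))" "q2 v = (\<Sum>s\<in>J2. \<iota>2 s (p2 s (q2 v)))"
      using M R q unfolding biprod_def by blast+
    from arg_cong[OF this(1), of i1] arg_cong[OF this(2), of i2]
    have "i1 (q1 v) = (\<Sum>s\<in>J1. i1 (\<iota>1 s (p1 s (q1 v))))"
      "i2 (q2 v) = (\<Sum>s\<in>J2. i2 (\<iota>2 s (p2 s (q2 v))))"
      unfolding module_hom.sum[OF lin(1)] module_hom.sum[OF lin(2)] .
    moreover have "(\<Sum>s\<in>J2. i2 (\<iota>2 s (p2 s (q2 v)))) =
       (\<Sum>s\<in>J2. if s \<in> J1 then i1 (\<iota>1 s (p1 s (q1 v))) else i2 (\<iota>2 s (p2 s (q2 v))))"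
      by (rule sum.cong) (auto simp: n1)
    ultimately have "v = (\<Sum>s\<in>J1. if s \<in> J1 then i1 (\<iota>1 s (p1 s (q1 v))) else i2 (\<iota>2 s (p2 s (q2 v))))
        + (\<Sum>s\<in>J2. if s \<in> J1 then i1 (\<iota>1 s (p1 s (q1 v))) else i2 (\<iota>2 s (p2 s (q2 v))))"
      using id(5)[OF v] by simp
    also have "\<dots> = (\<Sum>s\<in>J1 \<union> J2. if s \<in> J1 then i1 (\<iota>1 s (p1 s (q1 v))) else i2 (\<iota>2 s (p2 s (q2 v))))"
      by (rule sum.union_disjoint[symmetric]) (use fin disj in auto)
    finally show "v = (\<Sum>s\<in>J1 \<union> J2. (if s \<in> J1 then i1 (\<iota>1 s (if s \<in> J1 then p1 s (q1 v) else p2 s (q2 v)))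
        else i2 (\<iota>2 s (if s \<in> J1 then p1 s (q1 v) else p2 s (q2 v)))))"
      by (simp cong: if_cong)
  qed
qed

lemma mod_dsum_Nil: "mdim (mod_dsum [] :: ('g, 'k) dmod) = 0" "carriers_ok (mod_dsum [])"
  "biprod (mod_dsum []) {} P (\<lambda>_ v. v) (\<lambda>_ v. v)"
  by (auto simp: mod_dsum_def carriers_ok_def biprod_def coords_def fun_eq_iff zero_fun_apply)

lemma mod_dsum_Cons:
  assumes "carriers_ok M" "carriers_ok (mod_dsum Ms)"
  shows "mdim (mod_dsum (M # Ms)) = mdim M + mdim (mod_dsum Ms)"
    and "s \<in> dd_gens D \<Longrightarrow> mact (mod_dsum (M # Ms)) s = four_block_mat (mact M s) (0\<^sub>m (mdim M) (mdim (mod_dsum Ms)))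
        (0\<^sub>m (mdim (mod_dsum Ms)) (mdim M)) (mact (mod_dsum Ms) s)"
    and "carriers_ok (mod_dsum (M # Ms))"
proof -
  show 1: "mdim (mod_dsum (M # Ms)) = mdim M + mdim (mod_dsum Ms)" by (simp add: mod_dsum_def)
  show 2: "mact (mod_dsum (M # Ms)) s = four_block_mat (mact M s) (0\<^sub>m (mdim M) (mdim (mod_dsum Ms)))
        (0\<^sub>m (mdim (mod_dsum Ms)) (mdim M)) (mact (mod_dsum Ms) s)" if "s \<in> dd_gens D" for s
    using carrier_matD[OF bspec[OF assms(1)[unfolded carriers_ok_def] that]]
      carrier_matD[OF bspec[OF assms(2)[unfolded carriers_ok_def] that]]
    by (simp add: mod_dsum_def Let_def)
  show "carriers_ok (mod_dsum (M # Ms))"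
    using assms unfolding carriers_ok_def by (auto simp: 1 2)
qed

text \<open>The coordinates of a direct sum are those of the first summand followed by the rest.\<close>

lemma biprod_Cons:
  assumes ok: "carriers_ok M" "carriers_ok (mod_dsum Ms)"
    and M: "biprod M J1 P \<iota>1 p1" and R: "biprod (mod_dsum Ms) J2 P \<iota>2 p2" and disj: "J1 \<inter> J2 = {}"
  shows "\<exists>\<iota> p. biprod (mod_dsum (M # Ms)) (J1 \<union> J2) P \<iota> p"
proof -
  let ?R = "mod_dsum Ms" and ?Q = "mod_dsum (M # Ms)"
  let ?d = "mdim M" and ?e = "mdim ?R"
  define i1 where "i1 v = (\<lambda>i. if i < ?d then v i else 0)" for v :: "nat \<Rightarrow> 'k"
  define i2 where "i2 v = (\<lambda>i. if ?d \<le> i \<and> i < ?d + ?e then v (i - ?d) else 0)" for v :: "nat \<Rightarrow> 'k"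
  define q2 where "q2 v = (\<lambda>i. if i < ?e then v (?d + i) else 0)" for v :: "nat \<Rightarrow> 'k"
  note defs = i1_def i2_def q2_def
  have dim: "mdim ?Q = ?d + ?e" by (rule mod_dsum_Cons(1)[OF ok])
  have lin: "module_hom scl scl i1" "module_hom scl scl i2" "module_hom scl scl q2"
    by (unfold_locales; auto simp: defs fun_eq_iff pointwise)+
  have actQ: "act ?Q s v = i1 (act M s (i1 v)) + i2 (act ?R s (q2 v))" if s: "s \<in> dd_gens D" for s v
  proof
    fix i
    have car: "mact M s \<in> carrier_mat ?d ?d" "mact ?R s \<in> carrier_mat ?e ?e"
      using ok s by (auto simp: carriers_ok_def)
    have split: "(\<Sum>j<?d + ?e. h j) = (\<Sum>j<?d. h j) + (\<Sum>j<?e. h (?d + j))" for h :: "nat \<Rightarrow> 'k"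
      using sum.atLeastLessThan_concat[of 0 ?d "?d + ?e" h] sum.shift_bounds_nat_ivl[of h 0 ?d ?e]
      by (simp add: lessThan_atLeast0 add.commute)
    show "act ?Q s v i = (i1 (act M s (i1 v)) + i2 (act ?R s (q2 v))) i"
      using car unfolding act_def mop_def mod_dsum_Cons(2)[OF ok s]
      by (auto simp: split defs pointwise)
  qed
  have act_in: "act M s u \<in> coords ?d" "act ?R s u \<in> coords ?e" if "s \<in> dd_gens D" for s u
    using act_coords ok that by auto
  have id: "v \<in> coords ?d \<Longrightarrow> i1 v = v" "v \<in> coords ?d \<Longrightarrow> q2 v = 0" "v \<in> coords ?e \<Longrightarrow> q2 (i2 v) = v"
    "i1 (i2 v) = 0" "v \<in> coords (?d + ?e) \<Longrightarrow> v = i1 v + i2 (q2 v)" "i1 (i1 v) = i1 v" "q2 (i1 v) = 0"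
    "i1 0 = 0" "i2 0 = 0" "q2 0 = 0" for v
    by (auto simp: defs coords_def fun_eq_iff pointwise)
  have cl: "i1 v \<in> coords ?d" "q2 v \<in> coords ?e" "i1 v \<in> coords (?d + ?e)" "i2 v \<in> coords (?d + ?e)" for v
    by (auto simp: defs coords_def)
  have up: "v \<in> coords ?d \<Longrightarrow> v \<in> coords (?d + ?e)" for v :: "nat \<Rightarrow> 'k"
    by (simp add: coords_def)
  have z: "act M s 0 = 0" "act ?R s 0 = 0" for s
    by (simp_all add: act_def mop_lin)
  have "fhom M ?Q i1"
    unfolding fhom_def dim using lin cl by (auto simp: actQ id z act_in up)
  moreover have "fhom ?Q M i1"
    unfolding fhom_def dim using lin cl by (auto simp: actQ id act_in module_hom.add[OF lin(1)])
  moreover have "fhom ?R ?Q i2"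
    unfolding fhom_def dim using lin cl by (auto simp: actQ id z)
  moreover have "fhom ?Q ?R q2"
    unfolding fhom_def dim using lin cl by (auto simp: actQ id act_in module_hom.add[OF lin(3)])
  ultimately show ?thesis
    using biprod_merge[OF _ _ _ _ _ _ _ _ _ M R disj, of ?Q i1 i1 i2 q2] id unfolding dim by metis
qed

lemma biprod_list:
  assumes "distinct xs" "\<And>x. x \<in> set xs \<Longrightarrow> carriers_ok (P x)"
  shows "carriers_ok (mod_dsum (map P xs)) \<and> (\<exists>\<iota> p. biprod (mod_dsum (map P xs)) (set xs) P \<iota> p)"
  using assms
proof (induction xs)
  case Nil
  show ?case using mod_dsum_Nil by auto
next
  case (Cons x xs)
  have IH: "carriers_ok (mod_dsum (map P xs))" and ok: "carriers_ok (P x)" using Cons by auto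
  obtain \<iota> p where b: "biprod (mod_dsum (map P xs)) (set xs) P \<iota> p" using Cons by auto
  have disj: "{x} \<inter> set xs = {}" using Cons.prems by auto
  show ?case
    using mod_dsum_Cons(3)[OF ok IH] biprod_Cons[OF ok IH biprod_single b disj] by simp
qed

lemma ev_hom:
  assumes F: "\<And>s v. s \<in> dd_gens D \<Longrightarrow> v \<in> coords (mdim M) \<Longrightarrow> F (act M s v) = act N s (F v)"
    and lin: "module_hom scl scl F" and ok: "carriers_ok M"
  shows "set1_ncpoly P \<subseteq> dd_gens D \<Longrightarrow> v \<in> coords (mdim M) \<Longrightarrow>
    ev scl (act M) P v \<in> coords (mdim M) \<and> F (ev scl (act M) P v) = ev scl (act N) P (F v)"
  by (induction P arbitrary: v)
    (auto simp: F act_coords[OF ok] module_hom.add[OF lin] module_hom.diff[OF lin] module_hom.scale[OF lin]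
      fs.subspace_add[OF subspace_coords] fs.subspace_diff[OF subspace_coords] fs.subspace_scale[OF subspace_coords])

text \<open>Relations pass to homomorphic images; this is how a direct sum inherits them from \<open>T\<close>.\<close>

lemma is_dmod_image:
  assumes M: "is_dmod D M" and ok: "carriers_ok N" and F: "fhom M N F"
    and surj: "\<And>w. w \<in> coords (mdim N) \<Longrightarrow> \<exists>v\<in>coords (mdim M). F v = w"
  shows "is_dmod D N"
  unfolding is_dmod_iff
proof (intro conjI ballI)
  show "mact N s \<in> carrier_mat (mdim N) (mdim N)" if "s \<in> dd_gens D" for s
    using ok that by (simp add: carriers_ok_def)
  fix w :: "nat \<Rightarrow> 'k" assume "w \<in> coords (mdim N)"
  then obtain v where v: "v \<in> coords (mdim M)" "F v = w" using surj by blast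
  have okM: "carriers_ok M" using M by (simp add: carriers_ok_def is_dmod_def)
  have rel: "rel_vec scl (act K) u \<longleftrightarrow> (\<forall>(p, q)\<in>dd_relations D. ev scl (act K) p u = ev scl (act K) q u)"
    for K :: "('g, 'k) dmod" and u
    by (rule rel_iff[symmetric]) (auto simp: act_def module_hom_mop intro: fs.vector_space_axioms)
  have "ev scl (act N) p w = ev scl (act N) q w" if pq: "(p, q) \<in> dd_relations D" for p q
  proof -
    have "rel_vec scl (act M) v" using M v(1) unfolding is_dmod_iff by blast
    then have "ev scl (act M) p v = ev scl (act M) q v" using pq unfolding rel by blast
    then show ?thesis
      using ev_hom[of M F N, OF _ _ okM relations_letters(1)[OF pq] v(1)]
        ev_hom[of M F N, OF _ _ okM relations_letters(2)[OF pq] v(1)] F v(2) by (auto simp: fhom_def)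
  qed
  then show "rel_vec scl (act N) w" unfolding rel by blast
qed

lemma mod_hom_fhom: "is_dmod D M \<Longrightarrow> is_dmod D N \<Longrightarrow> f \<in> mod_hom D M N \<Longrightarrow> fhom M N (mop f)"
  by (simp add: fhom_def module_hom_mop mod_hom_closed dmod_hom_act)

lemma fhom_mod_hom:
  assumes "fhom M N F" "carriers_ok M" "carriers_ok N"
  obtains f where "f \<in> mod_hom D M N" "\<And>u. u \<in> coords (mdim M) \<Longrightarrow> mop f u = F u"
  by (rule mod_homE[of M N F]) (use assms that in \<open>auto simp: fhom_def carriers_ok_def module_hom.add module_hom.scale\<close>)

lemma fhom_pact:
  assumes "is_dmod D M" "is_dmod D N" "fhom M N F" "v \<in> coords (mdim M)"
  shows "F (dd_rep.pact D scl (act M) p v) = dd_rep.pact D scl (act N) p (F v)"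
  by (rule hom_pact[OF dd_rep_act[OF assms(1)] dd_rep_act[OF assms(2)]])
    (use assms(3,4) in \<open>auto simp: fhom_def module_hom.add module_hom.scale\<close>)

end

section \<open>Decomposition by Casimir eigenvalues\<close>

context dd_verma_tensor
begin

text \<open>The simple module \<open>V(l, \<phi>\<^sup>s \<nu>)\<close> contains the weight \<open>\<psi>\<close>, at \<open>v\<^sub>n\<^sub>-\<^sub>1\<^sub>-\<^sub>s\<close>. That vector generates it and lifts to \<open>y\<close> in the
projective cover, which yields \<open>F\<close>. As the Casimir operator is a scalar on the simple module, a polynomial in it that does not
vanish at this scalar preserves surjectivity onto the simple module and, by essentiality, onto the cover. The map \<open>H\<close> lifts the
projection of the cover along the map from \<open>T\<close> to the simple module; comparing images in the simple module normalises \<open>H y\<close>.\<close>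

lemma cover_data:
  assumes s: "s < n" and l: "n - 1 - s < l" "l \<le> n"
    and alpha: "\<And>i. 1 \<le> i \<Longrightarrow> i < l \<Longrightarrow> alpha_coeff D (phi_shift D s \<nu>) i \<noteq> 0"
    and cover: "projective_cover D P (simple_mod D l (phi_shift D s \<nu>))"
  obtains y F H where "is_dmod D P" "y \<in> coords (mdim P)" "fhom T P F" "fhom P T H"
    "act T (Grp a) (H y) = scl (\<psi> (a, \<one>\<^bsub>\<Gamma>\<^esub>)) (H y)"
    "\<And>R v. poly R (cval s) \<noteq> 0 \<Longrightarrow> v \<in> coords (mdim P) \<Longrightarrow>
       \<exists>u\<in>coords (mdim T). dd_rep.pact D scl (act P) R (F u) = v"
    "\<And>q. H y = RT.pact q t \<Longrightarrow> poly q (cval s) = 1"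
proof -
  let ?\<mu> = "phi_shift D s \<nu>"
  let ?S = "simple_mod D l ?\<mu>"
  let ?j = "n - 1 - s"
  have S: "is_dmod D ?S" and proj: "projective_dmod D P" and P: "is_dmod D P"
    using cover by (auto simp: projective_cover_def projective_dmod_def)
  obtain \<pi> where \<pi>: "\<pi> \<in> mod_hom D P ?S" "surj_mat \<pi>"
    and ess: "\<And>N h. h \<in> mod_hom D N P \<Longrightarrow> is_dmod D N \<Longrightarrow> surj_mat (\<pi> * h) \<Longrightarrow> surj_mat h"
    using cover unfolding projective_cover_def by blast
  interpret RS: dd_rep D scl "coords (mdim ?S)" "act ?S" by (rule dd_rep_act[OF S])
  interpret RP: dd_rep D scl "coords (mdim P)" "act P" by (rule dd_rep_act[OF P])
  note f\<pi> = mod_hom_fhom[OF P S \<pi>(1)]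
  have tW: "t \<in> coords (mdim T)" by (rule RT.z_W[OF t_wt])
  have shift: "phi_shift D ?j ?\<mu> = \<psi>"
    using phi_shift_shift[OF nu_Lam, of ?j s] s by simp
  have "wtv ?S \<psi> (unit_seq ?j)"
    using simple_unit_wtv[OF S l(1)] unfolding shift .
  then obtain y where y: "wtv P \<psi> y" "mop \<pi> y = unit_seq ?j"
    using weight_lift[OF P S \<pi> phi_shift_Lam[OF nu_Lam]] by blast
  obtain f where f: "f \<in> mod_hom D T P" "mop f t = y" using T_hom[OF P y(1)] .
  note ff = mod_hom_fhom[OF tensor_dmod P f(1)]
  define h where "h u = mop \<pi> (mop f u)" for u
  have fh: "fhom T ?S h" unfolding h_def by (rule fhom_comp[OF ff f\<pi>])
  have ht: "h t = unit_seq ?j" by (simp add: h_def f y)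
  have cas: "RS.cas w = scl (cval s) w" if w: "w \<in> coords l" for w
  proof -
    have e: "RS.eig (inverse \<rho> ^ s * \<nu> (a, \<one>\<^bsub>\<Gamma>\<^esub>)) (\<rho> ^ s * \<nu> (\<one>\<^bsub>G\<^esub>, \<chi>)) (unit_seq 0)"
      unfolding RS.eig_def using l(1) by (simp add: simple_unit_gg[OF a_G] simple_unit_cc[OF chi_Gam] phi_shift_apply
          Gam_one_apply a_G char_one[OF chi_Gam] chi_Gam chi_a)
    have "RS.cas (unit_seq i) = scl (cval s) (unit_seq i)" if i: "i < l" for i
    proof -
      have "RS.cas ((RS.X ^^ i) (unit_seq 0)) = (RS.X ^^ i) (RS.cas (unit_seq 0))"
        using i by (intro RS.cas_Xp) simp
      also have "RS.cas (unit_seq 0) = scl (cval s) (unit_seq 0)"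
        using RS.cas_eig[OF e] i by (simp add: simple_unit_Xi cval_def mult.assoc)
      finally show ?thesis by (simp add: RS.Ap_scale simple_unit_Xp i)
    qed
    then have "RS.cas (\<Sum>i<l. scl (w i) (unit_seq i)) = (\<Sum>i<l. scl (w i) (scl (cval s) (unit_seq i)))"
      unfolding RS.cas_lin by (intro sum.cong refl) simp
    then show ?thesis
      unfolding coords_expand[OF w, symmetric] fs.scale_left_commute[of _ "cval s"] fs.scale_sum_right[symmetric] .
  qed
  have pactS: "RS.pact q w = scl (poly q (cval s)) w" if "w \<in> coords l" for q w
    by (rule RS.pact_eigen[OF cas[OF that]])
  have hsurj: "\<exists>u\<in>coords (mdim T). h u = w" if w: "w \<in> coords l" for w
  proof -
    define \<beta> where "\<beta> = (\<Prod>k<?j. alpha_coeff D ?\<mu> (Suc k))"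
    have \<beta>: "\<beta> \<noteq> 0" unfolding \<beta>_def using alpha l by (subst prod_zero_iff) auto
    have hp: "h ((act T r ^^ i) u) = (act ?S r ^^ i) (h u) \<and> (act T r ^^ i) u \<in> coords (mdim T)"
      if "r \<in> dd_gens D" "u \<in> coords (mdim T)" for r i u
      using fh that by (induction i) (auto simp: fhom_def RT.closed simp del: mdim_T)
    define b where "b i = scl (inverse \<beta>) ((act T GenX ^^ i) ((act T GenXi ^^ ?j) t))" for i
    have bW: "b i \<in> coords (mdim T)" for i
      unfolding b_def by (intro RT.W_rules RT.Xp_W RT.Xip_W tW)
    have hlin: "module_hom scl scl h" using fh by (simp add: fhom_def)
    have hb: "h (b i) = unit_seq i" if "i < l" for i
      using hp[OF x_gens conjunct2[OF hp[OF xi_gens tW]]] hp[OF xi_gens tW] that l(1) \<beta>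
      unfolding b_def module_hom.scale[OF hlin]
      by (simp add: ht simple_unit_Xip RS.Ap_scale simple_unit_Xp \<beta>_def del: mdim_T)
    have "h (\<Sum>i<l. scl (w i) (b i)) = (\<Sum>i<l. scl (w i) (unit_seq i))"
      unfolding module_hom.sum[OF hlin] module_hom.scale[OF hlin] by (intro sum.cong refl) (simp add: hb)
    then have "h (\<Sum>i<l. scl (w i) (b i)) = w" unfolding coords_expand[OF w, symmetric] .
    moreover have "(\<Sum>i<l. scl (w i) (b i)) \<in> coords (mdim T)"
      by (intro fs.subspace_sum[OF subspace_coords] RT.W_rules bW)
    ultimately show ?thesis by blast
  qed
  have okT: "carriers_ok T" and okP: "carriers_ok P" and okS: "carriers_ok ?S"
    using tensor_dmod P S by (simp_all add: carriers_ok_def is_dmod_def)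
  obtain hm where hm: "hm \<in> mod_hom D T ?S" "\<And>u. u \<in> coords (mdim T) \<Longrightarrow> mop hm u = h u"
    using fhom_mod_hom[OF fh okT okS] by blast
  have "surj_mat hm"
    unfolding surj_mat_iff[OF mod_hom_carrier[OF hm(1)]]
  proof
    fix w :: "nat \<Rightarrow> 'k" assume "w \<in> coords (mdim ?S)"
    then obtain u where "u \<in> coords (mdim T)" "h u = w" using hsurj[of w] by auto
    then show "\<exists>v\<in>coords (mdim T). mop hm v = w" using hm(2) by blast
  qed
  then obtain g where g: "g \<in> mod_hom D P T" "hm * g = \<pi>"
    using proj tensor_dmod S hm(1) \<pi>(1) unfolding projective_dmod_def by blast
  note fg = mod_hom_fhom[OF P tensor_dmod g(1)]
  have yW: "y \<in> coords (mdim P)" using y(1) by (simp add: RP.wt_def)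
  have gyW: "mop g y \<in> coords (mdim T)" using fg yW by (simp add: fhom_def)
  have hg: "h (mop g y) = unit_seq ?j"
    using mop_mult[OF mod_hom_carrier[OF hm(1)] mod_hom_carrier[OF g(1)], of y] g(2) hm(2)[OF gyW] y(2) by simp
  show thesis
  proof (rule that[of y "mop f" "mop g"])
    show "act T (Grp a) (mop g y) = scl (\<psi> (a, \<one>\<^bsub>\<Gamma>\<^esub>)) (mop g y)"
      using hom_wtv[OF P tensor_dmod g(1) y(1)] a_G unfolding RT.wt_def by blast
  next
    fix R and v :: "nat \<Rightarrow> 'k"
    assume R: "poly R (cval s) \<noteq> 0" and v: "v \<in> coords (mdim P)"
    have "fhom T P (\<lambda>u. RP.pact R (mop f u))"
      unfolding fhom_def
    proof (intro conjI ballI)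
      show "module_hom scl scl (\<lambda>u. RP.pact R (mop f u))"
        by unfold_locales (simp_all add: mop_lin RP.pact_vadd RP.pact_vscale)
    qed (use ff in \<open>auto simp: fhom_def RP.pact_W RP.pact_gens\<close>)
    from fhom_mod_hom[OF this okT okP] obtain k where k: "k \<in> mod_hom D T P"
      "\<And>u. u \<in> coords (mdim T) \<Longrightarrow> mop k u = RP.pact R (mop f u)" by blast
    have "surj_mat (\<pi> * k)"
    proof (subst surj_mat_iff[of _ l "mdim T"])
      show "\<pi> * k \<in> carrier_mat l (mdim T)"
        using mod_hom_carrier[OF \<pi>(1)] mod_hom_carrier[OF k(1)] by auto
      show "\<forall>w\<in>coords l. \<exists>u\<in>coords (mdim T). mop (\<pi> * k) u = w"
      proof
        fix w :: "nat \<Rightarrow> 'k" assume w: "w \<in> coords l"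
        then have "scl (inverse (poly R (cval s))) w \<in> coords l" by (intro fs.subspace_scale[OF subspace_coords])
        then obtain u where u: "u \<in> coords (mdim T)" "h u = scl (inverse (poly R (cval s))) w" using hsurj by blast
        have fu: "mop f u \<in> coords (mdim P)" using ff u(1) by (simp add: fhom_def)
        have "h u \<in> coords l" using fh u(1) by (simp add: fhom_def)
        then have "mop \<pi> (mop k u) = w"
          unfolding k(2)[OF u(1)] fhom_pact[OF P S f\<pi> fu] h_def[symmetric]
          using pactS u(2) R by simp
        then show "\<exists>u\<in>coords (mdim T). mop (\<pi> * k) u = w"
          using mop_mult[OF mod_hom_carrier[OF \<pi>(1)] mod_hom_carrier[OF k(1)]] u(1) by metis
      qed
    qed
    from ess[OF k(1) tensor_dmod this] have "\<exists>u\<in>coords (mdim T). mop k u = v"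
      using v surj_mat_iff[OF mod_hom_carrier[OF k(1)]] by blast
    then show "\<exists>u\<in>coords (mdim T). RP.pact R (mop f u) = v" using k(2) by metis
  next
    fix q assume q: "mop g y = RT.pact q t"
    have "unit_seq ?j = h (RT.pact q t)" using hg q by simp
    also have "\<dots> = scl (poly q (cval s)) (unit_seq ?j)"
      unfolding fhom_pact[OF tensor_dmod S fh tW] ht using pactS[of "unit_seq ?j"] l(1) by simp
    finally have "unit_seq ?j ?j = scl (poly q (cval s)) (unit_seq ?j) ?j" by (rule fun_cong)
    then show "poly q (cval s) = 1" by (simp add: unit_seq_def scl_apply)
  qed (use P yW ff fg in auto)
qed

end

context dd_verma_tensor
begin

text \<open>Group the factors by the representative in \<open>J\<close>; no value occurs more than \<open>n\<close> times.\<close>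

lemma linear_factors_dvd:
  fixes c :: "nat \<Rightarrow> 'k"
  assumes "finite J" "J \<subseteq> {..<n}" "inj_on c J" "\<And>k. k < n \<Longrightarrow> \<exists>s\<in>J. c k = c s"
  shows "(\<Prod>k<n. [:- c k, 1:]) dvd (\<Prod>s\<in>J. [:- c s, 1:] ^ n)"
proof -
  obtain g where g: "\<And>k. k < n \<Longrightarrow> g k \<in> J \<and> c k = c (g k)" using assms(4) by metis
  have "(\<Prod>k<n. [:- c k, 1:]) = (\<Prod>s\<in>J. \<Prod>k\<in>{k \<in> {..<n}. g k = s}. [:- c k, 1:])"
    by (rule prod.group[symmetric]) (use g assms in auto)
  also have "\<dots> = (\<Prod>s\<in>J. [:- c s, 1:] ^ card {k \<in> {..<n}. g k = s})"
  proof (rule prod.cong[OF refl])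
    fix s
    have "(\<Prod>k\<in>{k \<in> {..<n}. g k = s}. [:- c k, 1:]) = (\<Prod>k\<in>{k \<in> {..<n}. g k = s}. [:- c s, 1:])"
      by (rule prod.cong) (use g in auto)
    then show "(\<Prod>k\<in>{k \<in> {..<n}. g k = s}. [:- c k, 1:]) = [:- c s, 1:] ^ card {k \<in> {..<n}. g k = s}"
      by simp
  qed
  also have "\<dots> dvd (\<Prod>s\<in>J. [:- c s, 1:] ^ n)"
  proof (rule prod_dvd_prod)
    fix s
    have "card {k \<in> {..<n}. g k = s} \<le> card {..<n}" by (rule card_mono) auto
    then show "[:- c s, 1:] ^ card {k \<in> {..<n}. g k = s} dvd [:- c s, 1:] ^ n" by (simp add: le_imp_power_dvd)
  qed
  finally show ?thesis .
qed

text \<open>The polynomial \<open>E s\<close> has a zero of high order at the eigenvalues of all indices except \<open>s\<close>. It acts as \<open>0\<close> on the other covers and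
keeps \<open>T \<rightarrow> P s\<close> surjective, hence the joint map \<open>\<Phi>\<close> is onto. Applied to the lifts \<open>H s (y s)\<close>, which are polynomials in the
Casimir operator applied to \<open>t\<close>, the \<open>E s\<close> combine to a polynomial without zeros at the eigenvalues; it can be
inverted on \<open>T\<close>, so that \<open>t\<close> lies in the image of \<open>\<Psi>\<close>.\<close>

theorem decomposition:
  assumes J: "J \<subseteq> {..<n}" and inj: "inj_on cval J" and all: "\<And>k. k < n \<Longrightarrow> \<exists>s\<in>J. cval k = cval s"
    and l: "\<And>s. s \<in> J \<Longrightarrow> n - 1 - s < l s \<and> l s \<le> n"
    and alpha: "\<And>s i. s \<in> J \<Longrightarrow> 1 \<le> i \<Longrightarrow> i < l s \<Longrightarrow> alpha_coeff D (phi_shift D s \<nu>) i \<noteq> 0"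
    and cover: "\<And>s. s \<in> J \<Longrightarrow> projective_cover D (P s) (simple_mod D (l s) (phi_shift D s \<nu>))"
    and Q: "carriers_ok Q" "biprod Q J P \<iota> p"
  shows "mod_iso D T Q"
proof -
  have fin: "finite J" using J finite_subset by blast
  define C where "C s y F H \<longleftrightarrow> is_dmod D (P s) \<and> y \<in> coords (mdim (P s)) \<and> fhom T (P s) F \<and> fhom (P s) T H \<and>
    act T (Grp a) (H y) = scl (\<psi> (a, \<one>\<^bsub>\<Gamma>\<^esub>)) (H y) \<and>
    (\<forall>R v. poly R (cval s) \<noteq> 0 \<longrightarrow> v \<in> coords (mdim (P s)) \<longrightarrow>
       (\<exists>u\<in>coords (mdim T). dd_rep.pact D scl (act (P s)) R (F u) = v)) \<and>
    (\<forall>q. H y = RT.pact q t \<longrightarrow> poly q (cval s) = 1)" for s y F H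
  have "\<exists>y F H. C s y F H" if s: "s \<in> J" for s
    unfolding C_def by (rule cover_data[of s "l s" "P s"]) (use s J l alpha cover in blast)+
  then obtain y F H where C: "\<And>s. s \<in> J \<Longrightarrow> C s (y s) (F s) (H s)" by metis
  have P: "\<And>s. s \<in> J \<Longrightarrow> is_dmod D (P s)" and y: "\<And>s. s \<in> J \<Longrightarrow> y s \<in> coords (mdim (P s))"
    and F: "\<And>s. s \<in> J \<Longrightarrow> fhom T (P s) (F s)" and H: "\<And>s. s \<in> J \<Longrightarrow> fhom (P s) T (H s)"
    and Hy: "\<And>s. s \<in> J \<Longrightarrow> act T (Grp a) (H s (y s)) = scl (\<psi> (a, \<one>\<^bsub>\<Gamma>\<^esub>)) (H s (y s))"
    and surj: "\<And>s R v. s \<in> J \<Longrightarrow> poly R (cval s) \<noteq> 0 \<Longrightarrow> v \<in> coords (mdim (P s)) \<Longrightarrow>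
       \<exists>u\<in>coords (mdim T). dd_rep.pact D scl (act (P s)) R (F s u) = v"
    and one: "\<And>s q. s \<in> J \<Longrightarrow> H s (y s) = RT.pact q t \<Longrightarrow> poly q (cval s) = 1"
    using C unfolding C_def by blast+
  have \<iota>: "fhom (P s) Q (\<iota> s)" "fhom Q (P s) (p s)" if "s \<in> J" for s
    using Q(2) that by (auto simp: biprod_def)
  have p\<iota>: "p i (\<iota> j v) = (if i = j then v else 0)" if "i \<in> J" "j \<in> J" "v \<in> coords (mdim (P j))" for i j v
    using Q(2) that by (auto simp: biprod_def)
  have Qsum: "v = (\<Sum>s\<in>J. \<iota> s (p s v))" if "v \<in> coords (mdim Q)" for v
    using Q(2) that by (auto simp: biprod_def)
  have tW: "t \<in> coords (mdim T)" by (rule RT.z_W[OF t_wt])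
  define E where "E s = (\<Prod>j\<in>J - {s}. [:- cval j, 1:] ^ n)" for s
  define M where "M = (\<Prod>j\<in>J. [:- cval j, 1:] ^ n)"
  have ME: "M = [:- cval s, 1:] ^ n * E s" if "s \<in> J" for s
    unfolding M_def E_def using fin that by (simp add: prod.remove)
  have E0: "poly (E s) (cval j) = 0" if "s \<in> J" "j \<in> J" "j \<noteq> s" for s j
  proof -
    have "poly (E s) (cval j) = (\<Prod>i\<in>J - {s}. (cval j - cval i) ^ n)"
      by (simp add: E_def poly_prod)
    also have "\<dots> = 0" by (subst prod_zero_iff) (use fin that n_pos in auto)
    finally show ?thesis .
  qed
  have E1: "poly (E s) (cval s) \<noteq> 0" if "s \<in> J" for s
  proof -
    have "poly (E s) (cval s) = (\<Prod>i\<in>J - {s}. (cval s - cval i) ^ n)"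
      by (simp add: E_def poly_prod)
    also have "\<dots> \<noteq> 0" by (subst prod_zero_iff) (use fin that inj in \<open>auto dest: inj_onD\<close>)
    finally show ?thesis .
  qed
  have M0: "RT.pact (R * M) u = 0" if "u \<in> coords (mdim T)" for R u
  proof -
    obtain R' where "M = (\<Prod>k<n. [:- cval k, 1:]) * R'"
      using linear_factors_dvd[OF fin J inj all] unfolding M_def by blast
    then have "R * M = (R * R') * (\<Prod>k<n. [:- cval k, 1:])" by (simp add: mult_ac)
    then show ?thesis by (simp only: RT.pact_mult cas_annihilates[OF that] RT.pact_vzero)
  qed
  have hF: "F s (RT.pact R u) = dd_rep.pact D scl (act (P s)) R (F s u)" if "s \<in> J" "u \<in> coords (mdim T)" for s R u
    by (rule fhom_pact[OF tensor_dmod P F]) (use that in auto)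
  have Fc: "F s u \<in> coords (mdim (P s))" if "s \<in> J" "u \<in> coords (mdim T)" for s u
    using F[OF that(1)] that(2) by (simp add: fhom_def)
  \<comment> \<open>\<open>P j\<close> is a quotient of the part of \<open>T\<close> on which only the eigenvalue \<open>cval j\<close> survives.\<close>
  have kill: "dd_rep.pact D scl (act (P j)) (E s) v = 0" if sj: "s \<in> J" "j \<in> J" "s \<noteq> j" and v: "v \<in> coords (mdim (P j))" for s j v
  proof -
    obtain u where u: "u \<in> coords (mdim T)" "dd_rep.pact D scl (act (P j)) (E j) (F j u) = v"
      using surj[OF sj(2) E1[OF sj(2)] v] by blast
    have "[:- cval s, 1:] ^ n dvd E j"
      unfolding E_def using fin sj by (intro dvd_prodI) auto
    then obtain R where R: "E j = [:- cval s, 1:] ^ n * R" by blast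
    have "E s * E j = R * M" unfolding ME[OF sj(1)] R by (simp add: mult_ac)
    then have "F j (RT.pact (E s * E j) u) = F j 0" by (simp only: M0[OF u(1)])
    also have "\<dots> = 0" using F[OF sj(2)] module_hom.zero[of scl scl] unfolding fhom_def by blast
    finally have "F j (RT.pact (E s * E j) u) = 0" .
    then show ?thesis
      unfolding hF[OF sj(2) u(1)] dd_rep.pact_mult[OF dd_rep_act[OF P[OF sj(2)]]] u(2) .
  qed
  define \<Phi> where "\<Phi> u = (\<Sum>s\<in>J. \<iota> s (F s u))" for u
  define \<Psi> where "\<Psi> v = (\<Sum>s\<in>J. H s (p s v))" for v
  have fsum: "fhom A B (\<lambda>u. \<Sum>s\<in>J. K s u)" if K: "\<And>s. s \<in> J \<Longrightarrow> fhom A B (K s)" for A B and K :: "nat \<Rightarrow> (nat \<Rightarrow> 'k) \<Rightarrow> nat \<Rightarrow> 'k"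
    unfolding fhom_def
  proof (intro conjI ballI)
    show "module_hom scl scl (\<lambda>u. \<Sum>s\<in>J. K s u)" by (rule mh_sum) (use K in \<open>simp add: fhom_def\<close>)
    show "(\<Sum>s\<in>J. K s v) \<in> coords (mdim B)" if "v \<in> coords (mdim A)" for v
      by (rule fs.subspace_sum[OF subspace_coords]) (use K that in \<open>simp add: fhom_def\<close>)
    show "(\<Sum>s\<in>J. K s (act A r v)) = act B r (\<Sum>s\<in>J. K s v)" if "r \<in> dd_gens D" "v \<in> coords (mdim A)" for r v
      unfolding act_def[of B] mop_lin unfolding act_def[of B, symmetric]
      by (rule sum.cong) (use K that in \<open>simp_all add: fhom_def\<close>)
  qed
  have f\<Phi>: "fhom T Q \<Phi>" unfolding \<Phi>_def by (rule fsum, rule fhom_comp[OF F \<iota>(1)]) auto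
  have f\<Psi>: "fhom Q T \<Psi>" unfolding \<Psi>_def by (rule fsum, rule fhom_comp[OF \<iota>(2) H]) auto
  have \<Phi>surj: "\<exists>u\<in>coords (mdim T). \<Phi> u = v" if v: "v \<in> coords (mdim Q)" for v
  proof -
    have pv: "p s v \<in> coords (mdim (P s))" if "s \<in> J" for s using \<iota>(2)[OF that] v by (simp add: fhom_def)
    have "\<exists>u\<in>coords (mdim T). dd_rep.pact D scl (act (P s)) (E s) (F s u) = p s v" if "s \<in> J" for s
      by (rule surj[OF that E1[OF that] pv[OF that]])
    then obtain u where u: "\<And>s. s \<in> J \<Longrightarrow> u s \<in> coords (mdim T)"
      "\<And>s. s \<in> J \<Longrightarrow> dd_rep.pact D scl (act (P s)) (E s) (F s (u s)) = p s v" by metis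
    define w where "w = (\<Sum>s\<in>J. RT.pact (E s) (u s))"
    have wW: "w \<in> coords (mdim T)" unfolding w_def by (intro fs.subspace_sum[OF subspace_coords] RT.pact_W u)
    have "F j w = p j v" if j: "j \<in> J" for j
    proof -
      have "module_hom scl scl (F j)" using F[OF j] by (simp add: fhom_def)
      then have "F j w = (\<Sum>s\<in>J. F j (RT.pact (E s) (u s)))" unfolding w_def by (rule module_hom.sum)
      also have "\<dots> = (\<Sum>s\<in>J. if s = j then p j v else 0)"
        by (rule sum.cong) (use u kill[OF _ j] Fc[OF j] in \<open>auto simp: hF[OF j] simp del: mdim_T\<close>)
      finally show ?thesis using fin j by simp
    qed
    then have "\<Phi> w = (\<Sum>s\<in>J. \<iota> s (p s v))" unfolding \<Phi>_def by (intro sum.cong refl) simp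
    then show ?thesis using Qsum[OF v] wW by metis
  qed
  have \<Psi>surj: "\<exists>v\<in>coords (mdim Q). \<Psi> v = u" if u: "u \<in> coords (mdim T)" for u
  proof -
    let ?U = "\<Psi> ` coords (mdim Q)"
    have lin: "module_hom scl scl \<Psi>" using f\<Psi> by (simp add: fhom_def)
    have sub: "fs.subspace ?U"
      by (rule module_hom.subspace_image[OF lin subspace_coords])
    have sub': "act T r w \<in> ?U" if r: "r \<in> dd_gens D" and w: "w \<in> ?U" for r w
    proof -
      obtain v where v: "v \<in> coords (mdim Q)" "w = \<Psi> v" using w by blast
      have "act T r w = \<Psi> (act Q r v)" using f\<Psi> r v by (simp add: fhom_def)
      then show ?thesis using act_coords[OF Q(1) r] by blast
    qed
    have Hc: "H s v \<in> coords (mdim T)" if "s \<in> J" "v \<in> coords (mdim (P s))" for s v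
      using H[OF that(1)] that(2) by (simp add: fhom_def)
    have "\<exists>q. H s (y s) = RT.pact q t" if "s \<in> J" for s
      by (rule weight_space[OF Hc[OF that y[OF that]] Hy[OF that]])
    then obtain q where q: "\<And>s. s \<in> J \<Longrightarrow> H s (y s) = RT.pact (q s) t" by metis
    have PW: "dd_rep.pact D scl (act (P s)) R (y s) \<in> coords (mdim (P s))" if "s \<in> J" for s R
      by (rule dd_rep.pact_W[OF dd_rep_act[OF P[OF that]] y[OF that]])
    define v where "v = (\<Sum>s\<in>J. \<iota> s (dd_rep.pact D scl (act (P s)) (E s) (y s)))"
    have vW: "v \<in> coords (mdim Q)"
      unfolding v_def using \<iota>(1) PW by (intro fs.subspace_sum[OF subspace_coords]) (simp add: fhom_def)
    have pv: "p s v = dd_rep.pact D scl (act (P s)) (E s) (y s)" if s: "s \<in> J" for s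
    proof -
      have "module_hom scl scl (p s)" using \<iota>(2)[OF s] by (simp add: fhom_def)
      then have "p s v = (\<Sum>j\<in>J. p s (\<iota> j (dd_rep.pact D scl (act (P j)) (E j) (y j))))"
        unfolding v_def by (rule module_hom.sum)
      also have "\<dots> = (\<Sum>j\<in>J. if j = s then dd_rep.pact D scl (act (P s)) (E s) (y s) else 0)"
        by (rule sum.cong) (use p\<iota>[OF s] PW in auto)
      finally show ?thesis using fin s by simp
    qed
    define R where "R = (\<Sum>s\<in>J. E s * q s)"
    have "\<Psi> v = (\<Sum>s\<in>J. RT.pact (E s) (H s (y s)))"
      unfolding \<Psi>_def by (intro sum.cong refl) (simp add: pv fhom_pact[OF P tensor_dmod H y])
    also have "\<dots> = RT.pact R t"
      unfolding R_def RT.pact_sum[OF fin] by (intro sum.cong refl) (simp add: q RT.pact_mult)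
    finally have RU: "RT.pact R t \<in> ?U" using vW by (metis imageI)
    have "poly R (cval j) \<noteq> 0" if j: "j \<in> J" for j
    proof -
      have "poly R (cval j) = (\<Sum>s\<in>J. poly (E s) (cval j) * poly (q s) (cval j))"
        by (simp add: R_def poly_sum)
      also have "\<dots> = (\<Sum>s\<in>J. if s = j then poly (E j) (cval j) else 0)"
        by (rule sum.cong) (use E0[OF _ j] one[OF j q[OF j]] in auto)
      finally show ?thesis using fin j E1[OF j] by simp
    qed
    then obtain B B' where "B * R + B' * M = 1"
      using bezout_linear_factors[OF fin, of R cval n] unfolding M_def by blast
    then have "RT.pact (B * R + B' * M) t = t" by simp
    then have "RT.pact B (RT.pact R t) = t" by (simp only: RT.pact_add RT.pact_mult[of B] M0[OF tW] add_0_right)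
    moreover have "RT.pact B (RT.pact R t) \<in> ?U" by (rule RT.pact_submodule[OF sub sub' RU])
    ultimately have "t \<in> ?U" by simp
    then have "lev \<subseteq> ?U" by (rule RT.level_minimal[OF sub]) (auto intro: sub' x_gens xi_gens)
    then show ?thesis using coords_level u by blast
  qed
  have okT: "carriers_ok T" using tensor_dmod by (simp add: carriers_ok_def is_dmod_def)
  obtain f where f: "f \<in> mod_hom D T Q" "\<And>u. u \<in> coords (mdim T) \<Longrightarrow> mop f u = \<Phi> u"
    using fhom_mod_hom[OF f\<Phi> okT Q(1)] by blast
  obtain g where g: "g \<in> mod_hom D Q T" "\<And>u. u \<in> coords (mdim Q) \<Longrightarrow> mop g u = \<Psi> u"
    using fhom_mod_hom[OF f\<Psi> Q(1) okT] by blast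
  have sf: "surj_mat f"
    unfolding surj_mat_iff[OF mod_hom_carrier[OF f(1)]] using \<Phi>surj f(2) by metis
  have sg: "surj_mat g"
    unfolding surj_mat_iff[OF mod_hom_carrier[OF g(1)]] using \<Psi>surj g(2) by metis
  have "mdim Q = mdim T"
    using surj_mat_dim[OF mod_hom_carrier[OF f(1)] sf] surj_mat_dim[OF mod_hom_carrier[OF g(1)] sg] by simp
  then have "invertible_mat f"
    using surj_square_invertible[of f "mdim T"] mod_hom_carrier[OF f(1)] sf by simp
  moreover have "is_dmod D Q" by (rule is_dmod_image[OF tensor_dmod Q(1) f\<Phi> \<Phi>surj])
  ultimately show ?thesis unfolding mod_iso_def using tensor_dmod f(1) by blast
qed

section \<open>Coincidences among the eigenvalues\<close>

lemma nu_a: "\<nu> (a, \<one>\<^bsub>\<Gamma>\<^esub>) = at_achi D \<nu> * \<nu> (\<one>\<^bsub>G\<^esub>, \<chi>)"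
  using at_achi_eq[OF nu_Lam] by simp

text \<open>The two summands of \<open>cval i\<close> have a product that does not depend on \<open>i\<close>, so two such sums agree iff
their summands agree, possibly in the other order.\<close>

lemma cval_eq_iff: "cval i = cval j \<longleftrightarrow> \<rho> ^ i = \<rho> ^ j \<or> \<rho> ^ (i + j) = \<rho> * at_achi D \<nu>"
proof -
  define x y where "x = \<rho> ^ i" and "y = \<rho> ^ j"
  let ?z = "at_achi D \<nu>" and ?h = "\<nu> (\<one>\<^bsub>G\<^esub>, \<chi>)"
  have nz: "x \<noteq> 0" "y \<noteq> 0" "?h \<noteq> 0" using rho_nz Lam_nz[OF nu_Lam G.one_closed chi_Gam] by (auto simp: x_def y_def)
  have "cval i = ?h * (\<rho> * ?z / x + x)" "cval j = ?h * (\<rho> * ?z / y + y)"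
    by (simp_all add: cval_def nu_a x_def y_def power_inverse divide_inverse algebra_simps)
  then have "cval i = cval j \<longleftrightarrow> \<rho> * ?z / x + x = \<rho> * ?z / y + y" using nz by simp
  also have "\<dots> \<longleftrightarrow> (x - y) * (x * y - \<rho> * ?z) = 0"
    using nz by (simp add: field_simps)
  also have "\<dots> \<longleftrightarrow> x = y \<or> x * y = \<rho> * ?z" by simp
  finally show ?thesis by (simp add: x_def y_def power_add)
qed

lemma rho_mod: "\<rho> ^ i = \<rho> ^ (i mod n)"
proof -
  have "\<rho> ^ i = \<rho> ^ (n * (i div n) + i mod n)" by simp
  then show ?thesis unfolding power_add power_mult by (simp add: rho_n)
qed

lemma rho_eq_mod: "\<rho> ^ i = \<rho> ^ j \<longleftrightarrow> i mod n = j mod n"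
proof
  assume "\<rho> ^ i = \<rho> ^ j"
  then have "\<rho> ^ (i mod n) = \<rho> ^ (j mod n)" using rho_mod by metis
  then show "i mod n = j mod n" by (intro rho_inj) (use n_pos in auto)
next
  assume "i mod n = j mod n"
  then show "\<rho> ^ i = \<rho> ^ j" using rho_mod by metis
qed

lemma at_achi_shift: "at_achi D (phi_shift D s \<nu>) * \<rho> ^ (2 * s) = at_achi D \<nu>"
proof -
  have L: "phi_shift D s \<nu> \<in> carrier \<Lambda>" by (rule phi_shift_Lam[OF nu_Lam])
  have nz: "\<nu> (\<one>\<^bsub>G\<^esub>, \<chi>) \<noteq> 0" by (rule Lam_nz[OF nu_Lam G.one_closed chi_Gam])
  have v: "phi_shift D s \<nu> (\<one>\<^bsub>G\<^esub>, \<chi>) = \<rho> ^ s * \<nu> (\<one>\<^bsub>G\<^esub>, \<chi>)"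
    "phi_shift D s \<nu> (a, \<one>\<^bsub>\<Gamma>\<^esub>) = inverse \<rho> ^ s * \<nu> (a, \<one>\<^bsub>\<Gamma>\<^esub>)"
    by (simp_all add: phi_shift_apply a_G chi_Gam chi_a Gam_one_apply char_one[OF chi_Gam])
  have "at_achi D (phi_shift D s \<nu>) * \<rho> ^ s * \<nu> (\<one>\<^bsub>G\<^esub>, \<chi>) = inverse \<rho> ^ s * (at_achi D \<nu> * \<nu> (\<one>\<^bsub>G\<^esub>, \<chi>))"
    using at_achi_eq[OF L] unfolding v nu_a by (simp add: mult_ac)
  then have "at_achi D (phi_shift D s \<nu>) * \<rho> ^ s = inverse \<rho> ^ s * at_achi D \<nu>" using nz by simp
  then have "at_achi D (phi_shift D s \<nu>) * \<rho> ^ s * \<rho> ^ s = at_achi D \<nu>" using rho_nz by (simp add: power_inverse)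
  then show ?thesis by (simp add: mult_2 power_add mult.assoc)
qed

text \<open>The label condition says that \<open>\<nu>(a \<chi>\<^sup>-\<^sup>1)\<close> is not a power of \<open>\<rho>\<close>, which excludes all coincidences of eigenvalues.\<close>

lemma semisimple_case:
  assumes "\<nu> \<in> I_n_prime D"
  shows "mod_iso D T (mod_dsum (map (\<lambda>s. simple_mod D n (phi_shift D s \<nu>)) [0..<n]))"
proof -
  let ?P = "\<lambda>s. simple_mod D n (phi_shift D s \<nu>)"
  have not: "at_achi D \<nu> \<noteq> \<rho> ^ k" for k
  proof -
    have "k mod n \<le> n - 1" using n_pos by (simp add: less_Suc_eq_le[symmetric])
    then have "at_achi D \<nu> \<noteq> \<rho> ^ (k mod n)" using assms by (simp add: I_n_prime_def)
    then show ?thesis using rho_mod by metis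
  qed
  have I: "phi_shift D s \<nu> \<in> I_set D n" for s
  proof -
    have "at_achi D (phi_shift D s \<nu>) \<noteq> \<rho> ^ k" for k
      using not[of "k + 2 * s"] at_achi_shift[of s] by (auto simp: power_add)
    then show ?thesis using phi_shift_Lam[OF nu_Lam] n2 by (simp add: I_set_def I_n_prime_def)
  qed
  have "\<rho> * at_achi D \<nu> \<noteq> \<rho> ^ k" for k
  proof
    assume "\<rho> * at_achi D \<nu> = \<rho> ^ k"
    then have "\<rho> ^ (n - 1) * (\<rho> * at_achi D \<nu>) = \<rho> ^ (n - 1 + k)" by (simp add: power_add)
    moreover have "\<rho> ^ (n - 1) * \<rho> = 1" using rho_n n_pos by (metis Suc_pred' power_Suc2)
    ultimately have "at_achi D \<nu> = \<rho> ^ (n - 1 + k)" by (simp flip: mult.assoc)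
    then show False using not by blast
  qed
  then have "inj_on cval {..<n}" unfolding inj_on_def cval_eq_iff using rho_inj by (metis lessThan_iff)
  moreover have "carriers_ok (?P s)" for s by (simp add: carriers_ok_def simple_carrier)
  then obtain \<iota> p where "carriers_ok (mod_dsum (map ?P [0..<n]))" "biprod (mod_dsum (map ?P [0..<n])) {..<n} ?P \<iota> p"
    using biprod_list[of "[0..<n]" ?P] by (auto simp: atLeast0LessThan)
  ultimately show ?thesis
    by (intro decomposition[where J = "{..<n}" and P = ?P and l = "\<lambda>_. n"])
      (use n_pos I alpha_nonzero simple_n_cover in auto)
qed

text \<open>Here \<open>c\<^sub>i = c\<^sub>j\<close> iff \<open>i = j\<close> or \<open>i + j\<close> is \<open>l\<close> or \<open>l + n\<close>. The two index ranges are the upper halves, midpoints included, of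
\<open>{0..l}\<close> and \<open>{l + 1..<n}\<close>, on which the reflections \<open>s \<mapsto> l - s\<close> and \<open>s \<mapsto> l + n - s\<close> act.\<close>

lemma projective_case:
  assumes P: "proj_family D P" and l: "l < n" and \<nu>: "\<nu> \<in> I_set D l"
  shows "mod_iso D T (mod_dsum
             [mod_dsum (map (\<lambda>s. P (n + l - 2 * s) (phi_shift D s \<nu>)) [cfun l..<l + 1]),
              mod_dsum (map (\<lambda>s. P (2 * n + l - 2 * s) (phi_shift D s \<nu>)) [cfun (n + l)..<n])])"
proof -
  have x: "\<rho> * at_achi D \<nu> = \<rho> ^ l"
  proof (cases "l = 0")
    case True
    then show ?thesis using \<nu> rho_n n2 by (simp add: I_set_def I_n_dprime_def flip: power_Suc)
  next
    case False
    then show ?thesis using \<nu> l by (simp add: I_set_def flip: power_Suc)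
  qed
  define L where "L s = (if s \<le> l then n + l - 2 * s else 2 * n + l - 2 * s)" for s
  define R where "R s = P (L s) (phi_shift D s \<nu>)" for s
  let ?J1 = "{cfun l..l}" and ?J2 = "{cfun (n + l)..<n}"
  let ?J = "?J1 \<union> ?J2"
  have J2: "l < s" if "s \<in> ?J2" for s using that l by (auto simp: cfun_def)
  have J: "s < n" "1 \<le> L s" "L s \<le> n" "n - 1 - s < L s" if "s \<in> ?J" for s
    using that l by (auto simp: L_def cfun_def)
  have I: "phi_shift D s \<nu> \<in> I_set D (L s)" if s: "s \<in> ?J" for s
  proof -
    have "\<rho> * at_achi D (phi_shift D s \<nu>) * \<rho> ^ (2 * s) = \<rho> ^ l"
      using at_achi_shift[of s] x by (simp add: mult.assoc)
    also have "\<dots> = \<rho> ^ L s * \<rho> ^ (2 * s)"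
      unfolding power_add[symmetric] rho_eq_mod using s l by (auto simp: L_def cfun_def mod_simps)
    finally have "\<rho> * at_achi D (phi_shift D s \<nu>) = \<rho> * \<rho> ^ (L s - 1)"
      using rho_nz J(2)[OF s] by (simp flip: power_Suc)
    then have "at_achi D (phi_shift D s \<nu>) = \<rho> ^ (L s - 1)" using rho_nz by simp
    then show ?thesis using phi_shift_Lam[OF nu_Lam] J[OF s] by (auto simp: I_set_def I_n_dprime_def)
  qed
  have cover: "projective_cover D (R s) (simple_mod D (L s) (phi_shift D s \<nu>))" if s: "s \<in> ?J" for s
  proof (cases "L s = n")
    case True
    then show ?thesis using P I[OF s] simple_n_cover unfolding proj_family_def R_def by auto
  next
    case False
    then show ?thesis using P I[OF s] J[OF s] unfolding proj_family_def R_def by auto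
  qed
  have inj: "inj_on cval ?J"
  proof (rule inj_onI)
    fix i j assume ij: "i \<in> ?J" "j \<in> ?J" and "cval i = cval j"
    then consider "\<rho> ^ i = \<rho> ^ j" | "(i + j) mod n = l mod n"
      unfolding cval_eq_iff x rho_eq_mod[of "i + j"] by blast
    then show "i = j"
    proof cases
      case 1
      then show ?thesis using rho_inj J(1) ij by blast
    next
      case 2
      have "i + j = l \<or> i + j = l + n"
      proof (cases "i + j < n")
        case True
        then show ?thesis using 2 l by simp
      next
        case False
        then have "(i + j) mod n = i + j - n" using J(1)[OF ij(1)] J(1)[OF ij(2)]
          by (simp add: mod_if)
        then show ?thesis using 2 l False by simp
      qed
      then show ?thesis using ij l by (auto simp: cfun_def)
    qed
  qed
  have all: "\<exists>s\<in>?J. cval k = cval s" if k: "k < n" for k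
  proof (cases "k \<in> ?J")
    case False
    show ?thesis
    proof (cases "k \<le> l")
      case True
      then have "cval k = cval (l - k)" "l - k \<in> ?J"
        using False unfolding cval_eq_iff x by (auto simp: cfun_def)
      then show ?thesis by blast
    next
      case lk: False
      then have "\<rho> ^ (k + (n + l - k)) = \<rho> ^ l" using k unfolding rho_eq_mod by simp
      moreover have "n + l - k \<in> ?J" using False lk k by (auto simp: cfun_def)
      ultimately show ?thesis unfolding cval_eq_iff x by blast
    qed
  qed blast
  have ok: "carriers_ok (R s)" if "s \<in> ?J" for s
    using cover[OF that] by (auto simp: projective_cover_def projective_dmod_def is_dmod_def carriers_ok_def)
  let ?A = "mod_dsum (map R [cfun l..<l + 1])" and ?B = "mod_dsum (map R [cfun (n + l)..<n])"
  have sets: "set [cfun l..<l + 1] = ?J1" "set [cfun (n + l)..<n] = ?J2" by auto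
  obtain \<iota>1 p1 where A: "carriers_ok ?A" "biprod ?A ?J1 R \<iota>1 p1"
    using biprod_list[OF distinct_upt, of "cfun l" "l + 1" R] ok unfolding sets by blast
  obtain \<iota>2 p2 where B: "carriers_ok ?B" "biprod ?B ?J2 R \<iota>2 p2"
    using biprod_list[OF distinct_upt, of "cfun (n + l)" n R] ok unfolding sets by blast
  obtain \<iota>3 p3 where B': "biprod (mod_dsum [?B]) ?J2 R \<iota>3 p3"
    using biprod_Cons[OF B(1) mod_dsum_Nil(2) B(2) mod_dsum_Nil(3)] unfolding Un_empty_right by blast
  have okB: "carriers_ok (mod_dsum [?B])" by (rule mod_dsum_Cons(3)[OF B(1) mod_dsum_Nil(2)])
  have "?J1 \<inter> ?J2 = {}" using J2 by fastforce
  then obtain \<iota> p where b: "biprod (mod_dsum [?A, ?B]) ?J R \<iota> p"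
    using biprod_Cons[OF A(1) okB A(2) B'] by blast
  have "mod_iso D T (mod_dsum [?A, ?B])"
  proof (rule decomposition[OF _ inj all _ _ cover mod_dsum_Cons(3)[OF A(1) okB] b])
    show "?J \<subseteq> {..<n}" using J(1) by blast
    show "n - 1 - s < L s \<and> L s \<le> n" if "s \<in> ?J" for s using J[OF that] by simp
    show "alpha_coeff D (phi_shift D s \<nu>) i \<noteq> 0" if "s \<in> ?J" "1 \<le> i" "i < L s" for s i
      by (rule alpha_nonzero[OF I[OF that(1)] that(2,3) J(3)[OF that(1)]])
  qed
  moreover have "map R [cfun l..<l + 1] = map (\<lambda>s. P (n + l - 2 * s) (phi_shift D s \<nu>)) [cfun l..<l + 1]"
    by (auto simp: R_def L_def)
  moreover have "map R [cfun (n + l)..<n] = map (\<lambda>s. P (2 * n + l - 2 * s) (phi_shift D s \<nu>)) [cfun (n + l)..<n]"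
    using J2 by (fastforce simp: R_def L_def)
  ultimately show ?thesis by (simp only:)
qed

end

theorem theorem5p13:
  fixes D :: "('g, 'k::{alg_closed_field, field_char_0}) gdatum"
    and P :: "nat \<Rightarrow> ('g \<times> ('g \<Rightarrow> 'k) \<Rightarrow> 'k) \<Rightarrow> ('g, 'k) dmod"
    and n :: nat
    and \<mu> \<mu>' \<nu> :: "'g \<times> ('g \<Rightarrow> 'k) \<Rightarrow> 'k"
    and T :: "('g, 'k) dmod"
  assumes "abelian_group_datum D"
    and "proj_family D P"
    and "n = ordn D"
    and "\<mu> \<in> I_set D n" and "\<mu>' \<in> I_set D n"
    and "\<nu> = \<mu> \<otimes>\<^bsub>Lam D\<^esub> \<mu>'"
    and "T = mod_tensor D (simple_mod D n \<mu>) (simple_mod D n \<mu>')"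
  shows "(\<nu> \<in> I_n_prime D \<longrightarrow>
           mod_iso D T (mod_dsum (map (\<lambda>s. simple_mod D n (phi_shift D s \<nu>)) [0..<n])))
       \<and> (\<forall>l\<in>{0..n - 1}. \<nu> \<in> I_set D l \<longrightarrow>
           mod_iso D T (mod_dsum
             [mod_dsum (map (\<lambda>s. P (n + l - 2 * s) (phi_shift D s \<nu>)) [cfun l..<l + 1]),
              mod_dsum (map (\<lambda>s. P (2 * n + l - 2 * s) (phi_shift D s \<nu>)) [cfun (n + l)..<n])]))"
proof -
  interpret V: dd_verma_tensor D \<mu> \<mu>'
    by unfold_locales (use assms in auto)
  have "\<nu> = V.\<nu>" unfolding V.\<nu>_def by (rule assms(6))
  moreover have "l < ordn D" if "l \<in> {0..n - 1}" for l
    using that V.n_pos assms(3) by auto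
  ultimately show ?thesis
    unfolding assms(3,7) using V.semisimple_case V.projective_case[OF assms(2)] by auto
qed

end
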